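(* Let $\mathcal{C}$ be a closed cone field on a smooth manifold $M$. If $\mathcal{C}$ is locally solvable and admits a Cauchy subset, then $\mathcal{C}$ is globally hyperbolic.
   Context: $M$ is a smooth manifold. A convex cone in a vector space $E$ is a (possibly empty) convex subset $C\subset E$ which is contained in an open half space $\{\ell>0\}$ and satisfies $tx\in C$ for all $t>0$, $x\in C$. A cone field on $M$ is a subset $\mathcal{C}\subset TM$ such that $\mathcal{C}(x):=\mathcal{C}\cap T_xM$ is a convex cone for each $x\in M$ (so $\mathcal{C}$ contains no zero vector). It is a closed cone field if $\mathcal{C}\cup T^0M$ is closed in $TM$, where $T^0M$ is the zero section. The domain $\mathcal{D}$ of $\mathcal{C}$ is the (closed) set of points $x$ with $\mathcal{C}(x)\neq\emptyset$. A curve $\gamma:I\to M$ ($I$ an interval) is causal if it is locally Lipschitz and $\dot\gamma(t)\in\mathcal{C}(\gamma(t))$ for almost all $t\in I$; the trivial curve $\{0\}\mapsto x$ is declared causal if and only if $x\in\mathcal{D}$. A causal curve is inextensible if neither it nor any causal curve obtained from it by an increasing reparametrization can be extended to a causal curve on a strictly larger interval. $\mathcal{J}^+(x)$ (resp. $\mathcal{J}^{++}(x)$) is the set of $y\in M$ for which there is a causal curve $\gamma:[0,T]\to M$ with $T\geq 0$ (resp. $T>0$), $\gamma(0)=x$, $\gamma(T)=y$. $\mathcal{J}^-(x)=\{x': x\in\mathcal{J}^+(x')\}$ and $\mathcal{J}^\pm(A)=\bigcup_{x\in A}\mathcal{J}^\pm(x)$. $\mathcal{C}$ is locally solvable if for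 each $x\in\mathcal{D}$ there is a nonconstant causal curve $\gamma:]-1,1[\to M$ with $\gamma(0)=x$. $\mathcal{C}$ is causal if $x\notin\mathcal{J}^{++}(x)$ for all $x\in M$; hyperbolic if it is causal and $\mathcal{J}^+(K)\cap\mathcal{J}^-(K')$ is compact for all compact $K,K'\subset M$; globally hyperbolic if it is hyperbolic and locally solvable. For locally solvable $\mathcal{C}$, a subset $H\subset M$ is a Cauchy subset if there exist a neighborhood $\tilde M$ of $\mathcal{D}$ and two open sets $U^\pm$ of $\tilde M$ such that $U^+$, $U^-$ and $\tilde M\cap H$ form a partition of $\tilde M$ and such that, for each inextensible causal curve $\gamma:\mathbb{R}\to M$, there exist two finite times $a\leq b$ with $\gamma(]-\infty,a[)\subset U^-$, $\gamma(]b,\infty[)\subset U^+$ and $\gamma([a,b])\subset H$. *)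

theory Defs
  imports "HOL-Analysis.Analysis" "HOL-Library.Function_Algebras"
begin

section \<open>Pointwise vector space structure on functions\<close>

instantiation "fun" :: (type, real_vector) real_vector
begin

definition scaleR_fun :: "real \<Rightarrow> ('a \<Rightarrow> 'b) \<Rightarrow> 'a \<Rightarrow> 'b"
  where "scaleR_fun r f = (\<lambda>x. r *\<^sub>R f x)"

instance
  by standard (simp_all add: scaleR_fun_def fun_eq_iff scaleR_add_right scaleR_add_left)

end

section \<open>Smooth manifolds\<close>

text \<open>
  The manifold is a whole type \<open>'m\<close>, Hausdorff and second countable. The model space \<open>'e\<close> has
  sort \<open>{real_inner, heine_borel}\<close> in the main statement: these are exactly the finite-dimensional
  Euclidean spaces, including dimension 0 (which the class \<open>euclidean_space\<close> excludes).
\<close>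

fun higher_differentiable_on ::
  "'a::real_normed_vector set \<Rightarrow> ('a \<Rightarrow> 'b::real_normed_vector) \<Rightarrow> nat \<Rightarrow> bool"
where
  "higher_differentiable_on S f 0 \<longleftrightarrow> continuous_on S f"
| "higher_differentiable_on S f (Suc k) \<longleftrightarrow>
     (\<forall>x\<in>S. f differentiable (at x)) \<and>
     (\<forall>v. higher_differentiable_on S (\<lambda>x. frechet_derivative f (at x) v) k)"

definition smooth_on :: "'a::real_normed_vector set \<Rightarrow> ('a \<Rightarrow> 'b::real_normed_vector) \<Rightarrow> bool"
  where "smooth_on S f \<longleftrightarrow> (\<forall>k. higher_differentiable_on S f k)"

text \<open>A chart \<open>(U, \<phi>)\<close>; the values of \<open>\<phi>\<close> outside \<open>U\<close> are irrelevant.\<close>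

type_synonym ('m, 'e) chart = "'m set \<times> ('m \<Rightarrow> 'e)"

definition transition :: "('m, 'e) chart \<Rightarrow> ('m, 'e) chart \<Rightarrow> 'e \<Rightarrow> 'e"
  where "transition c d = snd d \<circ> inv_into (fst c) (snd c)"

definition smooth_atlas ::
  "('m::topological_space, 'e::real_normed_vector) chart set \<Rightarrow> bool"
where
  "smooth_atlas A \<longleftrightarrow>
     (\<Union>c\<in>A. fst c) = UNIV \<and>
     (\<forall>c\<in>A. open (fst c) \<and> open (snd c ` fst c) \<and>
        homeomorphism (fst c) (snd c ` fst c) (snd c) (inv_into (fst c) (snd c))) \<and>
     (\<forall>c\<in>A. \<forall>d\<in>A. smooth_on (snd c ` (fst c \<inter> fst d)) (transition c d))"

section \<open>The tangent bundle\<close>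

text \<open>
  A tangent vector at \<open>x\<close> is given by its coordinates in all charts around \<open>x\<close>, related to each
  other by the derivatives of the transition maps. Coordinates in the other charts are set to 0,
  so that \<open>tangent_space A x\<close> is a linear subspace of the space of all functions.
\<close>

type_synonym ('m, 'e) tangent_vector = "('m, 'e) chart \<Rightarrow> 'e"

definition tangent_space ::
  "('m, 'e::real_normed_vector) chart set \<Rightarrow> 'm \<Rightarrow> ('m, 'e) tangent_vector set"
where
  "tangent_space A x =
     {v. (\<forall>c\<in>A. \<forall>d\<in>A. x \<in> fst c \<longrightarrow> x \<in> fst d \<longrightarrow>
            v d = frechet_derivative (transition c d) (at (snd c x)) (v c)) \<and>
         (\<forall>c. c \<notin> A \<or> x \<notin> fst c \<longrightarrow> v c = 0)}"

definition tangent_bundle ::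
  "('m, 'e::real_normed_vector) chart set \<Rightarrow> ('m \<times> ('m, 'e) tangent_vector) set"
  where "tangent_bundle A = (SIGMA x:UNIV. tangent_space A x)"

definition zero_section :: "('m \<times> ('m, 'e::real_normed_vector) tangent_vector) set"
  where "zero_section = UNIV \<times> {0}"

text \<open>
  The standard topology of the tangent bundle: a set is open iff its trace in each bundle chart
  \<open>(x, v) \<mapsto> (\<phi> x, v\<^sub>\<phi>)\<close> is open.
\<close>

definition open_in_tangent_bundle ::
  "('m, 'e::real_normed_vector) chart set \<Rightarrow> ('m \<times> ('m, 'e) tangent_vector) set \<Rightarrow> bool"
where
  "open_in_tangent_bundle A W \<longleftrightarrow>
     W \<subseteq> tangent_bundle A \<and>
     (\<forall>c\<in>A. open ((\<lambda>(x, v). (snd c x, v c)) ` (W \<inter> (fst c \<times> UNIV))))"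

definition tangent_bundle_topology ::
  "('m, 'e::real_normed_vector) chart set \<Rightarrow> ('m \<times> ('m, 'e) tangent_vector) topology"
  where "tangent_bundle_topology A = topology (open_in_tangent_bundle A)"

lemma tangent_vector_eqI:
  assumes "c \<in> A" "x \<in> fst c" "v \<in> tangent_space A x" "w \<in> tangent_space A x" "v c = w c"
  shows "v = w"
proof
  fix d
  show "v d = w d"
  proof (cases "d \<in> A \<and> x \<in> fst d")
    case True
    then have "v d = frechet_derivative (transition c d) (at (snd c x)) (v c)"
      "w d = frechet_derivative (transition c d) (at (snd c x)) (w c)"
      using assms(1-4) unfolding tangent_space_def by blast+
    then show ?thesis using assms(5) by metis
  next
    case False
    then have "v d = 0" "w d = 0"
      using assms(3,4) unfolding tangent_space_def by blast+
    then show ?thesis by metis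
  qed
qed

lemma openin_tangent_bundle_topology:
  fixes A :: "('m::topological_space, 'e::real_normed_vector) chart set"
  assumes A: "smooth_atlas A"
  shows "openin (tangent_bundle_topology A) = open_in_tangent_bundle A"
proof -
  define \<Phi> :: "('m, 'e) chart \<Rightarrow> 'm \<times> ('m, 'e) tangent_vector \<Rightarrow> 'e \<times> 'e"
    where "\<Phi> c = (\<lambda>(x, v). (snd c x, v c))" for c
  have eq: "open_in_tangent_bundle A W \<longleftrightarrow>
      W \<subseteq> tangent_bundle A \<and> (\<forall>c\<in>A. open (\<Phi> c ` (W \<inter> (fst c \<times> UNIV))))" for W
    unfolding open_in_tangent_bundle_def \<Phi>_def ..
  have inj: "inj_on (\<Phi> c) (tangent_bundle A \<inter> (fst c \<times> UNIV))" if c: "c \<in> A" for c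
  proof (rule inj_onI)
    fix p q assume p: "p \<in> tangent_bundle A \<inter> (fst c \<times> UNIV)"
      and q: "q \<in> tangent_bundle A \<inter> (fst c \<times> UNIV)" and e: "\<Phi> c p = \<Phi> c q"
    obtain x v y w where pq: "p = (x, v)" "q = (y, w)" by fastforce
    have h: "homeomorphism (fst c) (snd c ` fst c) (snd c) (inv_into (fst c) (snd c))"
      using A c unfolding smooth_atlas_def by blast
    have "snd c x = snd c y" "v c = w c" using e by (auto simp: \<Phi>_def pq)
    moreover have "x \<in> fst c" "y \<in> fst c" using p q pq by auto
    ultimately have "x = y" using h by (metis homeomorphism_apply1)
    moreover have "v \<in> tangent_space A x" "w \<in> tangent_space A y"
      using p q pq unfolding tangent_bundle_def by auto
    ultimately show "p = q"
      using tangent_vector_eqI[OF c \<open>x \<in> fst c\<close>] \<open>v c = w c\<close> pq by blast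
  qed
  have "istopology (open_in_tangent_bundle A)"
    unfolding istopology_def
  proof (intro conjI allI impI)
    fix S T assume S: "open_in_tangent_bundle A S" and T: "open_in_tangent_bundle A T"
    show "open_in_tangent_bundle A (S \<inter> T)"
      unfolding eq
    proof (intro conjI ballI)
      show "S \<inter> T \<subseteq> tangent_bundle A" using S unfolding eq by blast
      fix c assume c: "c \<in> A"
      have "\<Phi> c ` ((S \<inter> (fst c \<times> UNIV)) \<inter> (T \<inter> (fst c \<times> UNIV))) =
          \<Phi> c ` (S \<inter> (fst c \<times> UNIV)) \<inter> \<Phi> c ` (T \<inter> (fst c \<times> UNIV))"
        using S T unfolding eq by (intro inj_on_image_Int[OF inj[OF c]]) auto
      moreover have "open (\<dots>)"
        using S T c unfolding eq by blast
      moreover have "S \<inter> T \<inter> (fst c \<times> UNIV) = (S \<inter> (fst c \<times> UNIV)) \<inter> (T \<inter> (fst c \<times> UNIV))"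
        by blast
      ultimately show "open (\<Phi> c ` (S \<inter> T \<inter> (fst c \<times> UNIV)))"
        by metis
    qed
  next
    fix \<K> assume K: "\<forall>K\<in>\<K>. open_in_tangent_bundle A K"
    have "\<Phi> c ` (\<Union>\<K> \<inter> (fst c \<times> UNIV)) = (\<Union>K\<in>\<K>. \<Phi> c ` (K \<inter> (fst c \<times> UNIV)))" for c
      by blast
    with K show "open_in_tangent_bundle A (\<Union>\<K>)"
      unfolding eq by auto
  qed
  then show ?thesis
    unfolding tangent_bundle_topology_def by (simp add: topology_inverse')
qed

section \<open>Closed cone fields\<close>

text \<open>
  Linear functionals on a subspace extend to the whole space, so in \<open>strict_convex_cone\<close> it makes
  no difference whether \<open>l\<close> is defined on the tangent space or on the space of all functions.
\<close>

definition strict_convex_cone :: "'v::real_vector set \<Rightarrow> bool"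
where
  "strict_convex_cone K \<longleftrightarrow>
     convex K \<and>
     (\<exists>l :: 'v \<Rightarrow> real. linear l \<and> K \<subseteq> {v. l v > 0}) \<and>
     (\<forall>v\<in>K. \<forall>t>0. t *\<^sub>R v \<in> K)"

text \<open>The fibre of \<open>C\<close> over \<open>x\<close> is the relational image \<open>C `` {x}\<close>.\<close>

definition cone_field ::
  "('m, 'e::real_normed_vector) chart set \<Rightarrow> ('m \<times> ('m, 'e) tangent_vector) set \<Rightarrow> bool"
where
  "cone_field A C \<longleftrightarrow> C \<subseteq> tangent_bundle A \<and> (\<forall>x. strict_convex_cone (C `` {x}))"

definition closed_cone_field ::
  "('m, 'e::real_normed_vector) chart set \<Rightarrow> ('m \<times> ('m, 'e) tangent_vector) set \<Rightarrow> bool"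
where
  "closed_cone_field A C \<longleftrightarrow>
     cone_field A C \<and> closedin (tangent_bundle_topology A) (C \<union> zero_section)"

definition cone_domain :: "('m \<times> ('m, 'e) tangent_vector) set \<Rightarrow> 'm set"
  where "cone_domain C = {x. C `` {x} \<noteq> {}}"

section \<open>Causal curves\<close>

text \<open>
  A curve on an interval \<open>I\<close> is a total function on the reals whose values outside \<open>I\<close> are
  irrelevant.
\<close>

definition locally_lipschitz_curve ::
  "('m, 'e::real_normed_vector) chart set \<Rightarrow> real set \<Rightarrow> (real \<Rightarrow> 'm) \<Rightarrow> bool"
where
  "locally_lipschitz_curve A I \<gamma> \<longleftrightarrow>
     (\<forall>t\<in>I. \<exists>c\<in>A. \<exists>\<delta>>0. \<exists>L.
        \<gamma> ` (I \<inter> ball t \<delta>) \<subseteq> fst c \<and> L-lipschitz_on (I \<inter> ball t \<delta>) (snd c \<circ> \<gamma>))"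

definition has_velocity ::
  "('m, 'e::real_normed_vector) chart set \<Rightarrow> real set \<Rightarrow> (real \<Rightarrow> 'm) \<Rightarrow> real \<Rightarrow>
    ('m, 'e) tangent_vector \<Rightarrow> bool"
where
  "has_velocity A I \<gamma> t v \<longleftrightarrow>
     v \<in> tangent_space A (\<gamma> t) \<and>
     (\<forall>c\<in>A. \<gamma> t \<in> fst c \<longrightarrow> ((snd c \<circ> \<gamma>) has_vector_derivative v c) (at t within I))"

text \<open>
  On a one-point interval the almost-everywhere condition is void; there a curve is declared causal
  iff its only value lies in the domain of the cone field.
\<close>

definition causal_curve ::
  "('m, 'e::real_normed_vector) chart set \<Rightarrow> ('m \<times> ('m, 'e) tangent_vector) set \<Rightarrow>
    real set \<Rightarrow> (real \<Rightarrow> 'm) \<Rightarrow> bool"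
where
  "causal_curve A C I \<gamma> \<longleftrightarrow>
     is_interval I \<and> I \<noteq> {} \<and> locally_lipschitz_curve A I \<gamma> \<and>
     (if \<exists>t. I = {t} then \<gamma> ` I \<subseteq> cone_domain C
      else AE t in lebesgue. t \<in> I \<longrightarrow> (\<exists>v. has_velocity A I \<gamma> t v \<and> (\<gamma> t, v) \<in> C))"

definition extensible_curve ::
  "('m, 'e::real_normed_vector) chart set \<Rightarrow> ('m \<times> ('m, 'e) tangent_vector) set \<Rightarrow>
    real set \<Rightarrow> (real \<Rightarrow> 'm) \<Rightarrow> bool"
where
  "extensible_curve A C I \<gamma> \<longleftrightarrow>
     (\<exists>J \<eta>. I \<subset> J \<and> causal_curve A C J \<eta> \<and> (\<forall>t\<in>I. \<eta> t = \<gamma> t))"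

definition inextensible_causal_curve ::
  "('m, 'e::real_normed_vector) chart set \<Rightarrow> ('m \<times> ('m, 'e) tangent_vector) set \<Rightarrow>
    real set \<Rightarrow> (real \<Rightarrow> 'm) \<Rightarrow> bool"
where
  "inextensible_causal_curve A C I \<gamma> \<longleftrightarrow>
     causal_curve A C I \<gamma> \<and> \<not> extensible_curve A C I \<gamma> \<and>
     (\<forall>J s. is_interval J \<and> strict_mono_on J s \<and> s ` J = I \<and> causal_curve A C J (\<gamma> \<circ> s)
        \<longrightarrow> \<not> extensible_curve A C J (\<gamma> \<circ> s))"

section \<open>Causality and Cauchy subsets\<close>

definition causal_future ::
  "('m, 'e::real_normed_vector) chart set \<Rightarrow> ('m \<times> ('m, 'e) tangent_vector) set \<Rightarrow> 'm \<Rightarrow> 'm set"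
where
  "causal_future A C x = {y. \<exists>T\<ge>0. \<exists>\<gamma>. causal_curve A C {0..T} \<gamma> \<and> \<gamma> 0 = x \<and> \<gamma> T = y}"

definition strict_causal_future ::
  "('m, 'e::real_normed_vector) chart set \<Rightarrow> ('m \<times> ('m, 'e) tangent_vector) set \<Rightarrow> 'm \<Rightarrow> 'm set"
where
  "strict_causal_future A C x =
     {y. \<exists>T>0. \<exists>\<gamma>. causal_curve A C {0..T} \<gamma> \<and> \<gamma> 0 = x \<and> \<gamma> T = y}"

definition causal_past ::
  "('m, 'e::real_normed_vector) chart set \<Rightarrow> ('m \<times> ('m, 'e) tangent_vector) set \<Rightarrow> 'm \<Rightarrow> 'm set"
  where "causal_past A C x = {x'. x \<in> causal_future A C x'}"

definition locally_solvable ::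
  "('m, 'e::real_normed_vector) chart set \<Rightarrow> ('m \<times> ('m, 'e) tangent_vector) set \<Rightarrow> bool"
where
  "locally_solvable A C \<longleftrightarrow>
     (\<forall>x\<in>cone_domain C. \<exists>\<gamma>. causal_curve A C {-1<..<1} \<gamma> \<and>
        \<not> \<gamma> constant_on {-1<..<1} \<and> \<gamma> 0 = x)"

definition causal ::
  "('m, 'e::real_normed_vector) chart set \<Rightarrow> ('m \<times> ('m, 'e) tangent_vector) set \<Rightarrow> bool"
  where "causal A C \<longleftrightarrow> (\<forall>x. x \<notin> strict_causal_future A C x)"

definition hyperbolic ::
  "('m::topological_space, 'e::real_normed_vector) chart set \<Rightarrow>
    ('m \<times> ('m, 'e) tangent_vector) set \<Rightarrow> bool"
where
  "hyperbolic A C \<longleftrightarrow>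
     causal A C \<and>
     (\<forall>K K'. compact K \<longrightarrow> compact K' \<longrightarrow>
        compact ((\<Union>x\<in>K. causal_future A C x) \<inter> (\<Union>x\<in>K'. causal_past A C x)))"

definition globally_hyperbolic ::
  "('m::topological_space, 'e::real_normed_vector) chart set \<Rightarrow>
    ('m \<times> ('m, 'e) tangent_vector) set \<Rightarrow> bool"
  where "globally_hyperbolic A C \<longleftrightarrow> hyperbolic A C \<and> locally_solvable A C"

text \<open>
  A neighbourhood \<open>N\<close> of the domain need not be open, and the members of the partition of \<open>N\<close> may
  be empty.
\<close>

definition cauchy_subset ::
  "('m::topological_space, 'e::real_normed_vector) chart set \<Rightarrow>
    ('m \<times> ('m, 'e) tangent_vector) set \<Rightarrow> 'm set \<Rightarrow> bool"
where
  "cauchy_subset A C H \<longleftrightarrow>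
     (\<exists>N Up Um. cone_domain C \<subseteq> interior N \<and>
        openin (top_of_set N) Up \<and> openin (top_of_set N) Um \<and>
        Up \<inter> Um = {} \<and> Up \<inter> (N \<inter> H) = {} \<and> Um \<inter> (N \<inter> H) = {} \<and>
        Up \<union> Um \<union> (N \<inter> H) = N \<and>
        (\<forall>\<gamma>. inextensible_causal_curve A C UNIV \<gamma> \<longrightarrow>
           (\<exists>a b. a \<le> b \<and> \<gamma> ` {..<a} \<subseteq> Um \<and> \<gamma> ` {b<..} \<subseteq> Up \<and> \<gamma> ` {a..b} \<subseteq> H)))"

end

theory Submission
  imports Defs "HOL-Complex_Analysis.Great_Picard" "HOL-Library.Diagonal_Subsequence"
begin

text \<open>
  Near a point, a closed cone field is controlled by one linear functional \<open>l\<close> in one chart: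
  \<open>norm w \<le> l w\<close> for every cone vector \<open>w\<close> at a point of a small compact box. Causal curves in the box
  therefore increase \<open>l\<close>, move by at most the increase of \<open>l\<close>, and become uniformly Lipschitz when
  parametrised by \<open>l\<close>. Limits of such curves exist by Arzela-Ascoli, and their derivatives stay in
  the cones because the cones are convex and depend on the point in a closed way
  (\<open>cone_curve_limit\<close>). So the relation ``equal, or joined by a causal curve inside the box'' is
  closed (\<open>arc_in_eq_closed\<close>). Where \<open>l\<close> is extremal on the points related to a given point, local
  solvability would allow one to continue, unless the rim of the box is reached; hence every point
  of the domain inside the box is joined to the rim, towards the future and towards the past
  (\<open>exit_box\<close>).

  Globally, curves are replaced by discrete chains. The manifold has a locally finite cover by
  boxes, each with a smaller core. A step is a causal curve in one box between its closed core and
  its rim. Infinite chains of steps never converge, since only finitely many boxes are met near a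
  limit point and each step crosses from one compact set to a disjoint one (\<open>zigzag_diverges\<close>); for
  the same reason a causal curve from \<open>x\<close> to \<open>z\<close> is a finite chain followed by a remainder in one
  box (\<open>chain_decomposition\<close>). A two-sided infinite chain, glued together, is an inextensible
  causal curve. Given a Cauchy subset with the open sets \<open>Um\<close> and \<open>Up\<close>, it starts in \<open>Um\<close>, ends in
  \<open>Up\<close>, and never goes from \<open>Up\<close> to \<open>Um\<close>; as chains can be prolonged in both directions, no causal
  curve at all leads from \<open>Up\<close> to \<open>Um\<close> (\<open>no_return\<close>).

  Causality: a closed causal curve, run through again and again, would visit the same points
  in \<open>Um\<close> and in \<open>Up\<close>. Compactness of causal diamonds: the number of steps from a compact set \<open>K\<close>
  to a compact set \<open>K'\<close> is bounded (\<open>chain_length_bounded\<close>). Otherwise longer and longer chains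
  converge, counted from their start, to an infinite future chain, which enters \<open>Up\<close>, and, counted
  from their end, to an infinite past chain, which enters \<open>Um\<close>. Both sets are open near the domain,
  so some long chain would first meet \<open>Up\<close> and then \<open>Um\<close>. With the bound, only finitely
  many boxes are involved, and limits of chains can be taken step by step.
\<close>


section \<open>Differentiability of Lipschitz functions on the line\<close>

text \<open>
  Vitali's covering theorem extracts from the short intervals with slope below \<open>p\<close> a
  disjoint family that covers \<open>S\<close> up to a null set and stays in an open set of nearly
  the same outer measure. The image of each interval is an interval shorter than \<open>p\<close>
  times the original, and null sets have null images.
\<close>
lemma outer_measure_image_le:
  fixes g :: "real \<Rightarrow> real"
  assumes mono: "strict_mono g" and cont: "continuous_on UNIV g"
    and lip: "L-lipschitz_on UNIV g" and p: "0 < p"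
    and fine: "\<And>x d. x \<in> S \<Longrightarrow> 0 < d \<Longrightarrow>
      \<exists>u v. u \<le> x \<and> x \<le> v \<and> u < v \<and> v - u < d \<and> g v - g u < p * (v - u)"
  shows "outer_measure_of lebesgue (g ` S) \<le> ennreal p * outer_measure_of lebesgue S"
proof (rule ennreal_le_epsilon)
  fix e :: real assume "0 < e"
  obtain E where E: "E \<in> sets lebesgue" "S \<subseteq> E" "outer_measure_of lebesgue S = emeasure lebesgue E"
    using outer_measure_of_attain[of S lebesgue] by auto
  have ep: "0 < e / p" using \<open>0 < e\<close> p by simp
  obtain U where U: "open U" "E \<subseteq> U" "emeasure lebesgue (U - E) < ennreal (e / p)"
    using sets_lebesgue_outer_open[OF E(1) ep] by metis
  have Us: "U \<in> sets lebesgue" using U(1) by (simp add: borel_open sets_completionI_sets)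
  define K where "K = {(u,v). u < v \<and> {u..v} \<subseteq> U \<and> g v - g u < p * (v - u)}"
  let ?a = "\<lambda>i::real\<times>real. (fst i + snd i) / 2" and ?r = "\<lambda>i::real\<times>real. (snd i - fst i) / 2"
  have cb: "cball (?a i) (?r i) = {fst i..snd i}" for i
    by (auto simp: cball_eq_atLeastAtMost field_simps)
  have "\<exists>i. i \<in> K \<and> x \<in> cball (?a i) (?r i) \<and> ?r i < d" if "x \<in> S" "0 < d" for x d
  proof -
    obtain d' where d': "d' > 0" "ball x d' \<subseteq> U" 
      using U E(2) \<open>x \<in> S\<close> by (meson openE subsetD)
    obtain u v where uv: "u \<le> x" "x \<le> v" "u < v" "v - u < min d d'" "g v - g u < p * (v - u)"
      using fine[OF \<open>x \<in> S\<close>, of "min d d'"] d' \<open>0 < d\<close> by auto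
    have "{u..v} \<subseteq> ball x d'" using uv by (auto simp: dist_real_def)
    then have "(u, v) \<in> K" using uv d' by (auto simp: K_def)
    moreover have "x \<in> cball (?a (u, v)) (?r (u, v))" unfolding cb using uv by simp
    moreover have "?r (u, v) < d" using uv by simp
    ultimately show ?thesis by blast
  qed
  note fine_cover = this
  have pos: "0 < ?r i" if "i \<in> K" for i using that by (auto simp: K_def)
  obtain C where C: "countable C" "C \<subseteq> K"
     "pairwise (\<lambda>i j. disjnt (cball (?a i) (?r i)) (cball (?a j) (?r j))) C"
     "negligible (S - (\<Union>i \<in> C. cball (?a i) (?r i)))"
    by (rule Vitali_covering_theorem_cballs[of K ?r S ?a]) (use pos fine_cover in blast)+
  define I where "I = (\<lambda>i::real\<times>real. {fst i..snd i})"
  have disj: "disjoint_family_on I C" and neg: "negligible (S - \<Union>(I ` C))"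
    using C(3,4) by (auto simp: cb I_def disjoint_family_on_def pairwise_def disjnt_def)
  have gI: "g ` I i = {g (fst i)..g (snd i)}" if "i \<in> C" for i
  proof -
    have "fst i \<le> snd i" using that C(2) by (auto simp: K_def)
    show ?thesis unfolding I_def
    proof (intro equalityI subsetI)
      fix y assume "y \<in> {g (fst i)..g (snd i)}"
      then show "y \<in> g ` {fst i..snd i}"
        using IVT'[of g "fst i" y "snd i"] \<open>fst i \<le> snd i\<close> continuous_on_subset[OF cont] by auto
    qed (use strict_mono_less_eq[OF mono] in auto)
  qed
  have neg': "negligible (g ` (S - \<Union>(I ` C)))"
  proof (rule negligible_locally_Lipschitz_image[OF _ neg])
    fix x assume "x \<in> S - \<Union>(I ` C)"
    show "\<exists>T B. open T \<and> x \<in> T \<and> (\<forall>y\<in>(S - \<Union>(I ` C)) \<inter> T. norm (g y - g x) \<le> B * norm (y - x))"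
      using lip by (intro exI[of _ UNIV] exI[of _ L]) (auto simp: lipschitz_on_def dist_norm)
  qed simp
  have dg: "disjoint_family_on (\<lambda>i. g ` I i) C"
    unfolding disjoint_family_on_def
  proof (intro ballI impI)
    fix i j assume "i \<in> C" "j \<in> C" "i \<noteq> j"
    then have "I i \<inter> I j = {}" using disj by (auto simp: disjoint_family_on_def)
    moreover have "g ` I i \<inter> g ` I j = g ` (I i \<inter> I j)"
      using strict_mono_imp_inj_on[OF mono] by (metis image_Int inj_on_subset subset_UNIV)
    ultimately show "g ` I i \<inter> g ` I j = {}" by simp
  qed
  have sub: "g ` S \<subseteq> (\<Union>i\<in>C. g ` I i) \<union> g ` (S - \<Union>(I ` C))" by blast
  have ms: "(\<Union>i\<in>C. g ` I i) \<in> sets lebesgue"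
    using C(1) gI by (auto intro!: sets.countable_UN')
  have "outer_measure_of lebesgue (g ` S) \<le> emeasure lebesgue ((\<Union>i\<in>C. g ` I i) \<union> g ` (S - \<Union>(I ` C)))"
    unfolding outer_measure_of_def using sub ms neg' 
    by (intro INF_lower) (auto simp: negligible_imp_sets)
  also have "\<dots> \<le> emeasure lebesgue (\<Union>i\<in>C. g ` I i) + emeasure lebesgue (g ` (S - \<Union>(I ` C)))"
    using ms neg' by (intro emeasure_subadditive) (auto simp: negligible_imp_sets)
  also have "emeasure lebesgue (g ` (S - \<Union>(I ` C))) = 0"
    using neg' by (simp add: negligible_iff_null_sets null_setsD1)
  also have "emeasure lebesgue (\<Union>i\<in>C. g ` I i) + 0 = (\<integral>\<^sup>+i. emeasure lebesgue (g ` I i) \<partial>count_space C)"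
    using C(1) gI dg by (subst emeasure_UN_countable) auto
  also have "\<dots> \<le> (\<integral>\<^sup>+i. ennreal p * emeasure lebesgue (I i) \<partial>count_space C)"
  proof (rule nn_integral_mono)
    fix i assume "i \<in> space (count_space C)"
    then have i: "i \<in> C" by simp
    then have "fst i < snd i" "g (snd i) - g (fst i) < p * (snd i - fst i)" using C(2) by (auto simp: K_def)
    moreover have "g (fst i) < g (snd i)" using \<open>fst i < snd i\<close> mono by (simp add: strict_mono_less)
    ultimately show "emeasure lebesgue (g ` I i) \<le> ennreal p * emeasure lebesgue (I i)"
      using p unfolding gI[OF i] by (simp add: I_def ennreal_mult[symmetric])
  qed
  also have "\<dots> = ennreal p * emeasure lebesgue (\<Union>i\<in>C. I i)"
    using C(1) disj by (simp add: emeasure_UN_countable I_def nn_integral_cmult)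
  also have "\<dots> \<le> ennreal p * emeasure lebesgue U"
    using C(2) Us by (intro mult_left_mono emeasure_mono) (fastforce simp: K_def I_def)+
  also have "emeasure lebesgue U \<le> emeasure lebesgue E + emeasure lebesgue (U - E)"
    using emeasure_subadditive[of E lebesgue "U - E"] E(1) U(2) Us
    by (metis Un_Diff_cancel Un_absorb1 sets.Diff)
  also have "\<dots> \<le> emeasure lebesgue E + ennreal (e / p)"
    using U(3) by (intro add_left_mono) simp
  finally have "outer_measure_of lebesgue (g ` S) \<le> ennreal p * (emeasure lebesgue E + ennreal (e / p))"
    by (simp add: mult_left_mono)
  also have "\<dots> = ennreal p * outer_measure_of lebesgue S + ennreal e"
    using p \<open>0 < e\<close> E(3) by (simp add: distrib_left ennreal_mult[symmetric])
  finally show "outer_measure_of lebesgue (g ` S) \<le> ennreal p * outer_measure_of lebesgue S + ennreal e" .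
qed

text \<open>
  Let \<open>Lo p\<close> and \<open>Hi q\<close> be the sets of points with arbitrarily short
  intervals around them of slope below \<open>p\<close>, respectively above \<open>q\<close>. For
  \<open>p < q\<close> their intersection is null: the covering estimate for \<open>g\<close>
  bounds the outer measure of its image by \<open>p\<close> times its own, and the one for the
  inverse of \<open>g\<close> bounds its own by \<open>1 / q\<close> times that of its image. At a
  point outside all these sets for rational \<open>p < q\<close> the slopes converge. Slopes are at
  least 1, so only positive \<open>p\<close> matter.
\<close>
lemma AE_differentiable_bilipschitz:
  fixes g :: "real \<Rightarrow> real"
  assumes lo: "\<And>u v. u \<le> v \<Longrightarrow> v - u \<le> g v - g u"
    and up: "\<And>u v. u \<le> v \<Longrightarrow> g v - g u \<le> L * (v - u)"
  shows "negligible {x. \<not> g differentiable (at x)}"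
proof -
  have L: "L \<ge> 1" using lo[of 0 1] up[of 0 1] by simp
  have mono: "strict_mono g" unfolding strict_mono_def using lo by (smt (verit))
  have lip: "L-lipschitz_on UNIV g"
  proof (rule lipschitz_onI)
    fix x y :: real
    show "dist (g x) (g y) \<le> L * dist x y"
      using lo[of x y] up[of x y] lo[of y x] up[of y x] unfolding dist_real_def
      by (cases "x \<le> y") (auto simp: abs_if)
  qed (use L in simp)
  have cont: "continuous_on UNIV g" using lip by (rule lipschitz_on_continuous_on)
  have surj: "surj g"
    unfolding surj_def
  proof
    fix y :: real
    let ?b = "\<bar>y\<bar> + \<bar>g 0\<bar>"
    have "y \<le> g ?b" using lo[of 0 ?b] by simp
    moreover have "g (- ?b) \<le> y" using lo[of "- ?b" 0] by linarith
    ultimately show "\<exists>x. y = g x"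
      using IVT'[of g "- ?b" y ?b] continuous_on_subset[OF cont] by auto
  qed
  define h where "h = inv g"
  have hg: "h (g x) = x" for x unfolding h_def using strict_mono_imp_inj_on[OF mono] by simp
  have gh: "g (h y) = y" for y unfolding h_def using surj by (simp add: surj_f_inv_f)
  have hmono: "strict_mono h" unfolding strict_mono_def using gh mono by (metis strict_mono_less)
  have hlip: "1-lipschitz_on UNIV h"
  proof (rule lipschitz_onI)
    fix x y :: real
    show "dist (h x) (h y) \<le> 1 * dist x y"
      using lo[of "h x" "h y"] lo[of "h y" "h x"] gh unfolding dist_real_def
      by (cases "h x \<le> h y") (auto simp: abs_if)
  qed simp
  have hcont: "continuous_on UNIV h" using hlip by (rule lipschitz_on_continuous_on)
  define Lo where "Lo p = {x. \<forall>d>0. \<exists>u v. u \<le> x \<and> x \<le> v \<and> u < v \<and> v - u < d \<and> g v - g u < p * (v - u)}" for p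
  define Hi where "Hi q = {x. \<forall>d>0. \<exists>u v. u \<le> x \<and> x \<le> v \<and> u < v \<and> v - u < d \<and> q * (v - u) < g v - g u}" for q
  have neg: "negligible (Lo p \<inter> Hi q \<inter> ball 0 n)" if "0 < p" "p < q" for p q n
  proof -
    \<comment> \<open>intersecting with a ball makes the outer measure finite, so that it can be cancelled\<close>
    let ?S = "Lo p \<inter> Hi q \<inter> ball 0 n" and ?m = "outer_measure_of lebesgue :: real set \<Rightarrow> ennreal"
    have 1: "?m (g ` ?S) \<le> ennreal p * ?m ?S"
      using \<open>0 < p\<close> by (intro outer_measure_image_le[OF mono cont lip]) (auto simp: Lo_def)
    have 2: "?m (h ` g ` ?S) \<le> ennreal (1 / q) * ?m (g ` ?S)"
    proof (rule outer_measure_image_le[OF hmono hcont hlip])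
      show "0 < 1 / q" using that by simp
      fix y d :: real assume y: "y \<in> g ` ?S" and "0 < d"
      then obtain x where x: "x \<in> Hi q" "y = g x" by auto
      obtain u v where uv: "u \<le> x" "x \<le> v" "u < v" "v - u < d / L" "q * (v - u) < g v - g u"
        using x L \<open>0 < d\<close> unfolding Hi_def by (auto dest!: spec[of _ "d / L"])
      have "g v - g u \<le> L * (v - u)" using up uv by auto
      also have "\<dots> < d" using uv L by (simp add: field_simps)
      finally show "\<exists>u v. u \<le> y \<and> y \<le> v \<and> u < v \<and> v - u < d \<and> h v - h u < 1 / q * (v - u)"
        using uv x that strict_mono_less_eq[OF mono] strict_mono_less[OF mono] 
        by (intro exI[of _ "g u"] exI[of _ "g v"]) (auto simp: hg field_simps)
    qed
    have "h ` g ` ?S = ?S" by (auto simp: image_image hg)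
    with 2 have "?m ?S \<le> ennreal (1 / q) * ?m (g ` ?S)" by simp
    also have "\<dots> \<le> ennreal (1 / q) * (ennreal p * ?m ?S)" using 1 by (intro mult_left_mono) auto
    also have "\<dots> = ennreal (p / q) * ?m ?S" using that by (simp add: mult.assoc[symmetric] ennreal_mult[symmetric])
    finally have 3: "?m ?S \<le> ennreal (p / q) * ?m ?S" .
    have "?m ?S \<le> emeasure lebesgue (ball (0::real) n)" 
      unfolding outer_measure_of_def by (intro INF_lower) auto
    also have "\<dots> < \<infinity>" using emeasure_lborel_ball_finite[of 0 n] by simp
    finally obtain r where r: "?m ?S = ennreal r" "0 \<le> r" by (cases "?m ?S") auto
    have "r \<le> p / q * r" using 3 r that by (simp add: ennreal_mult[symmetric])
    then have "r * (q - p) \<le> 0" using that by (simp add: field_simps)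
    then have "r = 0" using that r by (simp add: mult_le_0_iff)
    obtain E where E: "E \<in> sets lebesgue" "?S \<subseteq> E" "?m ?S = emeasure lebesgue E"
      using outer_measure_of_attain[of ?S lebesgue] by auto
    then have "E \<in> null_sets lebesgue" using r \<open>r = 0\<close> by (auto intro: null_setsI)
    then show ?thesis using E(2) negligible_iff_null_sets negligible_subset by blast
  qed
  let ?B = "\<Union>p\<in>\<rat> \<inter> {0<..}. \<Union>q\<in>\<rat> \<inter> {p<..}. \<Union>n\<in>(UNIV::nat set). Lo p \<inter> Hi q \<inter> ball 0 (real n)"
  have "negligible ?B"
    by (intro negligible_countable_Union countable_image) (auto intro!: negligible_countable_Union neg countable_image countable_Int1 countable_rat simp del: UN_simps)
  moreover have "g differentiable (at x)" if "x \<notin> ?B" for x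
  proof -
    have no: "\<not> (x \<in> Lo p \<and> x \<in> Hi q)" if "0 < p" "p < q" for p q
    proof
      assume xpq: "x \<in> Lo p \<and> x \<in> Hi q"
      obtain p' q' where "p < p'" "p' < q'" "q' < q" "p' \<in> \<rat>" "q' \<in> \<rat>"
        using Rats_dense_in_real[of p q] Rats_dense_in_real \<open>p < q\<close> by metis
      moreover have "x \<in> Lo p'"
        unfolding Lo_def
      proof (intro CollectI allI impI)
        fix d :: real assume "0 < d"
        then obtain u v where uv: "u \<le> x" "x \<le> v" "u < v" "v - u < d" "g v - g u < p * (v - u)"
          using xpq unfolding Lo_def by blast
        have "p * (v - u) \<le> p' * (v - u)" using uv \<open>p < p'\<close> by (intro mult_right_mono) auto
        with uv(5) have "g v - g u < p' * (v - u)" by linarith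
        then show "\<exists>u v. u \<le> x \<and> x \<le> v \<and> u < v \<and> v - u < d \<and> g v - g u < p' * (v - u)"
          using uv by blast
      qed
      moreover have "x \<in> Hi q'"
        unfolding Hi_def
      proof (intro CollectI allI impI)
        fix d :: real assume "0 < d"
        then obtain u v where uv: "u \<le> x" "x \<le> v" "u < v" "v - u < d" "q * (v - u) < g v - g u"
          using xpq unfolding Hi_def by blast
        have "q' * (v - u) \<le> q * (v - u)" using uv \<open>q' < q\<close> by (intro mult_right_mono) auto
        with uv(5) have "q' * (v - u) < g v - g u" by linarith
        then show "\<exists>u v. u \<le> x \<and> x \<le> v \<and> u < v \<and> v - u < d \<and> q' * (v - u) < g v - g u"
          using uv by blast
      qed
      moreover obtain n :: nat where "\<bar>x\<bar> < n" using reals_Archimedean2 by blast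
      ultimately have "p' \<in> \<rat> \<inter> {0<..}" "q' \<in> \<rat> \<inter> {p'<..}" "x \<in> Lo p' \<inter> Hi q' \<inter> ball 0 (real n)" 
        using \<open>0 < p\<close> by (auto simp: dist_real_def)
      then have "x \<in> ?B" by blast
      with \<open>x \<notin> ?B\<close> show False by blast
    qed
    define P where "P = {p. x \<notin> Lo p}"
    have P1: "1 \<in> P" unfolding P_def Lo_def using lo by (auto intro!: exI[of _ 1] simp: not_less)
    have PL: "p \<le> L + 1" if "p \<in> P" for p
    proof (rule ccontr)
      assume "\<not> p \<le> L + 1"
      have "x \<in> Lo p" unfolding Lo_def
      proof (intro CollectI allI impI)
        fix d :: real assume "0 < d"
        have "g (x + d / 2) - g x \<le> L * (d / 2)" using up[of x "x + d / 2"] \<open>0 < d\<close> by simp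
        also have "\<dots> < p * (d / 2)" using \<open>\<not> p \<le> L + 1\<close> \<open>0 < d\<close> by (intro mult_strict_right_mono) auto
        finally show "\<exists>u v. u \<le> x \<and> x \<le> v \<and> u < v \<and> v - u < d \<and> g v - g u < p * (v - u)"
          using \<open>0 < d\<close> by (intro exI[of _ x] exI[of _ "x + d/2"]) auto
      qed
      then show False using that by (simp add: P_def)
    qed
    \<comment> \<open>D is the lower derivative at x; outside the exceptional set it is the upper one as well\<close>
    define D where "D = Sup P"
    have bdd: "bdd_above P" using PL by (auto simp: bdd_above_def)
    have D1: "1 \<le> D" unfolding D_def using P1 bdd by (rule cSup_upper)
    have low: "\<exists>d>0. \<forall>u v. u \<le> x \<and> x \<le> v \<and> u < v \<and> v - u < d \<longrightarrow> (D - e) * (v - u) \<le> g v - g u" if "0 < e" for e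
    proof -
      obtain p where p: "p \<in> P" "D - e < p" using less_cSup_iff[of P "D - e"] P1 bdd \<open>0 < e\<close> by (auto simp: D_def)
      then obtain d where d: "d > 0" "\<And>u v. u \<le> x \<and> x \<le> v \<and> u < v \<and> v - u < d \<Longrightarrow> p * (v - u) \<le> g v - g u"
        unfolding P_def Lo_def mem_Collect_eq not_all not_ex not_imp by (meson not_less)
      show ?thesis
      proof (intro exI[of _ d] conjI allI impI)
        fix u v assume uv: "u \<le> x \<and> x \<le> v \<and> u < v \<and> v - u < d"
        have "(D - e) * (v - u) \<le> p * (v - u)" using p uv by (intro mult_right_mono) auto
        then show "(D - e) * (v - u) \<le> g v - g u" using d(2)[OF uv] by simp
      qed (rule d)
    qed
    have upp: "\<exists>d>0. \<forall>u v. u \<le> x \<and> x \<le> v \<and> u < v \<and> v - u < d \<longrightarrow> g v - g u \<le> (D + e) * (v - u)" if "0 < e" for e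
    proof -
      have "D + e / 2 \<notin> P" using cSup_upper[OF _ bdd, of "D + e/2"] \<open>0 < e\<close> by (auto simp: D_def)
      then have "x \<in> Lo (D + e / 2)" by (simp add: P_def)
      then have "x \<notin> Hi (D + e)" using no[of "D + e / 2" "D + e"] D1 \<open>0 < e\<close> by auto
      then show ?thesis unfolding Hi_def mem_Collect_eq not_all not_ex not_imp by (meson not_less)
    qed
    have "((\<lambda>y. (g y - g x) / (y - x)) \<longlongrightarrow> D) (at x)"
    proof (rule LIM_I)
      fix e :: real assume "0 < e"
      then have e2: "0 < e / 2" by simp
      obtain d1 where d1: "d1 > 0" "\<And>u v. u \<le> x \<and> x \<le> v \<and> u < v \<and> v - u < d1 \<Longrightarrow> (D - e/2) * (v - u) \<le> g v - g u"
        using low[OF e2] by blast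
      obtain d2 where d2: "d2 > 0" "\<And>u v. u \<le> x \<and> x \<le> v \<and> u < v \<and> v - u < d2 \<Longrightarrow> g v - g u \<le> (D + e/2) * (v - u)"
        using upp[OF e2] by blast
      show "\<exists>s>0. \<forall>y. y \<noteq> x \<and> norm (y - x) < s \<longrightarrow> norm ((g y - g x) / (y - x) - D) < e"
      proof (intro exI[of _ "min d1 d2"] conjI allI impI)
        fix y assume y: "y \<noteq> x \<and> norm (y - x) < min d1 d2"
        define q where "q = (g y - g x) / (y - x)"
        have "D - e/2 \<le> q \<and> q \<le> D + e/2"
        proof (cases "x < y")
          case True
          then show ?thesis using d1(2)[of x y] d2(2)[of x y] y by (simp add: q_def field_simps)
        next
          case False
          then have "y < x" using y by simp
          moreover have "q = (g x - g y) / (x - y)" unfolding q_def by (metis minus_diff_eq minus_divide_divide)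
          ultimately have "q * (x - y) = g x - g y" by simp
          moreover have "(D - e/2) * (x - y) \<le> g x - g y" "g x - g y \<le> (D + e/2) * (x - y)"
            using d1(2)[of y x] d2(2)[of y x] y \<open>y < x\<close> by auto
          ultimately have "(D - e/2) * (x - y) \<le> q * (x - y)" "q * (x - y) \<le> (D + e/2) * (x - y)"
            by auto
          with \<open>y < x\<close> show ?thesis by (simp add: mult_le_cancel_right)
        qed
        then show "norm ((g y - g x) / (y - x) - D) < e" using \<open>0 < e\<close> unfolding q_def[symmetric] by (simp add: abs_if)
      qed (use d1 d2 in auto)
    qed
    then have "(g has_real_derivative D) (at x)" by (simp add: has_field_derivative_iff)
    then show ?thesis using real_differentiable_def by blast
  qed
  ultimately have "{x. \<not> g differentiable (at x)} \<subseteq> ?B" by blast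
  with \<open>negligible ?B\<close> show ?thesis by (rule negligible_subset)
qed

text \<open>
  Adding a multiple of the identity makes a Lipschitz function strictly increasing with a Lipschitz
  inverse.
\<close>
lemma AE_differentiable_lipschitz_real:
  fixes f :: "real \<Rightarrow> real"
  assumes "L-lipschitz_on UNIV f"
  shows "negligible {x. \<not> f differentiable (at x)}"
proof -
  define g where "g x = f x + (L + 1) * x" for x
  have b: "\<bar>f v - f u\<bar> \<le> L * (v - u)" if "u \<le> v" for u v
    using lipschitz_onD[OF assms, of v u] that by (simp add: dist_real_def)
  have "negligible {x. \<not> g differentiable (at x)}"
  proof (rule AE_differentiable_bilipschitz)
    fix u v :: real assume "u \<le> v"
    then show "v - u \<le> g v - g u" "g v - g u \<le> (2 * L + 1) * (v - u)"
      using b[of u v] by (auto simp: g_def algebra_simps abs_le_iff)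
  qed
  moreover have "f differentiable (at x)" if "g differentiable (at x)" for x
  proof -
    have "(\<lambda>x. g x - (L + 1) * x) differentiable (at x)" using that by (intro derivative_intros)
    then show ?thesis by (simp add: g_def)
  qed
  ultimately show ?thesis by (rule_tac negligible_subset) auto
qed

section \<open>Monotonicity from derivatives almost everywhere\<close>

text \<open>
  The Lipschitz constant may vary with the centre \<open>t\<close>. That is enough for null sets to
  have null images.
\<close>
definition pointwise_lipschitz_on :: "real set \<Rightarrow> (real \<Rightarrow> 'b::real_normed_vector) \<Rightarrow> bool" where
  "pointwise_lipschitz_on S f \<longleftrightarrow>
     (\<forall>t\<in>S. \<exists>T B. open T \<and> t \<in> T \<and> (\<forall>s\<in>S \<inter> T. norm (f s - f t) \<le> B * norm (s - t)))"

lemma pointwise_lipschitz_on_subset: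
  "pointwise_lipschitz_on S f \<Longrightarrow> T \<subseteq> S \<Longrightarrow> pointwise_lipschitz_on T f"
  unfolding pointwise_lipschitz_on_def by (intro ballI; drule bspec, blast, elim exE, intro exI) auto

lemma pointwise_lipschitz_on_linear:
  assumes "bounded_linear g" "pointwise_lipschitz_on S f"
  shows "pointwise_lipschitz_on S (\<lambda>t. g (f t))"
  unfolding pointwise_lipschitz_on_def
proof
  fix t assume "t \<in> S"
  obtain K where K: "K > 0" "\<And>x. norm (g x) \<le> norm x * K"
    using bounded_linear.pos_bounded[OF assms(1)] by blast
  obtain T B where TB: "open T" "t \<in> T" "\<And>s. s \<in> S \<inter> T \<Longrightarrow> norm (f s - f t) \<le> B * norm (s - t)"
    using assms(2) \<open>t \<in> S\<close> unfolding pointwise_lipschitz_on_def by metis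
  have "norm (g (f s) - g (f t)) \<le> (B * K) * norm (s - t)" if "s \<in> S \<inter> T" for s
  proof -
    have "norm (g (f s) - g (f t)) \<le> norm (f s - f t) * K"
      using K(2) by (simp add: linear_diff[OF bounded_linear.linear[OF assms(1)], symmetric])
    also have "\<dots> \<le> (B * norm (s - t)) * K" using TB(3)[OF that] K by (intro mult_right_mono) auto
    finally show ?thesis by (simp add: mult_ac)
  qed
  then show "\<exists>T B. open T \<and> t \<in> T \<and> (\<forall>s\<in>S \<inter> T. norm (g (f s) - g (f t)) \<le> B * norm (s - t))"
    using TB by blast
qed

lemma pointwise_lipschitz_on_add_linear:
  fixes f :: "real \<Rightarrow> real"
  assumes "pointwise_lipschitz_on S f"
  shows "pointwise_lipschitz_on S (\<lambda>t. f t + e * t)"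
  unfolding pointwise_lipschitz_on_def
proof
  fix t assume "t \<in> S"
  obtain T B where TB: "open T" "t \<in> T" "\<And>s. s \<in> S \<inter> T \<Longrightarrow> norm (f s - f t) \<le> B * norm (s - t)"
    using assms \<open>t \<in> S\<close> unfolding pointwise_lipschitz_on_def by metis
  have "norm ((f s + e * s) - (f t + e * t)) \<le> (B + \<bar>e\<bar>) * norm (s - t)" if "s \<in> S \<inter> T" for s
  proof -
    have "(f s + e * s) - (f t + e * t) = (f s - f t) + e * (s - t)" by (simp add: algebra_simps)
    then have "norm ((f s + e * s) - (f t + e * t)) \<le> norm (f s - f t) + norm (e * (s - t))"
      using norm_triangle_ineq by metis
    also have "\<dots> \<le> B * norm (s - t) + \<bar>e\<bar> * norm (s - t)" 
      using TB(3)[OF that] by (simp add: abs_mult)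
    finally show ?thesis by (simp add: algebra_simps)
  qed
  then show "\<exists>T B. open T \<and> t \<in> T \<and> (\<forall>s\<in>S \<inter> T. norm ((f s + e * s) - (f t + e * t)) \<le> B * norm (s - t))"
    using TB by blast
qed

lemma pointwise_lipschitz_on_continuous:
  assumes "pointwise_lipschitz_on S f"
  shows "continuous_on S f"
  unfolding continuous_on_def
proof
  fix t assume "t \<in> S"
  obtain T B where TB: "open T" "t \<in> T" "\<And>s. s \<in> S \<inter> T \<Longrightarrow> norm (f s - f t) \<le> B * norm (s - t)"
    using assms \<open>t \<in> S\<close> unfolding pointwise_lipschitz_on_def by metis
  have "((\<lambda>s. f s - f t) \<longlongrightarrow> 0) (at t within S)"
  proof (rule Lim_null_comparison)
    show "\<forall>\<^sub>F s in at t within S. norm (f s - f t) \<le> B * norm (s - t)"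
      unfolding eventually_at_topological using TB by blast
    have "((\<lambda>s. B * norm (s - t)) \<longlongrightarrow> B * norm (t - t)) (at t within S)"
      by (intro tendsto_intros)
    then show "((\<lambda>s. B * norm (s - t)) \<longlongrightarrow> 0) (at t within S)" by simp
  qed
  then show "(f \<longlongrightarrow> f t) (at t within S)" by (simp add: LIM_zero_iff)
qed

text \<open>
  If \<open>f b < f a\<close>, then also \<open>g b < g a\<close> for \<open>g t = f t + e *
  t\<close> with small \<open>e > 0\<close>. The image under \<open>g\<close> of the exceptional
  null set is null, so some value \<open>y\<close> between \<open>g b\<close> and \<open>g
  a\<close> is missed by it. At the last time where \<open>g = y\<close> the function
  \<open>g\<close> has a positive derivative although it stays below \<open>y\<close> afterwards.
\<close>
lemma nondecreasing_if_AE_derivative_nonneg: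
  fixes f :: "real \<Rightarrow> real"
  assumes lip: "pointwise_lipschitz_on {a..b} f" and N: "negligible N" and "a \<le> b"
    and der: "\<And>t. t \<in> {a..b} - N \<Longrightarrow> \<exists>D\<ge>0. (f has_real_derivative D) (at t within {a..b})"
  shows "f a \<le> f b"
proof (rule ccontr)
  assume "\<not> f a \<le> f b"
  then have "a < b" "f b < f a" using \<open>a \<le> b\<close> by (auto simp: less_le)
  define e where "e = (f a - f b) / (2 * (b - a))"
  have e: "0 < e" using \<open>a < b\<close> \<open>f b < f a\<close> by (simp add: e_def)
  define g where "g t = f t + e * t" for t
  have "e * (b - a) = (f a - f b) / 2" using \<open>a < b\<close> unfolding e_def by (simp add: divide_simps; simp add: algebra_simps)
  then have gab: "g b < g a" using \<open>f b < f a\<close> by (simp add: g_def algebra_simps)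
  have glip: "pointwise_lipschitz_on {a..b} g"
    unfolding g_def by (rule pointwise_lipschitz_on_add_linear[OF lip])
  then have gcont: "continuous_on {a..b} g" by (rule pointwise_lipschitz_on_continuous)
  have "negligible (g ` ({a..b} \<inter> N))"
  proof (rule negligible_locally_Lipschitz_image)
    fix t assume "t \<in> {a..b} \<inter> N"
    then show "\<exists>T B. open T \<and> t \<in> T \<and> (\<forall>s\<in>({a..b} \<inter> N) \<inter> T. norm (g s - g t) \<le> B * norm (s - t))"
      using glip unfolding pointwise_lipschitz_on_def by (metis IntD1 IntD2 IntI)
  qed (use N negligible_subset[of N] in auto)
  moreover have "\<not> negligible {g b..g a}" using gab negligible_interval(1)[of "g b" "g a"] by simp
  ultimately have "\<not> {g b..g a} - {g b, g a} \<subseteq> g ` ({a..b} \<inter> N)"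
    using negligible_subset negligible_Un[of "g ` ({a..b} \<inter> N)" "{g b, g a}"]
    by (metis Un_commute Diff_subset_conv negligible_insert negligible_empty)
  then obtain y where y: "g b < y" "y < g a" "y \<notin> g ` ({a..b} \<inter> N)" by force
  define P where "P = {t \<in> {a..b}. y \<le> g t}"
  have P: "P \<noteq> {}" "bdd_above P" using y \<open>a < b\<close> by (auto simp: P_def intro!: exI[of _ a])
  have "closed P" unfolding P_def using gcont by (intro continuous_closed_preimage_constant continuous_on_closed_Collect_le) auto
  define s where "s = Sup P"
  have s: "s \<in> P" unfolding s_def using P \<open>closed P\<close> by (simp add: closed_contains_Sup)
  have after: "g t < y" if "s < t" "t \<le> b" for t
    using cSup_upper[OF _ P(2), of t] that s by (force simp: s_def P_def)
  have sb: "s < b" using s y by (cases "s = b") (auto simp: P_def)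
  have "g s = y"
  proof (rule ccontr)
    assume "g s \<noteq> y"
    then have "y < g s" using s by (simp add: P_def)
    then obtain t where "s \<le> t" "t \<le> b" "g t = y"
      using IVT2'[of g b y s] sb y(1) continuous_on_subset[OF gcont, of "{s..b}"] s by (auto simp: P_def)
    then show False using after[of t] \<open>g s \<noteq> y\<close> by (cases "s = t") auto
  qed
  then have "s \<in> {a..b} - N" using y(3) s by (auto simp: P_def)
  then obtain D where D: "D \<ge> 0" "(f has_real_derivative D) (at s within {a..b})" using der by blast
  have "(g has_real_derivative D + e) (at s within {a..b})"
    unfolding g_def using D(2) by (auto intro!: derivative_eq_intros)
  then obtain d where d: "d > 0" "\<And>h. 0 < h \<Longrightarrow> s + h \<in> {a..b} \<Longrightarrow> h < d \<Longrightarrow> g s < g (s + h)"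
    using has_real_derivative_pos_inc_right[of g "D + e" s "{a..b}"] D(1) e by auto
  define h where "h = min (d / 2) (b - s)"
  have "0 < h" "h < d" "s + h \<in> {a..b}" using d sb s by (auto simp: h_def P_def min_def)
  with d(2)[of h] after[of "s + h"] \<open>g s = y\<close> show False by auto
qed

text \<open>
  A nondecreasing function with equal end values is constant, and a constant has derivative 0.
\<close>
lemma increasing_if_AE_derivative_pos:
  fixes f :: "real \<Rightarrow> real"
  assumes lip: "pointwise_lipschitz_on {a..b} f" and N: "negligible N" and "a < b"
    and der: "\<And>t. t \<in> {a..b} - N \<Longrightarrow> \<exists>D>0. (f has_real_derivative D) (at t within {a..b})"
  shows "f a < f b"
proof -
  have le: "f u \<le> f v" if "a \<le> u" "u \<le> v" "v \<le> b" for u v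
  proof (rule nondecreasing_if_AE_derivative_nonneg[where f = f and a = u and b = v, OF _ N])
    show "pointwise_lipschitz_on {u..v} f" using lip that by (auto intro: pointwise_lipschitz_on_subset)
    fix t assume t: "t \<in> {u..v} - N"
    then have "t \<in> {a..b} - N" using that by auto
    then obtain D where "D > 0" "(f has_real_derivative D) (at t within {a..b})" using der[of t] by blast
    then show "\<exists>D\<ge>0. (f has_real_derivative D) (at t within {u..v})"
      using that DERIV_subset[of f D t "{a..b}" "{u..v}"] by (intro exI[of _ D]) auto
  qed (rule that)
  have "f a \<noteq> f b"
  proof
    assume eq: "f a = f b"
    have const: "f t = f a" if "t \<in> {a..b}" for t
      using le[of a t] le[of t b] that eq by auto
    have "\<not> {a..b} \<subseteq> N" using N \<open>a < b\<close> negligible_subset negligible_interval(1)[of a b] by auto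
    then obtain t where t: "t \<in> {a..b} - N" by blast
    then obtain D where D: "D > 0" "(f has_real_derivative D) (at t within {a..b})" using der by blast
    have "((\<lambda>_. f a) has_real_derivative D) (at t within {a..b})"
    proof (rule has_field_derivative_transform_within[OF D(2), of 1])
      show "f u = f a" if "u \<in> {a..b}" for u by (rule const[OF that])
    qed (use t in auto)
    moreover have "((\<lambda>_. f a) has_real_derivative 0) (at t within {a..b})" by simp
    moreover have "at t within {a..b} \<noteq> bot" using t \<open>a < b\<close> by (simp add: trivial_limit_within)
    ultimately have "D = 0" by (metis has_real_derivative_iff_has_vector_derivative vector_derivative_unique_within)
    with D show False by simp
  qed
  with le[of a b] \<open>a < b\<close> show ?thesis by simp
qed

section \<open>Spaces with compact balls are finite-dimensional\<close>

text \<open>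
  Distinct orthonormal vectors have distance \<open>sqrt 2\<close>, so a cover of the unit ball by
  finitely many balls of radius \<open>1/2\<close> bounds the size of orthonormal sets. A largest
  one spans the space.
\<close>
lemma finite_orthonormal_basis:
  "\<exists>B::'e::{real_inner, heine_borel} set. finite B \<and> (\<forall>x. x = (\<Sum>b\<in>B. (x \<bullet> b) *\<^sub>R b))"
proof -
  define ON where "ON B \<longleftrightarrow> finite B \<and> (\<forall>b\<in>B. \<forall>c\<in>B. b \<bullet> c = (if b = c then 1 else 0))" for B :: "'e set"
  have "compact (cball (0::'e) 1)" by (simp add: compact_eq_bounded_closed)
  then have "\<exists>K. finite K \<and> K \<subseteq> cball (0::'e) 1 \<and> cball 0 1 \<subseteq> (\<Union>x\<in>K. ball x (1/2))"
    using seq_compact_imp_totally_bounded[of "cball (0::'e) 1"] compact_imp_seq_compact by (metis half_gt_zero zero_less_one)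
  then obtain K :: "'e set" where K: "finite K" "cball 0 1 \<subseteq> (\<Union>x\<in>K. ball x (1/2))" by blast
  have bound: "card B \<le> card K" if "ON B" for B
  proof -
    have "\<exists>x\<in>K. b \<in> ball x (1/2)" if "b \<in> B" for b
    proof -
      have "b \<bullet> b = 1" using \<open>ON B\<close> that by (simp add: ON_def)
      then have "b \<in> cball 0 1" by (simp add: norm_eq_sqrt_inner)
      with K show ?thesis by blast
    qed
    then obtain h where h: "\<And>b. b \<in> B \<Longrightarrow> h b \<in> K \<and> b \<in> ball (h b) (1/2)" by metis
    have "inj_on h B"
    proof (rule inj_onI, rule ccontr)
      fix b c assume bc: "b \<in> B" "c \<in> B" "h b = h c" "b \<noteq> c"
      have "(norm (b - c))\<^sup>2 = 2"
        using bc \<open>ON B\<close> by (simp add: power2_norm_eq_inner inner_diff_left inner_diff_right inner_commute ON_def)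
      moreover have "dist b c < 1"
        using h[OF bc(1)] h[OF bc(2)] bc(3) dist_triangle_half_r[of "h b" b 1 c] by simp
      then have "norm (b - c) < 1" by (simp add: dist_norm)
      then have "(norm (b - c))\<^sup>2 < 1" by (simp add: power_less_one_iff)
      ultimately show False by simp
    qed
    then show ?thesis using h K(1) by (intro card_inj_on_le[of h]) auto
  qed
  have "ON {}" by (simp add: ON_def)
  then have "\<exists>B. ON B \<and> (\<forall>B'. ON B' \<longrightarrow> card B' \<le> card B)"
    using ex_has_greatest_nat[of ON "{}" card "Suc (card K)"] bound by (simp add: less_Suc_eq_le)
  then obtain B where B: "ON B" "\<And>B'. ON B' \<Longrightarrow> card B' \<le> card B" by blast
  have "x = (\<Sum>b\<in>B. (x \<bullet> b) *\<^sub>R b)" for x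
  proof (rule ccontr)
    define y where "y = x - (\<Sum>b\<in>B. (x \<bullet> b) *\<^sub>R b)"
    assume "x \<noteq> (\<Sum>b\<in>B. (x \<bullet> b) *\<^sub>R b)"
    then have "y \<noteq> 0" by (simp add: y_def)
    have fB: "finite B" using B(1) by (simp add: ON_def)
    have yb: "y \<bullet> c = 0" if "c \<in> B" for c
    proof -
      have "(\<Sum>b\<in>B. (x \<bullet> b) * (b \<bullet> c)) = (\<Sum>b\<in>B. if b = c then x \<bullet> c else 0)"
        using B(1) that by (intro sum.cong) (auto simp: ON_def)
      then show ?thesis using that fB by (simp add: y_def inner_diff_left inner_sum_left)
    qed
    define z where "z = y /\<^sub>R norm y"
    have "z \<bullet> z = 1" using \<open>y \<noteq> 0\<close> by (simp add: z_def power2_norm_eq_inner[symmetric] power2_eq_square divide_simps)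
    moreover have "z \<bullet> c = 0" "c \<bullet> z = 0" if "c \<in> B" for c
      using yb[OF that] by (auto simp: z_def inner_commute)
    ultimately have "ON (insert z B)" "z \<notin> B" using B(1) by (auto simp: ON_def)
    then show False using B(2)[of "insert z B"] fB by simp
  qed
  then show ?thesis using B(1) by (auto simp: ON_def)
qed

lemma linear_imp_bounded_linear_heine_borel:
  fixes f :: "'e::{real_inner, heine_borel} \<Rightarrow> 'b::real_normed_vector"
  assumes "linear f"
  shows "bounded_linear f"
proof -
  obtain B :: "'e set" where B: "finite B" "\<And>x. x = (\<Sum>b\<in>B. (x \<bullet> b) *\<^sub>R b)"
    using finite_orthonormal_basis by metis
  have "f x = (\<Sum>b\<in>B. (x \<bullet> b) *\<^sub>R f b)" for x
  proof -
    have "f x = f (\<Sum>b\<in>B. (x \<bullet> b) *\<^sub>R b)" using B(2) by simp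
    then show ?thesis by (simp add: linear_sum[OF assms] linear_scale[OF assms])
  qed
  moreover have "bounded_linear (\<lambda>x. \<Sum>b\<in>B. (x \<bullet> b) *\<^sub>R f b)"
    by (intro bounded_linear_sum bounded_linear_scaleR_const bounded_linear_inner_left)
  ultimately show ?thesis by (metis (no_types, lifting) ext)
qed

text \<open>
  Componentwise in an orthonormal basis, after extending \<open>g\<close> to the line by constants.
\<close>
lemma AE_vector_derivative_lipschitz:
  fixes g :: "real \<Rightarrow> 'e::{real_inner, heine_borel}"
  assumes g: "L-lipschitz_on {0..1} g"
  shows "\<exists>N. negligible N \<and> (\<forall>t\<in>{0<..<1} - N. \<exists>v. (g has_vector_derivative v) (at t))"
proof -
  obtain B :: "'e set" where B: "finite B" "\<And>x. x = (\<Sum>b\<in>B. (x \<bullet> b) *\<^sub>R b)"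
    using finite_orthonormal_basis by metis
  define c where "c t = max 0 (min 1 t)" for t :: real
  have c: "c t \<in> {0..1}" for t by (auto simp: c_def)
  define f where "f b t = g (c t) \<bullet> b" for b t
  have "negligible {t. \<not> f b differentiable (at t)}" for b
  proof (rule AE_differentiable_lipschitz_real)
    show "(L * norm b)-lipschitz_on UNIV (f b)"
    proof (rule lipschitz_onI)
      fix s t :: real
      have L: "0 \<le> L" using g lipschitz_on_nonneg by blast
      have "dist (f b s) (f b t) = \<bar>(g (c s) - g (c t)) \<bullet> b\<bar>" by (simp add: f_def dist_real_def inner_diff_left)
      also have "\<dots> \<le> norm (g (c s) - g (c t)) * norm b" by (rule Cauchy_Schwarz_ineq2)
      also have "\<dots> \<le> (L * dist (c s) (c t)) * norm b"
        using lipschitz_onD[OF g c c] by (intro mult_right_mono) (auto simp: dist_norm)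
      also have "\<dots> \<le> (L * dist s t) * norm b"
        using L by (intro mult_right_mono mult_left_mono) (auto simp: c_def dist_real_def)
      finally show "dist (f b s) (f b t) \<le> L * norm b * dist s t" by (simp add: mult_ac)
    qed (use lipschitz_on_nonneg[OF g] in simp)
  qed
  then have neg: "negligible (\<Union>b\<in>B. {t. \<not> f b differentiable (at t)})" using B(1) by (intro negligible_Union) auto
  have "\<exists>v. (g has_vector_derivative v) (at t)" if t: "t \<in> {0<..<1} - (\<Union>b\<in>B. {t. \<not> f b differentiable (at t)})" for t
  proof -
    have "\<forall>b\<in>B. \<exists>D. (f b has_real_derivative D) (at t)" using t real_differentiable_def by auto
    then obtain D where "\<And>b. b \<in> B \<Longrightarrow> (f b has_real_derivative D b) (at t)" by metis
    then have "((\<lambda>s. \<Sum>b\<in>B. f b s *\<^sub>R b) has_vector_derivative (\<Sum>b\<in>B. D b *\<^sub>R b)) (at t)"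
      by (intro has_vector_derivative_sum) (auto intro!: derivative_eq_intros)
    then have "(g has_vector_derivative (\<Sum>b\<in>B. D b *\<^sub>R b)) (at t)"
    proof (rule has_vector_derivative_transform_within_open[of _ _ _ "{0<..<1}"])
      fix s :: real assume "s \<in> {0<..<1}"
      then have "c s = s" by (simp add: c_def)
      then show "(\<Sum>b\<in>B. f b s *\<^sub>R b) = g s" using B(2)[of "g s"] by (simp add: f_def)
    qed (use t in auto)
    then show ?thesis by blast
  qed
  with neg show ?thesis by blast
qed

text \<open>
  Smoothness is stated through directional derivatives; a finite basis turns their separate local
  bounds into a bound for the operator norm of the derivative, to which the mean value inequality
  applies.
\<close>
lemma smooth_on_imp_locally_lipschitz:
  fixes f :: "'e::{real_inner, heine_borel} \<Rightarrow> 'b::real_normed_vector"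
  assumes f: "smooth_on S f" and S: "open S" "x \<in> S"
  shows "\<exists>e>0. \<exists>L\<ge>0. ball x e \<subseteq> S \<and> (\<forall>y\<in>ball x e. \<forall>z\<in>ball x e. norm (f y - f z) \<le> L * norm (y - z))"
proof -
  obtain B :: "'e set" where B: "finite B" "\<And>x. x = (\<Sum>b\<in>B. (x \<bullet> b) *\<^sub>R b)"
    using finite_orthonormal_basis by metis
  have "higher_differentiable_on S f (Suc 0)" using f unfolding smooth_on_def by blast
  then have df: "\<And>y. y \<in> S \<Longrightarrow> f differentiable (at y)"
    and cf: "\<And>v. continuous_on S (\<lambda>y. frechet_derivative f (at y) v)" by auto
  define M where "M b = norm (frechet_derivative f (at x) b) + 1" for b
  have "\<forall>\<^sub>F y in nhds x. norm (frechet_derivative f (at y) b) < M b" for b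
  proof -
    have "isCont (\<lambda>y. frechet_derivative f (at y) b) x"
      using cf S by (simp add: continuous_on_eq_continuous_at)
    then have "((\<lambda>y. norm (frechet_derivative f (at y) b)) \<longlongrightarrow> norm (frechet_derivative f (at x) b)) (nhds x)"
      unfolding isCont_def by (intro tendsto_norm iffD1[OF tendsto_at_iff_tendsto_nhds])
    then show ?thesis by (rule order_tendstoD) (simp add: M_def)
  qed
  then have "\<forall>\<^sub>F y in nhds x. \<forall>b\<in>B. norm (frechet_derivative f (at y) b) < M b"
    using B(1) by (simp add: eventually_ball_finite)
  moreover have "\<forall>\<^sub>F y in nhds x. y \<in> S" using S by (rule eventually_nhds_in_open)
  ultimately have "\<forall>\<^sub>F y in nhds x. y \<in> S \<and> (\<forall>b\<in>B. norm (frechet_derivative f (at y) b) < M b)"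
    by eventually_elim auto
  then obtain e where e: "e > 0" "\<And>y. y \<in> ball x e \<Longrightarrow> y \<in> S \<and> (\<forall>b\<in>B. norm (frechet_derivative f (at y) b) < M b)"
    unfolding eventually_nhds_metric by (auto simp: dist_commute)
  define L where "L = (\<Sum>b\<in>B. norm b * M b)"
  have Mp: "M b \<ge> 0" for b by (simp add: M_def)
  have Lp: "L \<ge> 0" unfolding L_def by (intro sum_nonneg) (simp add: Mp)
  have der: "norm (frechet_derivative f (at y) v) \<le> L * norm v" if "y \<in> ball x e" for y v
  proof -
    let ?D = "frechet_derivative f (at y)"
    have lin: "linear ?D" using df e(2)[OF that] by (simp add: linear_frechet_derivative)
    have "?D v = ?D (\<Sum>b\<in>B. (v \<bullet> b) *\<^sub>R b)" using B(2) by simp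
    also have "\<dots> = (\<Sum>b\<in>B. (v \<bullet> b) *\<^sub>R ?D b)" by (simp add: linear_sum[OF lin] linear_scale[OF lin])
    also have "norm \<dots> \<le> (\<Sum>b\<in>B. norm v * norm b * M b)"
    proof (rule sum_norm_le)
      fix b assume "b \<in> B"
      then have "norm (?D b) \<le> M b" using e(2)[OF that] by (simp add: less_imp_le)
      then show "norm ((v \<bullet> b) *\<^sub>R ?D b) \<le> norm v * norm b * M b"
        by (simp add: mult_mono Cauchy_Schwarz_ineq2)
    qed
    also have "\<dots> = L * norm v" by (simp add: L_def sum_distrib_left sum_distrib_right mult_ac)
    finally show ?thesis .
  qed
  have "norm (f y - f z) \<le> L * norm (y - z)" if "y \<in> ball x e" "z \<in> ball x e" for y z
  proof (rule differentiable_bound[of "ball x e" f "\<lambda>y. frechet_derivative f (at y)"])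
    fix w assume "w \<in> ball x e"
    then have "(f has_derivative frechet_derivative f (at w)) (at w)"
      using df e(2) frechet_derivative_works by blast
    then show "(f has_derivative frechet_derivative f (at w)) (at w within ball x e)"
      by (rule has_derivative_at_withinI)
    show "onorm (frechet_derivative f (at w)) \<le> L"
      by (rule onorm_bound[OF Lp]) (rule der[OF \<open>w \<in> ball x e\<close>])
  qed (use that in auto)
  then show ?thesis using Lp e by (intro exI[of _ e] conjI exI[of _ L]) auto
qed

section \<open>Limits of curves driven by a cone field\<close>

text \<open>
  A field of cones on a compact set \<open>Q\<close> of the model space, with one functional
  \<open>l\<close> that dominates the norm on all of them. The last assumption is closedness up to
  the zero section: limits of cone vectors are cone vectors or zero.
\<close>
locale cone_box =
  fixes K :: "'e::{real_inner, heine_borel} \<Rightarrow> 'e set" and Q :: "'e set" and l :: "'e \<Rightarrow> real"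
  assumes compact_Q: "compact Q"
    and linear_l: "bounded_linear l"
    and norm_le_l: "x \<in> Q \<Longrightarrow> w \<in> K x \<Longrightarrow> norm w \<le> l w"
    and zero_notin: "x \<in> Q \<Longrightarrow> 0 \<notin> K x"
    and scale: "x \<in> Q \<Longrightarrow> w \<in> K x \<Longrightarrow> 0 < t \<Longrightarrow> t *\<^sub>R w \<in> K x"
    and convex_K: "x \<in> Q \<Longrightarrow> convex (K x)"
    and closed_K: "(\<And>n. X n \<in> Q) \<Longrightarrow> (\<And>n. W n \<in> K (X n)) \<Longrightarrow> X \<longlonglongrightarrow> x \<Longrightarrow> W \<longlonglongrightarrow> w \<Longrightarrow> w \<noteq> 0 \<Longrightarrow> w \<in> K x"
begin

definition cone_curve :: "real \<Rightarrow> real \<Rightarrow> (real \<Rightarrow> 'e) \<Rightarrow> bool" where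
  "cone_curve a b \<sigma> \<longleftrightarrow> pointwise_lipschitz_on {a..b} \<sigma> \<and> \<sigma> ` {a..b} \<subseteq> Q \<and>
     (\<exists>N. negligible N \<and> (\<forall>t\<in>{a..b} - N. \<exists>w\<in>K (\<sigma> t). (\<sigma> has_vector_derivative w) (at t within {a..b})))"

lemma cone_curve_subinterval:
  assumes "cone_curve a b \<sigma>" "a \<le> c" "d \<le> b"
  shows "cone_curve c d \<sigma>"
proof -
  have sub: "{c..d} \<subseteq> {a..b}" using assms by auto
  obtain N where N: "negligible N" "\<And>t. t \<in> {a..b} - N \<Longrightarrow> \<exists>w\<in>K (\<sigma> t). (\<sigma> has_vector_derivative w) (at t within {a..b})"
    using assms(1) unfolding cone_curve_def by blast
  have "\<exists>w\<in>K (\<sigma> t). (\<sigma> has_vector_derivative w) (at t within {c..d})" if "t \<in> {c..d} - N" for t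
    using N(2)[of t] that sub has_vector_derivative_within_subset by blast
  then show ?thesis
    using assms(1) N(1) sub pointwise_lipschitz_on_subset unfolding cone_curve_def by blast
qed

text \<open>
  Along a curve, cone membership is only known almost everywhere; this turns it into an inequality
  that is free of derivatives and independent of the parametrisation, and thus survives limits.
\<close>
lemma functional_nondecreasing:
  assumes \<sigma>: "cone_curve a b \<sigma>" and "a \<le> b" and m: "bounded_linear m"
    and nonneg: "\<And>t w. t \<in> {a..b} \<Longrightarrow> w \<in> K (\<sigma> t) \<Longrightarrow> 0 \<le> m w"
  shows "m (\<sigma> a) \<le> (m (\<sigma> b) :: real)"
proof -
  obtain N where N: "negligible N" "\<And>t. t \<in> {a..b} - N \<Longrightarrow> \<exists>w\<in>K (\<sigma> t). (\<sigma> has_vector_derivative w) (at t within {a..b})"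
    using \<sigma> unfolding cone_curve_def by blast
  show ?thesis
  proof (rule nondecreasing_if_AE_derivative_nonneg[where f = "\<lambda>t. m (\<sigma> t)", OF _ N(1) \<open>a \<le> b\<close>])
    show "pointwise_lipschitz_on {a..b} (\<lambda>t. m (\<sigma> t))"
      using \<sigma> unfolding cone_curve_def by (intro pointwise_lipschitz_on_linear[OF m]) auto
    fix t assume t: "t \<in> {a..b} - N"
    then obtain w where w: "w \<in> K (\<sigma> t)" "(\<sigma> has_vector_derivative w) (at t within {a..b})" using N(2) by blast
    have "((\<lambda>t. m (\<sigma> t)) has_vector_derivative m w) (at t within {a..b})"
      by (rule bounded_linear.has_vector_derivative[OF m w(2)])
    then show "\<exists>D\<ge>0. ((\<lambda>t. m (\<sigma> t)) has_real_derivative D) (at t within {a..b})"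
      using nonneg[OF _ w(1)] t by (auto simp: has_real_derivative_iff_has_vector_derivative)
  qed
qed

lemma l_pos: "x \<in> Q \<Longrightarrow> w \<in> K x \<Longrightarrow> 0 < l w"
  using norm_le_l zero_notin by (metis less_le_trans zero_less_norm_iff)

lemma l_increasing:
  assumes \<sigma>: "cone_curve a b \<sigma>" and "a < b"
  shows "l (\<sigma> a) < l (\<sigma> b)"
proof -
  obtain N where N: "negligible N" "\<And>t. t \<in> {a..b} - N \<Longrightarrow> \<exists>w\<in>K (\<sigma> t). (\<sigma> has_vector_derivative w) (at t within {a..b})"
    and Q: "\<sigma> ` {a..b} \<subseteq> Q"
    using \<sigma> unfolding cone_curve_def by blast
  show ?thesis
  proof (rule increasing_if_AE_derivative_pos[where f = "\<lambda>t. l (\<sigma> t)", OF _ N(1) \<open>a < b\<close>])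
    show "pointwise_lipschitz_on {a..b} (\<lambda>t. l (\<sigma> t))"
      using \<sigma> unfolding cone_curve_def by (intro pointwise_lipschitz_on_linear[OF linear_l]) auto
    fix t assume t: "t \<in> {a..b} - N"
    then obtain w where w: "w \<in> K (\<sigma> t)" "(\<sigma> has_vector_derivative w) (at t within {a..b})" using N(2) by blast
    have "((\<lambda>t. l (\<sigma> t)) has_vector_derivative l w) (at t within {a..b})"
      by (rule bounded_linear.has_vector_derivative[OF linear_l w(2)])
    then show "\<exists>D>0. ((\<lambda>t. l (\<sigma> t)) has_real_derivative D) (at t within {a..b})"
      using l_pos[of "\<sigma> t" w] w(1) t subsetD[OF Q, of "\<sigma> t"] by (intro exI[of _ "l w"]) (auto simp: has_real_derivative_iff_has_vector_derivative)
  qed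
qed

text \<open>
  Apply monotonicity to \<open>l\<close> minus the inner product with the direction of
  \<open>\<sigma> b - \<sigma> a\<close>, which is nonnegative on the cones because
  \<open>l\<close> dominates the norm.
\<close>
lemma norm_diff_le_l_diff:
  assumes \<sigma>: "cone_curve a b \<sigma>" and "a \<le> b"
  shows "norm (\<sigma> b - \<sigma> a) \<le> l (\<sigma> b) - l (\<sigma> a)"
proof -
  define u where "u = sgn (\<sigma> b - \<sigma> a)"
  have nu: "norm u \<le> 1" by (simp add: u_def norm_sgn)
  have "l (\<sigma> a) - u \<bullet> \<sigma> a \<le> l (\<sigma> b) - u \<bullet> \<sigma> b"
  proof (rule functional_nondecreasing[OF \<sigma> \<open>a \<le> b\<close>])
    show "bounded_linear (\<lambda>w. l w - u \<bullet> w)"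
      by (intro bounded_linear_sub linear_l bounded_linear_inner_right)
    fix t w assume t: "t \<in> {a..b}" and w: "w \<in> K (\<sigma> t)"
    have "u \<bullet> w \<le> norm u * norm w" by (rule norm_cauchy_schwarz)
    also have "\<dots> \<le> norm w" using nu by (simp add: mult_left_le_one_le)
    also have "\<dots> \<le> l w" using norm_le_l[OF _ w] \<sigma> t unfolding cone_curve_def by blast
    finally show "0 \<le> l w - u \<bullet> w" by simp
  qed
  moreover have "u \<bullet> \<sigma> b - u \<bullet> \<sigma> a = norm (\<sigma> b - \<sigma> a)"
    unfolding inner_diff_right[symmetric] u_def sgn_div_norm
    by (cases "\<sigma> b = \<sigma> a") (auto simp: power2_norm_eq_inner[symmetric] power2_eq_square simp del: inner_diff_right)
  ultimately show ?thesis by linarith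
qed

text \<open>
  The reparametrisation by \<open>l\<close>, rescaled to the unit interval. The last clause says
  that it has no gaps, so that bounds on the new curve over an interval hold at all intermediate
  times of the old one.
\<close>
definition l_parameter :: "(real \<Rightarrow> 'e) \<Rightarrow> (real \<Rightarrow> real) \<Rightarrow> bool" where
  "l_parameter \<sigma> \<tau> \<longleftrightarrow> \<tau> 0 = 0 \<and> \<tau> 1 = 1 \<and> (\<forall>s\<in>{0..1}. \<tau> s \<in> {0..1}) \<and>
    (\<forall>s\<in>{0..1}. l (\<sigma> (\<tau> s)) = l (\<sigma> 0) + s * (l (\<sigma> 1) - l (\<sigma> 0))) \<and>
    (\<forall>s\<in>{0..1}. \<forall>t\<in>{0..1}. s \<le> t \<longrightarrow> \<tau> s \<le> \<tau> t) \<and>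
    (\<forall>s\<in>{0..1}. \<forall>t\<in>{0..1}. \<forall>r. \<tau> s \<le> r \<and> r \<le> \<tau> t \<longrightarrow> (\<exists>q. s \<le> q \<and> q \<le> t \<and> \<tau> q = r))"

lemma l_parameter_exists:
  assumes \<sigma>: "cone_curve 0 1 \<sigma>"
  shows "\<exists>\<tau>. l_parameter \<sigma> \<tau>"
proof -
  let ?h = "\<lambda>t. l (\<sigma> t)"
  have inc: "?h s < ?h t" if "s \<in> {0..1}" "t \<in> {0..1}" "s < t" for s t
    using l_increasing[OF cone_curve_subinterval[OF \<sigma>], of s t] that by auto
  have le: "s \<le> t" if "s \<in> {0..1}" "t \<in> {0..1}" "?h s \<le> ?h t" for s t
    using inc[OF that(2,1)] that(3) by force
  have eq: "s = t" if "s \<in> {0..1}" "t \<in> {0..1}" "?h s = ?h t" for s t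
    using le[of s t] le[of t s] that by auto
  have cont: "continuous_on {0..1} ?h"
    using \<sigma> unfolding cone_curve_def
    by (intro pointwise_lipschitz_on_continuous pointwise_lipschitz_on_linear[OF linear_l]) auto
  define d where "d = ?h 1 - ?h 0"
  have d: "0 < d" using inc[of 0 1] by (simp add: d_def)
  have "\<exists>r\<in>{0..1}. ?h r = ?h 0 + s * d" if "s \<in> {0..1}" for s
  proof -
    have "s * d \<le> 1 * d" using that d by (intro mult_right_mono) auto
    then have "?h 0 + s * d \<le> ?h 1" by (simp add: d_def)
    moreover have "?h 0 \<le> ?h 0 + s * d" using that d by auto
    ultimately show ?thesis using IVT'[of ?h 0 "?h 0 + s * d" 1, OF _ _ _ cont] by auto
  qed
  then obtain \<tau> where \<tau>: "\<And>s. s \<in> {0..1} \<Longrightarrow> \<tau> s \<in> {0..1} \<and> ?h (\<tau> s) = ?h 0 + s * d" by metis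
  have 0: "\<tau> 0 = 0" using \<tau>[of 0] by (rule_tac eq) auto
  have 1: "\<tau> 1 = 1" using \<tau>[of 1] by (rule_tac eq) (auto simp: d_def)
  have mono: "\<tau> s \<le> \<tau> t" if "s \<in> {0..1}" "t \<in> {0..1}" "s \<le> t" for s t
  proof -
    have "s * d \<le> t * d" using that d by simp
    then show ?thesis using \<tau>[OF that(1)] \<tau>[OF that(2)] by (rule_tac le) auto
  qed
  have surj: "\<exists>q. s \<le> q \<and> q \<le> t \<and> \<tau> q = r" if "s \<in> {0..1}" "t \<in> {0..1}" "\<tau> s \<le> r" "r \<le> \<tau> t" for s t r
  proof -
    have r: "r \<in> {0..1}" using \<tau>[OF that(1)] \<tau>[OF that(2)] that by auto
    define q where "q = (?h r - ?h 0) / d"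
    have mono': "?h u \<le> ?h v" if "u \<in> {0..1}" "v \<in> {0..1}" "u \<le> v" for u v
      using inc[OF that(1,2)] that(3) by (cases "u = v") auto
    have "?h (\<tau> s) \<le> ?h r" "?h r \<le> ?h (\<tau> t)" using mono' \<tau> that r by blast+
    then have "s * d \<le> q * d" "q * d \<le> t * d" using \<tau>[OF that(1)] \<tau>[OF that(2)] d by (auto simp: q_def)
    then have q: "s \<le> q" "q \<le> t" using d by auto
    then have "q \<in> {0..1}" using that by auto
    moreover have "?h 0 + q * d = ?h r" using d by (simp add: q_def)
    ultimately have "\<tau> q = r" using \<tau> r by (rule_tac eq) auto
    with q show ?thesis by blast
  qed
  show ?thesis
    unfolding l_parameter_def using 0 1 \<tau> mono surj by (intro exI[of _ \<tau>]) (simp add: d_def)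
qed

text \<open>
  By homogeneity a counterexample at a nearby point may be scaled to \<open>l w = k\<close>, which
  bounds its norm; a limit of such vectors would be a cone vector at \<open>x\<close> with \<open>m
  w \<le> 0\<close>.
\<close>
lemma functional_nonneg_nearby:
  assumes x: "x \<in> Q" and m: "bounded_linear m" and k: "0 < k"
    and pos: "\<And>w. w \<in> K x \<Longrightarrow> l w = k \<Longrightarrow> 0 < (m w :: real)"
  shows "\<exists>e>0. \<forall>z\<in>Q \<inter> ball x e. \<forall>w\<in>K z. 0 \<le> m w"
proof (rule ccontr)
  assume neg: "\<not> ?thesis"
  have "\<exists>z w. z \<in> Q \<and> dist x z < inverse (Suc n) \<and> w \<in> K z \<and> m w < 0 \<and> l w = k" for n
  proof -
    have "\<exists>z\<in>Q \<inter> ball x (inverse (Suc n)). \<exists>w\<in>K z. m w < 0"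
      using neg by (metis inverse_positive_iff_positive not_less of_nat_0_less_iff zero_less_Suc)
    then obtain z w where zw: "z \<in> Q" "dist x z < inverse (Suc n)" "w \<in> K z" "m w < 0" by auto
    have lw: "0 < l w" using l_pos zw by blast
    then have "(k / l w) *\<^sub>R w \<in> K z" using scale zw k by simp
    moreover have "m ((k / l w) *\<^sub>R w) < 0" using zw lw k linear_scale[OF bounded_linear.linear[OF m]]
      by (simp add: mult_pos_neg divide_neg_pos)
    moreover have "l ((k / l w) *\<^sub>R w) = k" using lw linear_scale[OF bounded_linear.linear[OF linear_l]] by simp
    ultimately show ?thesis using zw by blast
  qed
  then obtain z w where zw: "\<And>n. z n \<in> Q" "\<And>n. dist x (z n) < inverse (Suc n)" "\<And>n. w n \<in> K (z n)"
    "\<And>n. m (w n) < 0" "\<And>n. l (w n) = k"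
    by metis
  have "bounded (range w)"
    unfolding bounded_iff using norm_le_l zw by (intro exI[of _ k]) (metis rangeE)
  then obtain v r where vr: "strict_mono (r :: nat \<Rightarrow> nat)" "(w \<circ> r) \<longlonglongrightarrow> v"
    using bounded_imp_convergent_subsequence by blast
  have z: "z \<longlonglongrightarrow> x"
  proof (rule metric_tendsto_imp_tendsto[OF LIMSEQ_inverse_real_of_nat])
    show "\<forall>\<^sub>F n in sequentially. dist (z n) x \<le> dist (inverse (real (Suc n))) 0"
      using zw(2) by (intro always_eventually allI) (auto simp: dist_commute less_imp_le)
  qed
  have "(\<lambda>n. l ((w \<circ> r) n)) \<longlonglongrightarrow> l v" by (rule bounded_linear.tendsto[OF linear_l vr(2)])
  then have lv: "l v = k" using zw(5) by (simp add: LIMSEQ_const_iff o_def)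
  have "(\<lambda>n. m ((w \<circ> r) n)) \<longlonglongrightarrow> m v" by (rule bounded_linear.tendsto[OF m vr(2)])
  then have mv: "m v \<le> 0" using zw(4) by (intro LIMSEQ_le_const2) (auto simp: o_def less_imp_le)
  have "v \<noteq> 0" using lv k linear_0[OF bounded_linear.linear[OF linear_l]] by auto
  then have "v \<in> K x"
    using closed_K[of "z \<circ> r" "w \<circ> r" x v, OF _ _ LIMSEQ_subseq_LIMSEQ[OF z vr(1)] vr(2)] zw(1,3) by simp
  then have "0 < m v" using lv by (rule pos)
  then show False using mv by simp
qed

text \<open>
  Parametrised by \<open>l\<close>, the curves have a common Lipschitz constant, so a subsequence
  converges uniformly to a Lipschitz curve \<open>g\<close> along which \<open>l\<close> grows at
  the constant rate \<open>\<kappa>\<close>. Suppose that the derivative \<open>v\<close> of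
  \<open>g\<close> at \<open>t\<close> is not in the cone. A hyperplane separates \<open>v\<close>
  from the slice \<open>l w = \<kappa>\<close> of the cone, which gives a functional
  \<open>m\<close> with \<open>m v < 0\<close> that is nonnegative on all cones near \<open>g
  t\<close>. Then \<open>m\<close> is nondecreasing along the approximating curves near
  \<open>t\<close>, hence along \<open>g\<close>, contradicting \<open>m v < 0\<close>.
\<close>
theorem cone_curve_limit:
  assumes \<sigma>: "\<And>n. cone_curve 0 1 (\<sigma> n)" and x: "(\<lambda>n. \<sigma> n 0) \<longlonglongrightarrow> x" and y: "(\<lambda>n. \<sigma> n 1) \<longlonglongrightarrow> y"
    and "x \<noteq> y"
  shows "\<exists>g L. cone_curve 0 1 g \<and> L-lipschitz_on {0..1} g \<and> g 0 = x \<and> g 1 = y"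
proof -
  have \<sigma>Q: "\<sigma> n t \<in> Q" if "t \<in> {0..1}" for n t using \<sigma>[of n] that unfolding cone_curve_def by blast
  obtain \<tau> where par: "\<And>n. l_parameter (\<sigma> n) (\<tau> n)" using l_parameter_exists[OF \<sigma>] by metis
  have \<tau>: "\<And>n. \<tau> n 0 = 0" "\<And>n. \<tau> n 1 = 1" "\<And>n s. s \<in> {0..1} \<Longrightarrow> \<tau> n s \<in> {0..1}"
    "\<And>n s. s \<in> {0..1} \<Longrightarrow> l (\<sigma> n (\<tau> n s)) = l (\<sigma> n 0) + s * (l (\<sigma> n 1) - l (\<sigma> n 0))"
    "\<And>n s t. s \<in> {0..1} \<Longrightarrow> t \<in> {0..1} \<Longrightarrow> s \<le> t \<Longrightarrow> \<tau> n s \<le> \<tau> n t"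
    "\<And>n s t r. s \<in> {0..1} \<Longrightarrow> t \<in> {0..1} \<Longrightarrow> \<tau> n s \<le> r \<and> r \<le> \<tau> n t \<Longrightarrow> \<exists>q. s \<le> q \<and> q \<le> t \<and> \<tau> n q = r"
    using par unfolding l_parameter_def by blast+
  define G where "G n s = \<sigma> n (\<tau> n s)" for n s
  have GQ: "G n s \<in> Q" if "s \<in> {0..1}" for n s using \<sigma>Q \<tau>(3) that by (simp add: G_def)
  have "bounded (l ` Q)" "bounded Q" using compact_Q linear_l bounded_linear_image compact_imp_bounded by blast+
  then obtain M0 M where M0: "\<And>z. z \<in> Q \<Longrightarrow> \<bar>l z\<bar> \<le> M0" and M: "\<And>z. z \<in> Q \<Longrightarrow> norm z \<le> M"
    unfolding bounded_iff by auto
  define L where "L = 2 * M0"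
  have "\<bar>l (\<sigma> 0 0)\<bar> \<le> M0" by (intro M0 \<sigma>Q) simp
  then have L0: "0 \<le> L" by (simp add: L_def)
  have Glip: "norm (G n s - G n t) \<le> L * norm (s - t)" if "s \<in> {0..1}" "t \<in> {0..1}" for n s t
  proof -
    have *: "norm (G n t - G n s) \<le> L * \<bar>t - s\<bar>" if "s \<in> {0..1}" "t \<in> {0..1}" "s \<le> t" for s t
    proof -
      have "norm (G n t - G n s) \<le> l (G n t) - l (G n s)"
        unfolding G_def using that \<tau>(3)[of s n] \<tau>(3)[of t n] \<tau>(5)[of s t n]
        by (intro norm_diff_le_l_diff cone_curve_subinterval[OF \<sigma>]) auto
      also have "\<dots> = (t - s) * (l (\<sigma> n 1) - l (\<sigma> n 0))" using that \<tau>(4) by (simp add: G_def algebra_simps)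
      also have "\<dots> \<le> (t - s) * L"
        using M0[OF \<sigma>Q, of 0 n] M0[OF \<sigma>Q, of 1 n] that by (intro mult_left_mono) (auto simp: L_def)
      finally show ?thesis using that by (simp add: mult_ac)
    qed
    show ?thesis using *[of s t] *[of t s] that by (cases "s \<le> t") (auto simp: norm_minus_commute abs_minus_commute)
  qed
  have equi: "\<exists>d>0. \<forall>n t. t \<in> {0..1} \<and> norm (s - t) < d \<longrightarrow> norm (G n s - G n t) < e"
    if "s \<in> {0..1}" "0 < e" for s e :: real
  proof (intro exI[of _ "e / (L + 1)"] conjI allI impI)
    show "0 < e / (L + 1)" using that L0 by simp
    fix n t assume t: "t \<in> {0..1} \<and> norm (s - t) < e / (L + 1)"
    have "norm (G n s - G n t) \<le> L * norm (s - t)" using Glip that t by blast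
    also have "\<dots> \<le> (L + 1) * norm (s - t)" by (simp add: mult_right_mono)
    also have "\<dots> < e" using t L0 by (simp add: field_simps)
    finally show "norm (G n s - G n t) < e" .
  qed
  obtain g and k :: "nat \<Rightarrow> nat" where gk: "continuous_on {0..1} g" "strict_mono k"
    "\<And>e. 0 < e \<Longrightarrow> \<exists>N. \<forall>n s. n \<ge> N \<and> s \<in> {0..1} \<longrightarrow> norm (G (k n) s - g s) < e"
  proof (rule Arzela_Ascoli[of "{0..1::real}" G M])
    show "norm (G n s) \<le> M" if "s \<in> {0..1}" for n s using GQ[OF that] by (rule M)
  qed (rule compact_Icc, erule (1) equi, rule that)
  have lim: "(\<lambda>n. G (k n) s) \<longlonglongrightarrow> g s" if "s \<in> {0..1}" for s
    using gk(3) that unfolding LIMSEQ_iff by blast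
  have gQ: "g s \<in> Q" if "s \<in> {0..1}" for s
    using closed_sequentially[OF compact_imp_closed[OF compact_Q] _ lim[OF that]] GQ[OF that] by blast
  have g0: "g 0 = x"
    using LIMSEQ_unique[OF lim[of 0]] LIMSEQ_subseq_LIMSEQ[OF x gk(2)] by (simp add: G_def \<tau> o_def)
  have g1: "g 1 = y"
    using LIMSEQ_unique[OF lim[of 1]] LIMSEQ_subseq_LIMSEQ[OF y gk(2)] by (simp add: G_def \<tau> o_def)
  have glip: "L-lipschitz_on {0..1} g"
  proof (rule lipschitz_onI[OF _ L0])
    fix s t :: real assume st: "s \<in> {0..1}" "t \<in> {0..1}"
    show "dist (g s) (g t) \<le> L * dist s t"
    proof (rule LIMSEQ_le_const2)
      show "(\<lambda>n. dist (G (k n) s) (G (k n) t)) \<longlonglongrightarrow> dist (g s) (g t)" by (intro tendsto_intros lim st)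
      show "\<exists>N. \<forall>n\<ge>N. dist (G (k n) s) (G (k n) t) \<le> L * dist s t"
        unfolding dist_norm using Glip[OF st] by blast
    qed
  qed
  define \<kappa> where "\<kappa> = l y - l x"
  have lg: "l (g s) = l x + s * \<kappa>" if "s \<in> {0..1}" for s
  proof (rule LIMSEQ_unique)
    show "(\<lambda>n. l (G (k n) s)) \<longlonglongrightarrow> l (g s)" by (rule bounded_linear.tendsto[OF linear_l lim[OF that]])
    have "(\<lambda>n. l (\<sigma> n 0) + s * (l (\<sigma> n 1) - l (\<sigma> n 0))) \<longlonglongrightarrow> l x + s * \<kappa>"
      unfolding \<kappa>_def by (intro tendsto_intros bounded_linear.tendsto[OF linear_l] x y)
    from LIMSEQ_subseq_LIMSEQ[OF this gk(2)]
    show "(\<lambda>n. l (G (k n) s)) \<longlonglongrightarrow> l x + s * \<kappa>" using \<tau>(4)[OF that] by (simp add: G_def o_def)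
  qed
  have "norm (y - x) \<le> \<kappa>"
  proof (rule LIMSEQ_le)
    show "(\<lambda>n. norm (\<sigma> n 1 - \<sigma> n 0)) \<longlonglongrightarrow> norm (y - x)" by (intro tendsto_intros x y)
    show "(\<lambda>n. l (\<sigma> n 1) - l (\<sigma> n 0)) \<longlonglongrightarrow> \<kappa>"
      unfolding \<kappa>_def by (intro tendsto_intros bounded_linear.tendsto[OF linear_l] x y)
    show "\<exists>N. \<forall>n\<ge>N. norm (\<sigma> n 1 - \<sigma> n 0) \<le> l (\<sigma> n 1) - l (\<sigma> n 0)"
      using norm_diff_le_l_diff[OF \<sigma>] by simp
  qed
  then have \<kappa>: "0 < \<kappa>" using \<open>x \<noteq> y\<close> by (smt (verit) zero_less_norm_iff right_minus_eq)
  have der: "v \<in> K (g t)" if t: "t \<in> {0<..<1}" and v: "(g has_vector_derivative v) (at t)" for t v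
  proof (rule ccontr)
    assume vK: "v \<notin> K (g t)"
    have t01: "t \<in> {0..1}" using t by auto
    have "((\<lambda>s. l (g s)) has_vector_derivative l v) (at t)" by (rule bounded_linear.has_vector_derivative[OF linear_l v])
    moreover have "((\<lambda>s. l (g s)) has_vector_derivative \<kappa>) (at t)"
    proof (rule has_vector_derivative_transform_within_open[of "\<lambda>s. l x + s * \<kappa>" _ _ "{0<..<1}"])
      show "((\<lambda>s. l x + s * \<kappa>) has_vector_derivative \<kappa>) (at t)" by (auto intro!: derivative_eq_intros)
      show "open {0<..<1::real}" by simp
      show "t \<in> {0<..<1}" by (rule t)
      show "l x + s * \<kappa> = l (g s)" if "s \<in> {0<..<1}" for s using lg[of s] that by simp
    qed
    ultimately have lv: "l v = \<kappa>" by (rule vector_derivative_unique_at)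
    define S where "S = {w \<in> K (g t). l w = \<kappa>}"
    have "convex S"
    proof -
      have "convex {w. l w = \<kappa>}" unfolding convex_def
        using linear_add[OF bounded_linear.linear[OF linear_l]] linear_scale[OF bounded_linear.linear[OF linear_l]]
        by (auto simp: algebra_simps) (metis distrib_right mult_1)
      moreover have "S = K (g t) \<inter> {w. l w = \<kappa>}" by (auto simp: S_def)
      ultimately show ?thesis using convex_K[OF gQ[OF t01]] by (simp add: convex_Int)
    qed
    moreover have "closed S"
      unfolding closed_sequential_limits
    proof (intro allI impI)
      fix W w assume "(\<forall>n. W n \<in> S) \<and> W \<longlonglongrightarrow> w"
      then have W: "\<And>n. W n \<in> K (g t)" "\<And>n. l (W n) = \<kappa>" "W \<longlonglongrightarrow> w" by (auto simp: S_def)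
      have "(\<lambda>n. l (W n)) \<longlonglongrightarrow> l w" by (rule bounded_linear.tendsto[OF linear_l W(3)])
      then have lw: "l w = \<kappa>" using W(2) by (simp add: LIMSEQ_const_iff)
      then have "w \<noteq> 0" using \<kappa> linear_0[OF bounded_linear.linear[OF linear_l]] by auto
      then have "w \<in> K (g t)" using closed_K[of "\<lambda>_. g t" W "g t" w] W gQ[OF t01] by auto
      then show "w \<in> S" using lw by (simp add: S_def)
    qed
    moreover have "v \<notin> S" using vK by (simp add: S_def)
    ultimately obtain a b where ab: "a \<bullet> v < b" "\<And>w. w \<in> S \<Longrightarrow> a \<bullet> w > b"
      using separating_hyperplane_closed_point by metis
    \<comment> \<open>subtracting a multiple of l makes the affine separation homogeneous\<close>
    define m where "m w = a \<bullet> w - (b / \<kappa>) * l w" for w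
    have m: "bounded_linear m"
      unfolding m_def by (intro bounded_linear_sub bounded_linear_inner_right bounded_linear_const_mult linear_l)
    have "0 < m w" if "w \<in> K (g t)" "l w = \<kappa>" for w
      using ab(2)[of w] that \<kappa> by (simp add: m_def S_def)
    from functional_nonneg_nearby[OF gQ[OF t01] m \<kappa> this] obtain e where
      e: "e > 0" "\<And>z w. z \<in> Q \<Longrightarrow> z \<in> ball (g t) e \<Longrightarrow> w \<in> K z \<Longrightarrow> 0 \<le> m w" by auto
    have "((\<lambda>s. m (g s)) has_vector_derivative m v) (at t)" by (rule bounded_linear.has_vector_derivative[OF m v])
    then have "((\<lambda>s. m (g s)) has_real_derivative m v) (at t)" by (simp add: has_real_derivative_iff_has_vector_derivative)
    moreover have "m v < 0" using ab(1) \<kappa> lv by (simp add: m_def)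
    ultimately obtain d where d: "d > 0" "\<And>h. 0 < h \<Longrightarrow> h < d \<Longrightarrow> m (g (t + h)) < m (g t)"
      using DERIV_neg_dec_right[of "\<lambda>s. m (g s)" "m v" t] by auto
    obtain d2 where d2: "d2 > 0" "\<And>s. s \<in> {0..1} \<Longrightarrow> dist s t < d2 \<Longrightarrow> dist (g s) (g t) < e / 2"
      using gk(1)[unfolded continuous_on_iff, rule_format, OF t01, of "e / 2"] e(1) by auto
    define h where "h = min (min d d2) (1 - t) / 2"
    have "0 < h" "h < d" "h < d2" "h < 1 - t" using d d2 t by (auto simp: h_def min_def)
    define s where "s = t + h"
    have s: "t < s" "s - t < d" "s - t < d2" "s \<in> {0..1}" using \<open>0 < h\<close> \<open>h < d\<close> \<open>h < d2\<close> \<open>h < 1 - t\<close> t by (auto simp: s_def)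
    obtain N where N: "\<And>n q. n \<ge> N \<Longrightarrow> q \<in> {0..1} \<Longrightarrow> norm (G (k n) q - g q) < e / 2"
      using gk(3)[of "e / 2"] e(1) by auto
    have mono: "m (G (k n) t) \<le> m (G (k n) s)" if "n \<ge> N" for n
      unfolding G_def
    proof (rule functional_nondecreasing[OF _ _ m])
      show "cone_curve (\<tau> (k n) t) (\<tau> (k n) s) (\<sigma> (k n))"
        using \<tau>(3)[OF t01, of "k n"] \<tau>(3)[OF s(4), of "k n"] by (intro cone_curve_subinterval[OF \<sigma>]) auto
      show "\<tau> (k n) t \<le> \<tau> (k n) s" using \<tau>(5) t01 s by auto
      fix r w assume r: "r \<in> {\<tau> (k n) t..\<tau> (k n) s}" and w: "w \<in> K (\<sigma> (k n) r)"
      then obtain q where q: "t \<le> q" "q \<le> s" "\<tau> (k n) q = r" using \<tau>(6)[OF t01 s(4), of "k n" r] by auto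
      then have q01: "q \<in> {0..1}" using t s by auto
      have "dist (G (k n) q) (g q) < e / 2" using N[OF \<open>n \<ge> N\<close> q01] by (simp add: dist_norm)
      moreover have "dist (g q) (g t) < e / 2" using q s q01 by (intro d2) (auto simp: dist_real_def)
      ultimately have "dist (G (k n) q) (g t) < e" 
        using dist_triangle[of "G (k n) q" "g t" "g q"] by simp
      moreover have "G (k n) q = \<sigma> (k n) r" using q by (simp add: G_def)
      ultimately show "0 \<le> m w" using e(2)[of "\<sigma> (k n) r" w] GQ[OF q01, of "k n"] w by (simp add: dist_commute)
    qed
    have "m (g t) \<le> m (g s)"
      by (rule LIMSEQ_le[OF bounded_linear.tendsto[OF m lim[OF t01]] bounded_linear.tendsto[OF m lim[OF s(4)]]]) (use mono in blast)
    moreover have "m (g s) < m (g t)" using d(2)[of "s - t"] s by auto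
    ultimately show False by simp
  qed
  obtain N where N: "negligible N" "\<And>t. t \<in> {0<..<1} - N \<Longrightarrow> \<exists>v. (g has_vector_derivative v) (at t)"
    using AE_vector_derivative_lipschitz[OF glip] by blast
  have "cone_curve 0 1 g"
    unfolding cone_curve_def
  proof (intro conjI exI[of _ "insert 0 (insert 1 N)"] ballI)
    show "pointwise_lipschitz_on {0..1} g" unfolding pointwise_lipschitz_on_def
      using lipschitz_onD[OF glip] by (intro ballI exI[of _ UNIV] exI[of _ L]) (auto simp: dist_norm)
    show "g ` {0..1} \<subseteq> Q" using gQ by blast
    show "negligible (insert 0 (insert 1 N))" using N(1) by simp
    fix t assume t: "t \<in> {0..1} - insert 0 (insert 1 N)"
    then have t': "t \<in> {0<..<1} - N" by auto
    then obtain v where v: "(g has_vector_derivative v) (at t)" using N(2) by blast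
    then show "\<exists>w\<in>K (g t). (g has_vector_derivative w) (at t within {0..1})"
      using der[OF _ v] t' has_vector_derivative_at_within by blast
  qed
  have "cone_curve 0 1 g \<and> L-lipschitz_on {0..1} g \<and> g 0 = x \<and> g 1 = y"
    using \<open>cone_curve 0 1 g\<close> glip g0 g1 by simp
  then show ?thesis by blast
qed

end

section \<open>Charts\<close>

locale atlas_manifold =
  fixes A :: "('m::{t2_space, second_countable_topology}, 'e::{real_inner, heine_borel}) chart set"
  assumes atlas: "smooth_atlas A"
begin

abbreviation chart_inv :: "('m, 'e) chart \<Rightarrow> 'e \<Rightarrow> 'm" where
  "chart_inv c \<equiv> inv_into (fst c) (snd c)"

definition region :: "('m, 'e) chart \<Rightarrow> 'e set \<Rightarrow> 'm set" where
  "region c S = {x \<in> fst c. snd c x \<in> S}"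

lemma open_chart: "c \<in> A \<Longrightarrow> open (fst c)" "c \<in> A \<Longrightarrow> open (snd c ` fst c)"
  using atlas unfolding smooth_atlas_def by blast+

lemma homeomorphism_chart: "c \<in> A \<Longrightarrow> homeomorphism (fst c) (snd c ` fst c) (snd c) (chart_inv c)"
  using atlas unfolding smooth_atlas_def by blast

lemma chart_at: "\<exists>c\<in>A. x \<in> fst c"
  using atlas unfolding smooth_atlas_def by blast

lemma chart_inv_chart [simp]: "c \<in> A \<Longrightarrow> x \<in> fst c \<Longrightarrow> chart_inv c (snd c x) = x"
  using homeomorphism_chart by (metis homeomorphism_apply1)

lemma chart_chart_inv [simp]: "e \<in> snd c ` fst c \<Longrightarrow> snd c (chart_inv c e) = e"
  by (rule f_inv_into_f)

lemma chart_inv_in [simp]: "e \<in> snd c ` fst c \<Longrightarrow> chart_inv c e \<in> fst c"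
  by (rule inv_into_into)

lemma continuous_on_chart: "c \<in> A \<Longrightarrow> continuous_on (fst c) (snd c)"
  using homeomorphism_chart homeomorphism_def by blast

lemma continuous_on_chart_inv: "c \<in> A \<Longrightarrow> continuous_on (snd c ` fst c) (chart_inv c)"
  using homeomorphism_chart homeomorphism_def by blast

lemma tendsto_chart:
  assumes "c \<in> A" "x \<in> fst c" "(f \<longlongrightarrow> x) F"
  shows "((\<lambda>n. snd c (f n)) \<longlongrightarrow> snd c x) F"
  using assms continuous_on_chart open_chart continuous_on_eq_continuous_at isCont_tendsto_compose by metis

lemma tendsto_chart_inv:
  assumes "c \<in> A" "e \<in> snd c ` fst c" "(f \<longlongrightarrow> e) F"
  shows "((\<lambda>n. chart_inv c (f n)) \<longlongrightarrow> chart_inv c e) F"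
  using assms continuous_on_chart_inv open_chart continuous_on_eq_continuous_at isCont_tendsto_compose by metis

lemma region_eq_image:
  assumes "c \<in> A" "S \<subseteq> snd c ` fst c"
  shows "region c S = chart_inv c ` S"
proof
  show "region c S \<subseteq> chart_inv c ` S"
    using assms(1) unfolding region_def by (force simp: image_iff)
  show "chart_inv c ` S \<subseteq> region c S"
    using assms(2) unfolding region_def by (auto simp: subset_iff)
qed

lemma compact_region: "c \<in> A \<Longrightarrow> S \<subseteq> snd c ` fst c \<Longrightarrow> compact S \<Longrightarrow> compact (region c S)"
  by (simp add: region_eq_image compact_continuous_image continuous_on_subset[OF continuous_on_chart_inv])

lemma open_region:
  assumes "c \<in> A" "open S" shows "open (region c S)"
proof -
  have "region c S = fst c \<inter> snd c -` S" by (auto simp: region_def)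
  then show ?thesis using continuous_open_preimage[OF continuous_on_chart open_chart(1) \<open>open S\<close>] assms by simp
qed

lemma region_mono: "S \<subseteq> T \<Longrightarrow> region c S \<subseteq> region c T"
  by (auto simp: region_def)

section \<open>Transition maps and tangent vectors\<close>

lemma open_overlap:
  assumes "c \<in> A" "d \<in> A" shows "open (snd c ` (fst c \<inter> fst d))"
proof -
  have "snd c ` (fst c \<inter> fst d) = snd c ` fst c \<inter> chart_inv c -` fst d"
    using assms(1) by (auto simp: image_iff)
  then show ?thesis
    using continuous_open_preimage[OF continuous_on_chart_inv open_chart(2) open_chart(1)] assms by metis
qed

lemma transition_chart: "c \<in> A \<Longrightarrow> x \<in> fst c \<Longrightarrow> transition c d (snd c x) = snd d x"
  by (simp add: transition_def)

lemma smooth_transition: "c \<in> A \<Longrightarrow> d \<in> A \<Longrightarrow> smooth_on (snd c ` (fst c \<inter> fst d)) (transition c d)"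
  using atlas unfolding smooth_atlas_def by blast

definition change :: "('m, 'e) chart \<Rightarrow> ('m, 'e) chart \<Rightarrow> 'm \<Rightarrow> 'e \<Rightarrow> 'e" where
  "change c d x = frechet_derivative (transition c d) (at (snd c x))"

lemma transition_has_derivative:
  assumes "c \<in> A" "d \<in> A" "x \<in> fst c" "x \<in> fst d"
  shows "(transition c d has_derivative change c d x) (at (snd c x))"
proof -
  have "higher_differentiable_on (snd c ` (fst c \<inter> fst d)) (transition c d) (Suc 0)"
    using smooth_transition assms(1,2) unfolding smooth_on_def by blast
  then have "transition c d differentiable (at (snd c x))" using assms by auto
  then show ?thesis unfolding change_def by (simp add: frechet_derivative_works)
qed

text \<open>
  The chain rule, applied to the identity between transition maps on the overlap of the first two
  charts.
\<close>
lemma change_comp: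
  assumes "c \<in> A" "d \<in> A" "e \<in> A" "x \<in> fst c" "x \<in> fst d" "x \<in> fst e"
  shows "change d e x (change c d x w) = change c e x w"
proof -
  have "(transition d e has_derivative change d e x) (at (transition c d (snd c x)))"
    using transition_has_derivative[of d e x] assms by (simp add: transition_chart)
  from has_derivative_compose[OF transition_has_derivative[of c d x] this]
  have 1: "((\<lambda>y. transition d e (transition c d y)) has_derivative (\<lambda>w. change d e x (change c d x w))) (at (snd c x))"
    using assms by blast
  have 2: "(transition c e has_derivative (\<lambda>w. change d e x (change c d x w))) (at (snd c x))"
  proof (rule has_derivative_transform_within_open[OF 1 open_overlap[of c d]])
    show "transition d e (transition c d y) = transition c e y" if "y \<in> snd c ` (fst c \<inter> fst d)" for y
      using that assms by (auto simp: transition_chart)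
  qed (use assms in auto)
  from has_derivative_unique[OF 2 transition_has_derivative[of c e x]] assms
  show ?thesis by (metis (no_types))
qed

lemma change_self:
  assumes "c \<in> A" "x \<in> fst c" shows "change c c x w = w"
proof -
  have "(transition c c has_derivative (\<lambda>w. w)) (at (snd c x))"
  proof (rule has_derivative_transform_within_open[OF has_derivative_ident open_chart(2)[OF assms(1)]])
    show "y = transition c c y" if "y \<in> snd c ` fst c" for y
      using that assms by (auto simp: transition_chart)
  qed (use assms in auto)
  from has_derivative_unique[OF this transition_has_derivative[of c c x]] assms
  show ?thesis by metis
qed

text \<open>
  The inverse of reading off the coordinates of a tangent vector at \<open>x\<close> in the chart
  \<open>c\<close>.
\<close>
definition lift_vector :: "('m, 'e) chart \<Rightarrow> 'm \<Rightarrow> 'e \<Rightarrow> ('m, 'e) tangent_vector" where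
  "lift_vector c x w = (\<lambda>d. if d \<in> A \<and> x \<in> fst d then change c d x w else 0)"

lemma lift_vector_in_tangent_space:
  assumes "c \<in> A" "x \<in> fst c" shows "lift_vector c x w \<in> tangent_space A x"
  unfolding tangent_space_def change_def[symmetric] using assms by (auto simp: lift_vector_def change_comp)

lemma lift_vector_chart [simp]: "c \<in> A \<Longrightarrow> x \<in> fst c \<Longrightarrow> lift_vector c x w c = w"
  by (simp add: lift_vector_def change_self)

lemma linear_lift_vector:
  assumes "c \<in> A" "x \<in> fst c" shows "linear (lift_vector c x)"
proof -
  have "linear (change c d x)" if "d \<in> A" "x \<in> fst d" for d
    using transition_has_derivative[of c d x] assms that has_derivative_linear by blast
  then show ?thesis
    by (intro linearI) (auto simp: lift_vector_def fun_eq_iff scaleR_fun_def linear_add linear_scale)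
qed

text \<open>
  This identifies the whole space of the tangent bundle topology.
\<close>
lemma openin_tangent_bundle: "open_in_tangent_bundle A (tangent_bundle A)"
  unfolding open_in_tangent_bundle_def
proof (intro conjI ballI)
  fix c assume c: "c \<in> A"
  have "(\<lambda>(x, v). (snd c x, v c)) ` (tangent_bundle A \<inter> (fst c \<times> UNIV)) = snd c ` fst c \<times> UNIV"
  proof (intro equalityI subsetI)
    fix p assume "p \<in> snd c ` fst c \<times> (UNIV :: 'e set)"
    then obtain x w where "p = (snd c x, w)" "x \<in> fst c" by auto
    then show "p \<in> (\<lambda>(x, v). (snd c x, v c)) ` (tangent_bundle A \<inter> (fst c \<times> UNIV))"
      using c lift_vector_in_tangent_space[of c x w] 
      by (intro image_eqI[of _ _ "(x, lift_vector c x w)"]) (auto simp: tangent_bundle_def)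
  qed auto
  then show "open ((\<lambda>(x, v). (snd c x, v c)) ` (tangent_bundle A \<inter> (fst c \<times> UNIV)))"
    using open_chart(2)[OF c] by (simp add: open_Times)
qed simp

section \<open>Locally Lipschitz curves\<close>

lemma locally_lipschitz_curve_subset:
  assumes "locally_lipschitz_curve A I \<gamma>" "J \<subseteq> I"
  shows "locally_lipschitz_curve A J \<gamma>"
  unfolding locally_lipschitz_curve_def
proof
  fix t assume "t \<in> J"
  then obtain c \<delta> L where *: "c \<in> A" "\<delta> > 0" "\<gamma> ` (I \<inter> ball t \<delta>) \<subseteq> fst c"
    "L-lipschitz_on (I \<inter> ball t \<delta>) (snd c \<circ> \<gamma>)"
    using assms unfolding locally_lipschitz_curve_def by (meson subsetD)
  have "J \<inter> ball t \<delta> \<subseteq> I \<inter> ball t \<delta>" using assms(2) by blast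
  then show "\<exists>c\<in>A. \<exists>\<delta>>0. \<exists>L. \<gamma> ` (J \<inter> ball t \<delta>) \<subseteq> fst c \<and> L-lipschitz_on (J \<inter> ball t \<delta>) (snd c \<circ> \<gamma>)"
    using * lipschitz_on_subset image_mono by (meson subset_trans)
qed

lemma locally_lipschitz_curve_continuous:
  assumes "locally_lipschitz_curve A I \<gamma>"
  shows "continuous_on I \<gamma>"
  unfolding continuous_on_def
proof
  fix t assume t: "t \<in> I"
  then obtain c \<delta> L where *: "c \<in> A" "\<delta> > 0" "\<gamma> ` (I \<inter> ball t \<delta>) \<subseteq> fst c"
    "L-lipschitz_on (I \<inter> ball t \<delta>) (snd c \<circ> \<gamma>)"
    using assms unfolding locally_lipschitz_curve_def by meson
  have tI: "t \<in> I \<inter> ball t \<delta>" using t * by simp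
  have ev: "\<forall>\<^sub>F s in at t within I. s \<in> I \<inter> ball t \<delta>"
    unfolding eventually_at using * by (auto simp: dist_commute intro!: exI[of _ \<delta>])
  have "continuous_on (I \<inter> ball t \<delta>) (snd c \<circ> \<gamma>)" using *(4) by (rule lipschitz_on_continuous_on)
  then have "((snd c \<circ> \<gamma>) \<longlongrightarrow> (snd c \<circ> \<gamma>) t) (at t within (I \<inter> ball t \<delta>))"
    using tI unfolding continuous_on_def by blast
  moreover have "at t within (I \<inter> ball t \<delta>) = at t within I"
    by (rule at_within_nhd[of _ "ball t \<delta>"]) (use * in auto)
  ultimately have "((\<lambda>s. chart_inv c ((snd c \<circ> \<gamma>) s)) \<longlongrightarrow> chart_inv c ((snd c \<circ> \<gamma>) t)) (at t within I)"
    using imageI[OF subsetD[OF *(3) imageI[OF tI]], of "snd c"] by (intro tendsto_chart_inv[OF *(1)]) (auto simp: o_def)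
  moreover have "chart_inv c ((snd c \<circ> \<gamma>) s) = \<gamma> s" if "s \<in> I \<inter> ball t \<delta>" for s
    using *(1,3) that by (auto simp: image_subset_iff)
  ultimately show "(\<gamma> \<longlongrightarrow> \<gamma> t) (at t within I)"
    using tendsto_cong[of "\<lambda>s. chart_inv c ((snd c \<circ> \<gamma>) s)" \<gamma>] tI eventually_mono[OF ev]
    by (smt (verit, ccfv_SIG))
qed

text \<open>
  Transition maps are locally Lipschitz, so it does not matter in which chart the Lipschitz
  condition is tested. This is what allows curves from different charts to be joined.
\<close>
lemma locally_lipschitz_curve_in_chart:
  assumes \<gamma>: "locally_lipschitz_curve A I \<gamma>" and t: "t \<in> I" and d: "d \<in> A" "\<gamma> t \<in> fst d"
  shows "\<exists>\<delta>>0. \<exists>L. \<gamma> ` (I \<inter> ball t \<delta>) \<subseteq> fst d \<and> L-lipschitz_on (I \<inter> ball t \<delta>) (snd d \<circ> \<gamma>)"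
proof -
  obtain c \<delta>1 L1 where *: "c \<in> A" "\<delta>1 > 0" "\<gamma> ` (I \<inter> ball t \<delta>1) \<subseteq> fst c"
    "L1-lipschitz_on (I \<inter> ball t \<delta>1) (snd c \<circ> \<gamma>)"
    using \<gamma> t unfolding locally_lipschitz_curve_def by meson
  have tI: "t \<in> I \<inter> ball t \<delta>1" using t * by simp
  then have tc: "\<gamma> t \<in> fst c" using * by blast
  obtain e L2 where e: "e > 0" "L2 \<ge> 0" "ball (snd c (\<gamma> t)) e \<subseteq> snd c ` (fst c \<inter> fst d)"
    "\<And>y z. y \<in> ball (snd c (\<gamma> t)) e \<Longrightarrow> z \<in> ball (snd c (\<gamma> t)) e \<Longrightarrow>
      norm (transition c d y - transition c d z) \<le> L2 * norm (y - z)"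
    using smooth_on_imp_locally_lipschitz[OF smooth_transition[OF *(1) d(1)] open_overlap[OF *(1) d(1)], of "snd c (\<gamma> t)"]
      tc d(2) by (metis IntI imageI)
  have "continuous_on (I \<inter> ball t \<delta>1) (snd c \<circ> \<gamma>)" using *(4) by (rule lipschitz_on_continuous_on)
  then obtain \<delta>2 where \<delta>2: "\<delta>2 > 0" "\<And>s. s \<in> I \<inter> ball t \<delta>1 \<Longrightarrow> dist s t < \<delta>2 \<Longrightarrow> dist ((snd c \<circ> \<gamma>) s) ((snd c \<circ> \<gamma>) t) < e"
    using tI e(1) unfolding continuous_on_iff by metis
  define \<delta> where "\<delta> = min \<delta>1 \<delta>2"
  have in_ball: "snd c (\<gamma> s) \<in> ball (snd c (\<gamma> t)) e" "\<gamma> s \<in> fst c" if "s \<in> I \<inter> ball t \<delta>" for s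
    using \<delta>2(2)[of s] that *(3) by (auto simp: \<delta>_def dist_commute)
  have in_d: "\<gamma> s \<in> fst d" if "s \<in> I \<inter> ball t \<delta>" for s
  proof -
    have "snd c (\<gamma> s) \<in> snd c ` (fst c \<inter> fst d)" using in_ball(1)[OF that] e(3) by blast
    then obtain x where "x \<in> fst c \<inter> fst d" "snd c (\<gamma> s) = snd c x" by blast
    then show ?thesis using in_ball(2)[OF that] *(1) chart_inv_chart by (metis IntD1 IntD2)
  qed
  have "(L2 * L1)-lipschitz_on (I \<inter> ball t \<delta>) (snd d \<circ> \<gamma>)"
  proof (rule lipschitz_onI)
    show "0 \<le> L2 * L1" using e(2) lipschitz_on_nonneg[OF *(4)] by simp
    fix s u assume su: "s \<in> I \<inter> ball t \<delta>" "u \<in> I \<inter> ball t \<delta>"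
    have "dist ((snd d \<circ> \<gamma>) s) ((snd d \<circ> \<gamma>) u) = norm (transition c d (snd c (\<gamma> s)) - transition c d (snd c (\<gamma> u)))"
      using su in_ball *(1) by (simp add: transition_chart dist_norm)
    also have "\<dots> \<le> L2 * norm (snd c (\<gamma> s) - snd c (\<gamma> u))" using su in_ball e(4) by blast
    also have "\<dots> \<le> L2 * (L1 * dist s u)"
      using lipschitz_onD[OF *(4), of s u] su e(2) by (intro mult_left_mono) (auto simp: \<delta>_def dist_norm)
    finally show "dist ((snd d \<circ> \<gamma>) s) ((snd d \<circ> \<gamma>) u) \<le> L2 * L1 * dist s u" by simp
  qed
  moreover have "\<delta> > 0" using \<delta>2 * by (simp add: \<delta>_def)
  ultimately show ?thesis using in_d by blast
qed

end

section \<open>Cone fields in charts\<close>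

locale cone_manifold = atlas_manifold A
  for A :: "('m::{t2_space, second_countable_topology}, 'e::{real_inner, heine_borel}) chart set" +
  fixes C :: "('m \<times> ('m, 'e) tangent_vector) set"
  assumes closed_cone: "closed_cone_field A C"
begin

definition fibre :: "('m, 'e) chart \<Rightarrow> 'm \<Rightarrow> 'e set" where
  "fibre c x = {v c |v. (x, v) \<in> C}"

definition local_cone :: "('m, 'e) chart \<Rightarrow> 'e \<Rightarrow> 'e set" where
  "local_cone c e = fibre c (chart_inv c e)"

lemma cone_tangent: "(x, v) \<in> C \<Longrightarrow> v \<in> tangent_space A x"
  using closed_cone unfolding closed_cone_field_def cone_field_def tangent_bundle_def by blast

lemma cone_strict: "strict_convex_cone (C `` {x})"
  using closed_cone unfolding closed_cone_field_def cone_field_def by blast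

lemma mem_fibre_iff:
  assumes "c \<in> A" "x \<in> fst c"
  shows "w \<in> fibre c x \<longleftrightarrow> (x, lift_vector c x w) \<in> C"
proof
  assume "w \<in> fibre c x"
  then obtain v where v: "(x, v) \<in> C" "w = v c" by (auto simp: fibre_def)
  have "lift_vector c x w = v"
    by (rule tangent_vector_eqI[OF assms]) (use assms v cone_tangent lift_vector_in_tangent_space in auto)
  then show "(x, lift_vector c x w) \<in> C" using v by simp
next
  assume "(x, lift_vector c x w) \<in> C"
  then show "w \<in> fibre c x" using assms unfolding fibre_def by (metis (mono_tags, lifting) lift_vector_chart mem_Collect_eq)
qed

lemma convex_fibre:
  assumes "c \<in> A" "x \<in> fst c" shows "convex (fibre c x)"
proof -
  have "fibre c x = lift_vector c x -` (C `` {x})" using mem_fibre_iff[OF assms] by auto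
  moreover have "convex (C `` {x})" using cone_strict unfolding strict_convex_cone_def by blast
  ultimately show ?thesis using convex_linear_vimage[OF linear_lift_vector[OF assms]] by simp
qed

lemma scale_fibre:
  assumes "c \<in> A" "x \<in> fst c" "w \<in> fibre c x" "0 < t" shows "t *\<^sub>R w \<in> fibre c x"
proof -
  have "t *\<^sub>R lift_vector c x w \<in> C `` {x}"
    using cone_strict[of x] assms mem_fibre_iff unfolding strict_convex_cone_def by blast
  then show ?thesis using assms mem_fibre_iff by (simp add: linear_scale[OF linear_lift_vector])
qed

lemma fibre_functional:
  assumes "c \<in> A" "x \<in> fst c"
  shows "\<exists>l. bounded_linear l \<and> (\<forall>w\<in>fibre c x. 0 < (l w :: real))"
proof -
  obtain l where l: "linear l" "C `` {x} \<subseteq> {v. (l v :: real) > 0}"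
    using cone_strict[of x] unfolding strict_convex_cone_def by blast
  have "linear (l \<circ> lift_vector c x)" using linear_compose[OF linear_lift_vector[OF assms] l(1)] .
  then have "bounded_linear (l \<circ> lift_vector c x)" by (rule linear_imp_bounded_linear_heine_borel)
  then show ?thesis using l(2) mem_fibre_iff[OF assms] by (intro exI[of _ "l \<circ> lift_vector c x"]) auto
qed

lemma zero_notin_fibre: "c \<in> A \<Longrightarrow> x \<in> fst c \<Longrightarrow> 0 \<notin> fibre c x"
  using fibre_functional linear_0 bounded_linear.linear by (metis less_irrefl)

lemma fibre_nonempty_iff: "c \<in> A \<Longrightarrow> x \<in> fst c \<Longrightarrow> fibre c x \<noteq> {} \<longleftrightarrow> x \<in> cone_domain C"
  unfolding fibre_def cone_domain_def by auto

lemma fibre_change: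
  assumes "c \<in> A" "d \<in> A" "x \<in> fst c" "x \<in> fst d" "w \<in> fibre c x"
  shows "change c d x w \<in> fibre d x"
proof -
  have "(x, lift_vector c x w) \<in> C" using mem_fibre_iff assms by blast
  moreover have "lift_vector c x w d = change c d x w" using assms by (simp add: lift_vector_def)
  ultimately show ?thesis unfolding fibre_def mem_Collect_eq by metis
qed

text \<open>
  If \<open>w\<close> were not a cone vector, its lift would lie in the complement of the cone
  field and the zero section, which is open in the tangent bundle; so the pairs \<open>(X n, W
  n)\<close> would eventually be coordinates of vectors outside the cone field.
\<close>
lemma local_cone_closed:
  assumes c: "c \<in> A" and e: "e \<in> snd c ` fst c" and X: "\<And>n. X n \<in> snd c ` fst c" "X \<longlonglongrightarrow> e"
    and W: "\<And>n. W n \<in> local_cone c (X n)" "W \<longlonglongrightarrow> w" and "w \<noteq> 0"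
  shows "w \<in> local_cone c e"
proof (rule ccontr)
  assume not: "w \<notin> local_cone c e"
  define T where "T = tangent_bundle A - (C \<union> zero_section)"
  have "openin (tangent_bundle_topology A) (topspace (tangent_bundle_topology A) - (C \<union> zero_section))"
    using closed_cone unfolding closed_cone_field_def closedin_def by blast
  moreover have "topspace (tangent_bundle_topology A) = tangent_bundle A"
    using openin_tangent_bundle openin_topspace[of "tangent_bundle_topology A"] openin_subset[of "tangent_bundle_topology A"]
    unfolding openin_tangent_bundle_topology[OF atlas] by (metis open_in_tangent_bundle_def subset_antisym)
  ultimately have "open_in_tangent_bundle A T" by (simp add: T_def openin_tangent_bundle_topology[OF atlas])
  then have op: "open ((\<lambda>(x, v). (snd c x, v c)) ` (T \<inter> (fst c \<times> UNIV)))" (is "open ?P")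
    using c unfolding open_in_tangent_bundle_def by blast
  define x where "x = chart_inv c e"
  have x: "x \<in> fst c" "snd c x = e" using e by (auto simp: x_def)
  have "(x, lift_vector c x w) \<in> T"
    using not lift_vector_in_tangent_space[OF c x(1), of w] mem_fibre_iff[OF c x(1), of w] lift_vector_chart[OF c x(1), of w] \<open>w \<noteq> 0\<close>
    by (auto simp: T_def tangent_bundle_def zero_section_def local_cone_def x_def[symmetric])
  then have "(e, w) \<in> ?P" using x c by (intro image_eqI[of _ _ "(x, lift_vector c x w)"]) auto
  moreover have "(\<lambda>n. (X n, W n)) \<longlonglongrightarrow> (e, w)" using X W by (intro tendsto_Pair)
  ultimately have "\<forall>\<^sub>F n in sequentially. (X n, W n) \<in> ?P" using op topological_tendstoD by blast
  then obtain n where "(X n, W n) \<in> ?P" using eventually_happens by force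
  then obtain y v where yv: "(y, v) \<in> T" "y \<in> fst c" "X n = snd c y" "W n = v c" by auto
  then have "chart_inv c (X n) = y" using c by simp
  then have "(y, lift_vector c y (W n)) \<in> C" using W(1)[of n] mem_fibre_iff[OF c yv(2)] by (simp add: local_cone_def)
  moreover have "lift_vector c y (W n) = v"
    by (rule tangent_vector_eqI[OF c yv(2)])
      (use yv c lift_vector_in_tangent_space in \<open>auto simp: T_def tangent_bundle_def\<close>)
  ultimately show False using yv(1) by (simp add: T_def)
qed

text \<open>
  Otherwise there are unit cone vectors at points tending to \<open>x\<close> on which
  \<open>l0\<close> is at most \<open>1 / n\<close>; their limit is a unit cone vector at
  \<open>x\<close> on which \<open>l0\<close> is not positive.
\<close>
lemma cone_box_exists:
  assumes c: "c \<in> A" and x: "x \<in> fst c" and l0: "bounded_linear l0" "\<And>w. w \<in> fibre c x \<Longrightarrow> 0 < (l0 w :: real)"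
    and V: "open V" "x \<in> V"
  shows "\<exists>r>0. \<exists>k. cball (snd c x) (2 * r) \<subseteq> snd c ` (fst c \<inter> V) \<and> 
    cone_box (local_cone c) (cball (snd c x) (2 * r)) (\<lambda>w. k * l0 w)"
proof -
  let ?p = "snd c x"
  have "snd c ` (fst c \<inter> V) = snd c ` fst c \<inter> chart_inv c -` V"
    using c by (auto simp: image_iff)
  then have "open (snd c ` (fst c \<inter> V))"
    using continuous_open_preimage[OF continuous_on_chart_inv open_chart(2) V(1)] c by metis
  then obtain r0 where r0: "r0 > 0" "cball ?p r0 \<subseteq> snd c ` (fst c \<inter> V)"
    using x V by (metis IntI imageI open_contains_cball)
  then have r0': "cball ?p r0 \<subseteq> snd c ` fst c" by blast
  have "\<exists>n::nat. \<forall>e\<in>cball ?p (r0 / Suc n). \<forall>w\<in>local_cone c e. norm w \<le> Suc n * l0 w"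
  proof (rule ccontr)
    assume "\<not> ?thesis"
    then have "\<exists>e\<in>cball ?p (r0 / Suc n). \<exists>w\<in>local_cone c e. Suc n * l0 w < norm w" for n
      by (meson not_less)
    then obtain X W0 where X: "\<And>n. X n \<in> cball ?p (r0 / Suc n)" and W0: "\<And>n. W0 n \<in> local_cone c (X n)"
      "\<And>n. Suc n * l0 (W0 n) < norm (W0 n)" by metis
    have Xr: "X n \<in> cball ?p r0" for n
    proof -
      have "r0 / Suc n \<le> r0" using r0 by (simp add: field_simps)
      then show ?thesis using X[of n] by auto
    qed
    have Xi: "X n \<in> snd c ` fst c" for n using Xr r0' by blast
    define W where "W n = (1 / norm (W0 n)) *\<^sub>R W0 n" for n
    have W0nz: "W0 n \<noteq> 0" for n
      using zero_notin_fibre[OF c chart_inv_in[OF Xi]] W0(1)[of n] unfolding local_cone_def by metis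
    have W: "W n \<in> local_cone c (X n)" for n
      using W0(1)[of n] W0nz unfolding W_def local_cone_def by (intro scale_fibre c chart_inv_in Xi) auto
    have nW: "norm (W n) = 1" for n using W0nz by (simp add: W_def)
    have lW: "l0 (W n) \<le> inverse (Suc n)" for n
    proof -
      have "l0 (W n) = l0 (W0 n) / norm (W0 n)"
        using linear_scale[OF bounded_linear.linear[OF l0(1)]] by (simp add: W_def)
      moreover have "l0 (W0 n) / norm (W0 n) \<le> inverse (Suc n)"
        using W0(2)[of n] W0nz[of n] by (simp add: field_simps)
      ultimately show ?thesis by simp
    qed
    have "bounded (range W)" unfolding bounded_iff using nW by (intro exI[of _ 1]) auto
    then obtain w s where ws: "strict_mono (s :: nat \<Rightarrow> nat)" "(W \<circ> s) \<longlonglongrightarrow> w"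
      using bounded_imp_convergent_subsequence by blast
    have "X \<longlonglongrightarrow> ?p"
    proof (rule metric_tendsto_imp_tendsto)
      show "(\<lambda>n. r0 * inverse (real (Suc n))) \<longlonglongrightarrow> 0" using tendsto_mult_right_zero[OF LIMSEQ_inverse_real_of_nat] by simp
      show "\<forall>\<^sub>F n in sequentially. dist (X n) ?p \<le> dist (r0 * inverse (real (Suc n))) 0"
        using X r0(1) by (intro always_eventually allI) (auto simp: dist_commute divide_inverse abs_mult)
    qed
    have "(\<lambda>n. norm ((W \<circ> s) n)) \<longlonglongrightarrow> norm w" by (intro tendsto_norm ws)
    then have "norm w = 1" using nW by (simp add: LIMSEQ_const_iff o_def)
    then have "w \<in> local_cone c ?p"
      using local_cone_closed[OF c _ _ LIMSEQ_subseq_LIMSEQ[OF \<open>X \<longlonglongrightarrow> ?p\<close> ws(1)] _ ws(2)] x Xi W by force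
    then have "0 < l0 w" using l0(2) c x by (simp add: local_cone_def)
    moreover have "l0 w \<le> 0"
    proof (rule LIMSEQ_le)
      show "(\<lambda>n. l0 ((W \<circ> s) n)) \<longlonglongrightarrow> l0 w" by (rule bounded_linear.tendsto[OF l0(1) ws(2)])
      show "(\<lambda>n. inverse (real (Suc (s n)))) \<longlonglongrightarrow> 0"
        using LIMSEQ_subseq_LIMSEQ[OF LIMSEQ_inverse_real_of_nat ws(1)] by (simp add: o_def)
      show "\<exists>N. \<forall>n\<ge>N. l0 ((W \<circ> s) n) \<le> inverse (real (Suc (s n)))" using lW by auto
    qed
    ultimately show False by simp
  qed
  then obtain n :: nat where n: "\<And>e w. e \<in> cball ?p (r0 / Suc n) \<Longrightarrow> w \<in> local_cone c e \<Longrightarrow> norm w \<le> Suc n * l0 w"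
    by blast
  define r where "r = r0 / Suc n / 2"
  have r: "r > 0" "2 * r = r0 / Suc n" "2 * r \<le> r0" using r0 by (auto simp: r_def field_simps)
  have sub: "cball ?p (2 * r) \<subseteq> snd c ` (fst c \<inter> V)" using r(3) r0(2) by (meson subset_cball subset_trans)
  then have sub': "\<And>e. e \<in> cball ?p (2 * r) \<Longrightarrow> e \<in> snd c ` fst c" by blast
  have "cone_box (local_cone c) (cball ?p (2 * r)) (\<lambda>w. Suc n * l0 w)"
  proof (rule cone_box.intro)
    show "compact (cball ?p (2 * r))" by (simp add: compact_eq_bounded_closed)
    show "bounded_linear (\<lambda>w. Suc n * l0 w)" by (rule bounded_linear_const_mult[OF l0(1)])
    fix e assume e: "e \<in> cball ?p (2 * r)"
    note ci = chart_inv_in[OF sub'[OF e]]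
    show "norm w \<le> Suc n * l0 w" if "w \<in> local_cone c e" for w using n e that r(2) by metis
    show "0 \<notin> local_cone c e" unfolding local_cone_def by (rule zero_notin_fibre[OF c ci])
    show "t *\<^sub>R w \<in> local_cone c e" if "w \<in> local_cone c e" "0 < t" for w t
      using scale_fibre[OF c ci] that unfolding local_cone_def by blast
    show "convex (local_cone c e)" unfolding local_cone_def by (rule convex_fibre[OF c ci])
  next
    fix X W e w
    assume X: "\<And>n. X n \<in> cball ?p (2 * r)" "X \<longlonglongrightarrow> e" and W: "\<And>n. W n \<in> local_cone c (X n)" "W \<longlonglongrightarrow> w" "w \<noteq> 0"
    have "e \<in> cball ?p (2 * r)" using closed_sequentially[OF closed_cball _ X(2)] X(1) by blast
    then show "w \<in> local_cone c e" using local_cone_closed[OF c _ _ X(2) W] X(1) sub' by blast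
  qed
  then show ?thesis using r(1) sub by blast
qed

text \<open>
  Where the fibre is empty, even the functional 0 is (vacuously) positive on it; so on a whole
  neighbourhood 0 dominates the norm of cone vectors, and there are none.
\<close>
lemma closed_cone_domain: "closed (cone_domain C)"
proof -
  have "\<exists>U. open U \<and> x \<in> U \<and> U \<subseteq> - cone_domain C" if "x \<in> - cone_domain C" for x
  proof -
    obtain c where c: "c \<in> A" "x \<in> fst c" using chart_at by blast
    have "fibre c x = {}" using fibre_nonempty_iff[OF c] that by blast
    then obtain r k where r: "r > 0" "cball (snd c x) (2 * r) \<subseteq> snd c ` (fst c \<inter> UNIV)"
      "cone_box (local_cone c) (cball (snd c x) (2 * r)) (\<lambda>w. k * 0)"
      using cone_box_exists[OF c bounded_linear_zero, of UNIV] by auto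
    have "y \<in> - cone_domain C" if "y \<in> region c (ball (snd c x) (2 * r))" for y
    proof -
      have y: "y \<in> fst c" "snd c y \<in> cball (snd c x) (2 * r)" using that by (auto simp: region_def)
      have "w \<notin> fibre c y" for w
        using cone_box.norm_le_l[OF r(3) y(2), of w] cone_box.zero_notin[OF r(3) y(2)] y c by (auto simp: local_cone_def)
      then show ?thesis using fibre_nonempty_iff[OF c(1) y(1)] by blast
    qed
    moreover have "x \<in> region c (ball (snd c x) (2 * r))" using c r by (simp add: region_def)
    ultimately show ?thesis using open_region[OF c(1), of "ball (snd c x) (2 * r)"] by blast
  qed
  then show ?thesis unfolding closed_def by (subst open_subopen) blast
qed

end

section \<open>Causal arcs\<close>

context cone_manifold
begin

text \<open>
  The derivative is two-sided and read in a single chart, which makes the notion local in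
  \<open>t\<close> and independent of the interval of definition. For a continuous curve the
  velocities in the other charts follow by the chain rule.
\<close>
definition has_cone_velocity :: "(real \<Rightarrow> 'm) \<Rightarrow> real \<Rightarrow> bool" where
  "has_cone_velocity \<gamma> t \<longleftrightarrow>
     (\<exists>c\<in>A. \<gamma> t \<in> fst c \<and> (\<exists>w\<in>fibre c (\<gamma> t). ((snd c \<circ> \<gamma>) has_vector_derivative w) (at t)))"

lemma derivative_change_chart:
  assumes "c \<in> A" "d \<in> A" "\<gamma> t \<in> fst c" "\<gamma> t \<in> fst d" and cont: "isCont \<gamma> t"
    and der: "((snd c \<circ> \<gamma>) has_vector_derivative w) (at t)"
  shows "((snd d \<circ> \<gamma>) has_vector_derivative change c d (\<gamma> t) w) (at t)"
proof -
  let ?D = "change c d (\<gamma> t)"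
  have D: "(transition c d has_derivative ?D) (at ((snd c \<circ> \<gamma>) t))"
    using transition_has_derivative[of c d "\<gamma> t"] assms by simp
  have "((\<lambda>s. transition c d ((snd c \<circ> \<gamma>) s)) has_derivative (\<lambda>s. ?D (s *\<^sub>R w))) (at t)"
    using has_derivative_compose[OF der[unfolded has_vector_derivative_def] D] .
  moreover have "(\<lambda>s. ?D (s *\<^sub>R w)) = (\<lambda>s. s *\<^sub>R ?D w)"
    using linear_scale[OF has_derivative_linear[OF D]] by auto
  ultimately have 1: "((\<lambda>s. transition c d ((snd c \<circ> \<gamma>) s)) has_derivative (\<lambda>s. s *\<^sub>R ?D w)) (at t)" by simp
  have "\<forall>\<^sub>F s in at t. \<gamma> s \<in> fst c"
    using cont open_chart(1)[OF \<open>c \<in> A\<close>] \<open>\<gamma> t \<in> fst c\<close> unfolding isCont_def by (rule topological_tendstoD)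
  then have "\<forall>\<^sub>F s in at t. transition c d ((snd c \<circ> \<gamma>) s) = (snd d \<circ> \<gamma>) s"
    by eventually_elim (use assms(1) in \<open>simp add: transition_chart\<close>)
  then have "((snd d \<circ> \<gamma>) has_derivative (\<lambda>s. s *\<^sub>R ?D w)) (at t)"
    by (rule has_derivative_transform_eventually[OF 1]) (use assms in \<open>simp_all add: transition_chart\<close>)
  then show ?thesis unfolding has_vector_derivative_def .
qed

lemma has_cone_velocity_in_chart:
  assumes "has_cone_velocity \<gamma> t" "isCont \<gamma> t" "d \<in> A" "\<gamma> t \<in> fst d"
  shows "\<exists>w\<in>fibre d (\<gamma> t). ((snd d \<circ> \<gamma>) has_vector_derivative w) (at t)"
  using assms derivative_change_chart fibre_change unfolding has_cone_velocity_def by meson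

lemma has_cone_velocity_imp_has_velocity:
  assumes "has_cone_velocity \<gamma> t" "isCont \<gamma> t"
  shows "\<exists>v. has_velocity A I \<gamma> t v \<and> (\<gamma> t, v) \<in> C"
proof -
  obtain c w where c: "c \<in> A" "\<gamma> t \<in> fst c" and w: "w \<in> fibre c (\<gamma> t)" "((snd c \<circ> \<gamma>) has_vector_derivative w) (at t)"
    using assms(1) unfolding has_cone_velocity_def by blast
  have "has_velocity A I \<gamma> t (lift_vector c (\<gamma> t) w)"
    unfolding has_velocity_def
  proof (intro conjI ballI impI)
    fix d assume d: "d \<in> A" "\<gamma> t \<in> fst d"
    have "((snd d \<circ> \<gamma>) has_vector_derivative change c d (\<gamma> t) w) (at t)"
      using derivative_change_chart[of c d \<gamma> t w] c d w(2) assms(2) by blast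
    then show "((snd d \<circ> \<gamma>) has_vector_derivative lift_vector c (\<gamma> t) w d) (at t within I)"
      using d by (simp add: lift_vector_def has_vector_derivative_at_within)
  qed (rule lift_vector_in_tangent_space[OF c])
  then show ?thesis using w(1) mem_fibre_iff[OF c] by blast
qed

lemma has_velocity_imp_has_cone_velocity:
  assumes "has_velocity A I \<gamma> t v" "(\<gamma> t, v) \<in> C" "t \<in> interior I"
  shows "has_cone_velocity \<gamma> t"
proof -
  obtain c where c: "c \<in> A" "\<gamma> t \<in> fst c" using chart_at by blast
  have "((snd c \<circ> \<gamma>) has_vector_derivative v c) (at t within I)" using assms(1) c unfolding has_velocity_def by blast
  then have "((snd c \<circ> \<gamma>) has_vector_derivative v c) (at t)" using at_within_interior[OF assms(3)] by metis
  moreover have "v c \<in> fibre c (\<gamma> t)" using assms(2) unfolding fibre_def by blast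
  ultimately show ?thesis using c unfolding has_cone_velocity_def by blast
qed

lemma has_cone_velocity_cong:
  assumes "has_cone_velocity \<gamma> t" "open S" "t \<in> S" "\<And>s. s \<in> S \<Longrightarrow> \<gamma> s = \<gamma>' s"
  shows "has_cone_velocity \<gamma>' t"
proof -
  obtain c w where c: "c \<in> A" "\<gamma> t \<in> fst c" and w: "w \<in> fibre c (\<gamma> t)" "((snd c \<circ> \<gamma>) has_vector_derivative w) (at t)"
    using assms(1) unfolding has_cone_velocity_def by blast
  have "((snd c \<circ> \<gamma>') has_vector_derivative w) (at t)"
    by (rule has_vector_derivative_transform_within_open[OF w(2) assms(2,3)]) (use assms(4) in simp)
  then show ?thesis using c w(1) assms(4)[OF assms(3)] unfolding has_cone_velocity_def by metis
qed

text \<open>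
  Causal curves on a nondegenerate compact interval. The end points carry no velocity condition, so
  that restricting and joining arcs only affects null sets.
\<close>
definition causal_arc :: "real \<Rightarrow> real \<Rightarrow> (real \<Rightarrow> 'm) \<Rightarrow> bool" where
  "causal_arc a b \<gamma> \<longleftrightarrow> a < b \<and> locally_lipschitz_curve A {a..b} \<gamma> \<and>
     (\<exists>N. negligible N \<and> (\<forall>t\<in>{a<..<b} - N. has_cone_velocity \<gamma> t))"

lemma causal_arc_less: "causal_arc a b \<gamma> \<Longrightarrow> a < b"
  by (simp add: causal_arc_def)

lemma causal_arc_continuous: "causal_arc a b \<gamma> \<Longrightarrow> continuous_on {a..b} \<gamma>"
  using locally_lipschitz_curve_continuous unfolding causal_arc_def by blast

lemma causal_arc_isCont: "causal_arc a b \<gamma> \<Longrightarrow> t \<in> {a<..<b} \<Longrightarrow> isCont \<gamma> t"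
  using causal_arc_continuous continuous_on_interior by (metis interior_atLeastAtMost_real)

lemma causal_curve_imp_causal_arc:
  assumes \<gamma>: "causal_curve A C I \<gamma>" and ab: "{a..b} \<subseteq> I" "a < b"
  shows "causal_arc a b \<gamma>"
proof -
  have "\<not> (\<exists>t. I = {t})"
  proof
    assume "\<exists>t. I = {t}"
    then have "a \<in> I \<longrightarrow> b \<in> I \<longrightarrow> a = b" by auto
    moreover have "a \<in> I" "b \<in> I" using ab by auto
    ultimately show False using ab by simp
  qed
  then have ae: "AE t in lebesgue. t \<in> I \<longrightarrow> (\<exists>v. has_velocity A I \<gamma> t v \<and> (\<gamma> t, v) \<in> C)"
    and ll: "locally_lipschitz_curve A I \<gamma>"
    using \<gamma> unfolding causal_curve_def by (auto split: if_splits)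
  obtain N where N: "{t \<in> space lebesgue. \<not> (t \<in> I \<longrightarrow> (\<exists>v. has_velocity A I \<gamma> t v \<and> (\<gamma> t, v) \<in> C))} \<subseteq> N"
    "N \<in> null_sets lebesgue"
    using ae unfolding eventually_ae_filter by blast
  have "has_cone_velocity \<gamma> t" if t: "t \<in> {a<..<b} - N" for t
  proof -
    have "t \<in> interior I" using t interior_mono[OF ab(1)] by auto
    moreover have "t \<in> I" "t \<notin> N" using t ab(1) by auto
    then have "\<exists>v. has_velocity A I \<gamma> t v \<and> (\<gamma> t, v) \<in> C" using N(1) by auto
    then obtain v where "has_velocity A I \<gamma> t v" "(\<gamma> t, v) \<in> C" by blast
    ultimately show ?thesis using has_velocity_imp_has_cone_velocity by blast
  qed
  moreover have "negligible N" using N(2) negligible_iff_null_sets by blast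
  moreover have "locally_lipschitz_curve A {a..b} \<gamma>" using locally_lipschitz_curve_subset[OF ll ab(1)] .
  ultimately show ?thesis using ab(2) unfolding causal_arc_def by blast
qed

lemma causal_curveI:
  assumes I: "is_interval I" "interior I \<noteq> {}" and ll: "locally_lipschitz_curve A I \<gamma>"
    and N: "negligible N" and vel: "\<And>t. t \<in> interior I - N \<Longrightarrow> has_cone_velocity \<gamma> t"
  shows "causal_curve A C I \<gamma>"
proof -
  have "\<not> (\<exists>t. I = {t})" using I(2) by auto
  moreover have "AE t in lebesgue. t \<in> I \<longrightarrow> (\<exists>v. has_velocity A I \<gamma> t v \<and> (\<gamma> t, v) \<in> C)"
    unfolding eventually_ae_filter
  proof (intro bexI[of _ "N \<union> frontier I"])
    have "negligible (frontier I)" using I(1) is_interval_convex negligible_convex_frontier by blast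
    then show "N \<union> frontier I \<in> null_sets lebesgue" using N negligible_iff_null_sets by blast
    have "\<exists>v. has_velocity A I \<gamma> t v \<and> (\<gamma> t, v) \<in> C" if t: "t \<in> I" "t \<notin> N \<union> frontier I" for t
    proof -
      have "t \<in> interior I" using t closure_subset unfolding frontier_def by blast
      moreover have "continuous_on I \<gamma>" using ll by (rule locally_lipschitz_curve_continuous)
      ultimately have "isCont \<gamma> t" by (simp add: continuous_on_interior)
      then show ?thesis using has_cone_velocity_imp_has_velocity vel[of t] \<open>t \<in> interior I\<close> t by blast
    qed
    then show "{t \<in> space lebesgue. \<not> (t \<in> I \<longrightarrow> (\<exists>v. has_velocity A I \<gamma> t v \<and> (\<gamma> t, v) \<in> C))} \<subseteq> N \<union> frontier I"
      by blast
  qed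
  ultimately show ?thesis using I ll unfolding causal_curve_def by auto
qed

lemma causal_arc_imp_causal_curve:
  assumes "causal_arc a b \<gamma>" shows "causal_curve A C {a..b} \<gamma>"
proof -
  obtain N where N: "negligible N" "\<And>t. t \<in> {a<..<b} - N \<Longrightarrow> has_cone_velocity \<gamma> t"
    using assms unfolding causal_arc_def by blast
  show ?thesis
    by (rule causal_curveI[OF _ _ _ N(1)]) (use assms N(2) in \<open>auto simp: causal_arc_def is_interval_cc\<close>)
qed

lemma causal_arc_subinterval:
  assumes "causal_arc a b \<gamma>" "a \<le> c" "c < d" "d \<le> b"
  shows "causal_arc c d \<gamma>"
proof -
  have sub: "{c..d} \<subseteq> {a..b}" "{c<..<d} \<subseteq> {a<..<b}" using assms by auto
  then show ?thesis
    using assms locally_lipschitz_curve_subset[OF _ sub(1)] unfolding causal_arc_def by blast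
qed

lemma causal_arc_cong:
  assumes "causal_arc a b \<gamma>" "\<And>t. t \<in> {a..b} \<Longrightarrow> \<gamma> t = \<gamma>' t"
  shows "causal_arc a b \<gamma>'"
proof -
  have ll: "locally_lipschitz_curve A {a..b} \<gamma>" using assms(1) by (simp add: causal_arc_def)
  have "locally_lipschitz_curve A {a..b} \<gamma>'"
    unfolding locally_lipschitz_curve_def
  proof
    fix t assume "t \<in> {a..b}"
    then obtain c \<delta> L where *: "c \<in> A" "\<delta> > 0" "\<gamma> ` ({a..b} \<inter> ball t \<delta>) \<subseteq> fst c"
      "L-lipschitz_on ({a..b} \<inter> ball t \<delta>) (snd c \<circ> \<gamma>)"
      using ll unfolding locally_lipschitz_curve_def by meson
    have "\<gamma>' ` ({a..b} \<inter> ball t \<delta>) \<subseteq> fst c" using *(3) assms(2) by (auto simp: image_subset_iff)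
    moreover have "L-lipschitz_on ({a..b} \<inter> ball t \<delta>) (snd c \<circ> \<gamma>')"
      by (rule lipschitz_on_transform[OF *(4)]) (use assms(2) in auto)
    ultimately show "\<exists>c\<in>A. \<exists>\<delta>>0. \<exists>L. \<gamma>' ` ({a..b} \<inter> ball t \<delta>) \<subseteq> fst c \<and> L-lipschitz_on ({a..b} \<inter> ball t \<delta>) (snd c \<circ> \<gamma>')"
      using * by blast
  qed
  moreover have "has_cone_velocity \<gamma>' t" if "has_cone_velocity \<gamma> t" "t \<in> {a<..<b}" for t
    by (rule has_cone_velocity_cong[OF that(1), of "{a<..<b}"]) (use that assms(2) in auto)
  ultimately show ?thesis using assms(1) unfolding causal_arc_def by (metis DiffD1)
qed

lemma causal_arc_affine:
  assumes \<gamma>: "causal_arc a b \<gamma>" and q: "0 < q" and c: "p + q * c = a" and d: "p + q * d = b"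
  shows "causal_arc c d (\<lambda>s. \<gamma> (p + q * s))"
proof -
  have ll: "locally_lipschitz_curve A {a..b} \<gamma>" and "a < b" using \<gamma> by (simp_all add: causal_arc_def)
  obtain N where N: "negligible N" "\<And>t. t \<in> {a<..<b} - N \<Longrightarrow> has_cone_velocity \<gamma> t"
    using \<gamma> unfolding causal_arc_def by blast
  have cd: "c < d" using \<open>a < b\<close> c d q by (smt (verit) mult_left_mono)
  have in_ab: "p + q * s \<in> {a..b} \<longleftrightarrow> s \<in> {c..d}" "p + q * s \<in> {a<..<b} \<longleftrightarrow> s \<in> {c<..<d}" for s
    using q unfolding c[symmetric] d[symmetric] by auto
  have "locally_lipschitz_curve A {c..d} (\<lambda>s. \<gamma> (p + q * s))"
    unfolding locally_lipschitz_curve_def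
  proof
    fix s assume "s \<in> {c..d}"
    then have "p + q * s \<in> {a..b}" using in_ab by blast
    then obtain k \<delta> L where *: "k \<in> A" "\<delta> > 0" "\<gamma> ` ({a..b} \<inter> ball (p + q * s) \<delta>) \<subseteq> fst k"
      "L-lipschitz_on ({a..b} \<inter> ball (p + q * s) \<delta>) (snd k \<circ> \<gamma>)"
      using ll unfolding locally_lipschitz_curve_def by meson
    have dq: "dist (p + q * u) (p + q * v) = q * dist u v" for u v
      using q by (simp add: dist_real_def abs_mult[symmetric] right_diff_distrib) (simp add: abs_mult flip: right_diff_distrib)
    have into: "p + q * u \<in> {a..b} \<inter> ball (p + q * s) \<delta>" if "u \<in> {c..d} \<inter> ball s (\<delta> / q)" for u
      using that in_ab(1)[of u] q dq[of s u] by (auto simp: field_simps)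
    have "(L * q)-lipschitz_on ({c..d} \<inter> ball s (\<delta> / q)) (snd k \<circ> (\<lambda>s. \<gamma> (p + q * s)))"
    proof (rule lipschitz_onI)
      show "0 \<le> L * q" using lipschitz_on_nonneg[OF *(4)] q by simp
      fix u v assume "u \<in> {c..d} \<inter> ball s (\<delta> / q)" "v \<in> {c..d} \<inter> ball s (\<delta> / q)"
      from lipschitz_onD[OF *(4) into[OF this(1)] into[OF this(2)]]
      show "dist ((snd k \<circ> (\<lambda>s. \<gamma> (p + q * s))) u) ((snd k \<circ> (\<lambda>s. \<gamma> (p + q * s))) v) \<le> L * q * dist u v"
        by (simp only: o_def dq mult.assoc)
    qed
    moreover have "(\<lambda>s. \<gamma> (p + q * s)) ` ({c..d} \<inter> ball s (\<delta> / q)) \<subseteq> fst k" using into *(3) by blast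
    moreover have "\<delta> / q > 0" using * q by simp
    ultimately show "\<exists>k\<in>A. \<exists>\<delta>>0. \<exists>L. (\<lambda>s. \<gamma> (p + q * s)) ` ({c..d} \<inter> ball s \<delta>) \<subseteq> fst k \<and>
        L-lipschitz_on ({c..d} \<inter> ball s \<delta>) (snd k \<circ> (\<lambda>s. \<gamma> (p + q * s)))"
      using *(1) by blast
  qed
  moreover have "negligible ((\<lambda>t. (t - p) / q) ` N)"
  proof (rule negligible_locally_Lipschitz_image[OF _ N(1)])
    fix x assume "x \<in> N"
    have "norm ((y - p) / q - (x - p) / q) \<le> (1 / q) * norm (y - x)" for y
      using q by (simp add: diff_divide_distrib[symmetric])
    then show "\<exists>T B. open T \<and> x \<in> T \<and> (\<forall>y\<in>N \<inter> T. norm ((y - p) / q - (x - p) / q) \<le> B * norm (y - x))"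
      by (intro exI[of _ UNIV] exI[of _ "1 / q"]) auto
  qed simp
  moreover have "has_cone_velocity (\<lambda>s. \<gamma> (p + q * s)) s" if s: "s \<in> {c<..<d} - (\<lambda>t. (t - p) / q) ` N" for s
  proof -
    have "p + q * s \<in> {a<..<b} - N" using s in_ab(2)[of s] q by (force simp: image_iff)
    from N(2)[OF this] obtain k w where k: "k \<in> A" "\<gamma> (p + q * s) \<in> fst k" and w: "w \<in> fibre k (\<gamma> (p + q * s))"
      "((snd k \<circ> \<gamma>) has_vector_derivative w) (at (p + q * s))"
      unfolding has_cone_velocity_def by blast
    have "((\<lambda>s. p + q * s) has_vector_derivative q) (at s)" by (auto intro!: derivative_eq_intros)
    then have "((snd k \<circ> \<gamma> \<circ> (\<lambda>s. p + q * s)) has_vector_derivative q *\<^sub>R w) (at s)"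
      using w(2) by (rule vector_diff_chain_at)
    moreover have "q *\<^sub>R w \<in> fibre k (\<gamma> (p + q * s))" using scale_fibre[OF k w(1) q] .
    ultimately show ?thesis using k unfolding has_cone_velocity_def by (auto simp: o_def)
  qed
  ultimately show ?thesis using cd unfolding causal_arc_def by blast
qed

text \<open>
  The exceptional set absorbs the joint \<open>b\<close>. The Lipschitz condition at
  \<open>b\<close> is obtained by reading both arcs in the same chart and inserting the value at
  \<open>b\<close>.
\<close>
lemma causal_arc_join:
  assumes \<gamma>1: "causal_arc a b \<gamma>1" and \<gamma>2: "causal_arc b c \<gamma>2" and eq: "\<gamma>1 b = \<gamma>2 b"
  shows "causal_arc a c (\<lambda>t. if t \<le> b then \<gamma>1 t else \<gamma>2 t)" (is "causal_arc a c ?\<gamma>")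
proof -
  have ll1: "locally_lipschitz_curve A {a..b} \<gamma>1" and "a < b" using \<gamma>1 by (simp_all add: causal_arc_def)
  have ll2: "locally_lipschitz_curve A {b..c} \<gamma>2" and "b < c" using \<gamma>2 by (simp_all add: causal_arc_def)
  obtain N1 where N1: "negligible N1" "\<And>t. t \<in> {a<..<b} - N1 \<Longrightarrow> has_cone_velocity \<gamma>1 t"
    using \<gamma>1 unfolding causal_arc_def by blast
  obtain N2 where N2: "negligible N2" "\<And>t. t \<in> {b<..<c} - N2 \<Longrightarrow> has_cone_velocity \<gamma>2 t"
    using \<gamma>2 unfolding causal_arc_def by blast
  have "locally_lipschitz_curve A {a..c} ?\<gamma>"
    unfolding locally_lipschitz_curve_def
  proof
    fix t assume t: "t \<in> {a..c}"
    consider "t < b" | "t > b" | "t = b" by linarith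
    then show "\<exists>k\<in>A. \<exists>\<delta>>0. \<exists>L. ?\<gamma> ` ({a..c} \<inter> ball t \<delta>) \<subseteq> fst k \<and> L-lipschitz_on ({a..c} \<inter> ball t \<delta>) (snd k \<circ> ?\<gamma>)"
    proof cases
      case 1
      then obtain k \<delta> L where *: "k \<in> A" "\<delta> > 0" "\<gamma>1 ` ({a..b} \<inter> ball t \<delta>) \<subseteq> fst k"
        "L-lipschitz_on ({a..b} \<inter> ball t \<delta>) (snd k \<circ> \<gamma>1)"
        using ll1 t unfolding locally_lipschitz_curve_def by (meson atLeastAtMost_iff less_imp_le)
      define \<delta>' where "\<delta>' = min \<delta> (b - t)"
      have sub: "{a..c} \<inter> ball t \<delta>' \<subseteq> {a..b} \<inter> ball t \<delta>" by (auto simp: \<delta>'_def dist_real_def)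
      have "L-lipschitz_on ({a..c} \<inter> ball t \<delta>') (snd k \<circ> ?\<gamma>)"
        by (rule lipschitz_on_transform[OF lipschitz_on_subset[OF *(4) sub]]) (use sub in auto)
      moreover have "?\<gamma> ` ({a..c} \<inter> ball t \<delta>') \<subseteq> fst k" using sub *(3) by (auto simp: image_subset_iff)
      moreover have "\<delta>' > 0" using * 1 by (simp add: \<delta>'_def)
      ultimately show ?thesis using *(1) by blast
    next
      case 2
      then obtain k \<delta> L where *: "k \<in> A" "\<delta> > 0" "\<gamma>2 ` ({b..c} \<inter> ball t \<delta>) \<subseteq> fst k"
        "L-lipschitz_on ({b..c} \<inter> ball t \<delta>) (snd k \<circ> \<gamma>2)"
        using ll2 t unfolding locally_lipschitz_curve_def by (meson atLeastAtMost_iff less_imp_le)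
      define \<delta>' where "\<delta>' = min \<delta> (t - b)"
      have sub: "{a..c} \<inter> ball t \<delta>' \<subseteq> {b<..c} \<inter> ball t \<delta>" by (auto simp: \<delta>'_def dist_real_def)
      then have sub': "{a..c} \<inter> ball t \<delta>' \<subseteq> {b..c} \<inter> ball t \<delta>" by auto
      have "L-lipschitz_on ({a..c} \<inter> ball t \<delta>') (snd k \<circ> ?\<gamma>)"
        by (rule lipschitz_on_transform[OF lipschitz_on_subset[OF *(4) sub']]) (use sub in auto)
      moreover have "?\<gamma> ` ({a..c} \<inter> ball t \<delta>') \<subseteq> fst k" using sub sub' *(3) by (auto simp: image_subset_iff)
      moreover have "\<delta>' > 0" using * 2 by (simp add: \<delta>'_def)
      ultimately show ?thesis using *(1) by blast
    next
      case 3
      obtain k \<delta>1 L1 where k: "k \<in> A" and 1: "\<delta>1 > 0" "\<gamma>1 ` ({a..b} \<inter> ball b \<delta>1) \<subseteq> fst k"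
        "L1-lipschitz_on ({a..b} \<inter> ball b \<delta>1) (snd k \<circ> \<gamma>1)"
        using ll1 \<open>a < b\<close> unfolding locally_lipschitz_curve_def by (meson atLeastAtMost_iff less_imp_le order_refl)
      have "b \<in> {a..b} \<inter> ball b \<delta>1" using 1(1) \<open>a < b\<close> by simp
      then have "\<gamma>2 b \<in> fst k" using 1(2) eq by (metis image_subset_iff)
      then obtain \<delta>2 L2 where 2: "\<delta>2 > 0" "\<gamma>2 ` ({b..c} \<inter> ball b \<delta>2) \<subseteq> fst k"
        "L2-lipschitz_on ({b..c} \<inter> ball b \<delta>2) (snd k \<circ> \<gamma>2)"
        using locally_lipschitz_curve_in_chart[OF ll2 _ k, of b] \<open>b < c\<close> by auto
      define \<delta> where "\<delta> = min \<delta>1 \<delta>2"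
      define L where "L = max L1 L2"
      have L: "L1 \<le> L" "L2 \<le> L" "0 \<le> L" using lipschitz_on_nonneg[OF 1(3)] by (auto simp: L_def)
      let ?S = "{a..c} \<inter> ball b \<delta>" and ?f = "snd k \<circ> ?\<gamma>"
      have d1: "dist (?f u) (?f v) \<le> L * dist u v" if "u \<in> ?S" "v \<in> ?S" "u \<le> b" "v \<le> b" for u v
      proof -
        have "dist (?f u) (?f v) \<le> L1 * dist u v"
          using lipschitz_onD[OF 1(3), of u v] that by (auto simp: \<delta>_def)
        also have "\<dots> \<le> L * dist u v" using L by (intro mult_right_mono) auto
        finally show ?thesis .
      qed
      have d2: "dist (?f u) (?f v) \<le> L * dist u v" if "u \<in> ?S" "v \<in> ?S" "b \<le> u" "b \<le> v" for u v
      proof -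
        have "?\<gamma> u = \<gamma>2 u" "?\<gamma> v = \<gamma>2 v" using that eq by auto
        then have "dist (?f u) (?f v) \<le> L2 * dist u v"
          using lipschitz_onD[OF 2(3), of u v] that by (auto simp: \<delta>_def)
        also have "\<dots> \<le> L * dist u v" using L by (intro mult_right_mono) auto
        finally show ?thesis .
      qed
      have bS: "b \<in> ?S" using 1(1) 2(1) \<open>a < b\<close> \<open>b < c\<close> by (auto simp: \<delta>_def)
      have d3: "dist (?f u) (?f v) \<le> L * dist u v" if "u \<in> ?S" "v \<in> ?S" "u \<le> b" "b \<le> v" for u v
      proof -
        have "dist (?f u) (?f v) \<le> dist (?f u) (?f b) + dist (?f b) (?f v)" by (rule dist_triangle)
        also have "\<dots> \<le> L * dist u b + L * dist b v"
          using d1[OF that(1) bS that(3) order_refl] d2[OF bS that(2) order_refl that(4)] by (rule add_mono)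
        also have "\<dots> = L * dist u v" using that by (simp add: dist_real_def algebra_simps)
        finally show ?thesis .
      qed
      have "L-lipschitz_on ?S ?f"
      proof (rule lipschitz_onI[OF _ L(3)])
        fix u v assume "u \<in> ?S" "v \<in> ?S"
        then show "dist (?f u) (?f v) \<le> L * dist u v"
          using d1[of u v] d2[of u v] d3[of u v] d3[of v u]
          by (cases "u \<le> b"; cases "v \<le> b") (auto simp only: dist_commute not_le dest: less_imp_le)
      qed
      moreover have "?\<gamma> ` ?S \<subseteq> fst k" using 1(2) 2(2) by (auto simp: image_subset_iff \<delta>_def)
      moreover have "\<delta> > 0" using 1 2 by (simp add: \<delta>_def)
      ultimately show ?thesis using k 3 by blast
    qed
  qed
  moreover have "negligible (insert b (N1 \<union> N2))" using N1 N2 by simp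
  moreover have "has_cone_velocity ?\<gamma> t" if t: "t \<in> {a<..<c} - insert b (N1 \<union> N2)" for t
  proof (cases "t < b")
    case True
    then have "has_cone_velocity \<gamma>1 t" using t N1 by auto
    then show ?thesis by (rule has_cone_velocity_cong[of _ _ "{..<b}"]) (use True in auto)
  next
    case False
    then have "t > b" using t by auto
    then have "has_cone_velocity \<gamma>2 t" using t N2 by auto
    then show ?thesis by (rule has_cone_velocity_cong[of _ _ "{b<..}"]) (use \<open>t > b\<close> in auto)
  qed
  ultimately show ?thesis using \<open>a < b\<close> \<open>b < c\<close> unfolding causal_arc_def by (meson less_trans)
qed

definition arc_in :: "'m set \<Rightarrow> 'm \<Rightarrow> 'm \<Rightarrow> bool" where
  "arc_in Q x y \<longleftrightarrow> (\<exists>\<gamma>. causal_arc 0 1 \<gamma> \<and> \<gamma> 0 = x \<and> \<gamma> 1 = y \<and> \<gamma> ` {0..1} \<subseteq> Q)"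

lemma arc_in_mono: "arc_in Q x y \<Longrightarrow> Q \<subseteq> R \<Longrightarrow> arc_in R x y"
  unfolding arc_in_def by blast

lemma arc_in_endpoints: "arc_in Q x y \<Longrightarrow> x \<in> Q \<and> y \<in> Q"
  unfolding arc_in_def by force

lemma causal_arc_imp_arc_in:
  assumes "causal_arc a b \<gamma>" "\<gamma> ` {a..b} \<subseteq> Q"
  shows "arc_in Q (\<gamma> a) (\<gamma> b)"
proof -
  have ab: "a < b" using assms(1) by (rule causal_arc_less)
  have "causal_arc 0 1 (\<lambda>s. \<gamma> (a + (b - a) * s))" by (rule causal_arc_affine[OF assms(1)]) (use ab in auto)
  moreover have "a + (b - a) * s \<in> {a..b}" if "s \<in> {0..1}" for s
  proof -
    have "(b - a) * s \<le> (b - a) * 1" using that ab by (intro mult_left_mono) auto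
    moreover have "0 \<le> (b - a) * s" using that ab by simp
    ultimately show ?thesis by (simp only: atLeastAtMost_iff mult_1_right) linarith
  qed
  ultimately show ?thesis using assms(2) unfolding arc_in_def
    by (intro exI[of _ "\<lambda>s. \<gamma> (a + (b - a) * s)"]) (auto simp: image_subset_iff)
qed

lemma arc_in_trans:
  assumes "arc_in Q x y" "arc_in Q y z" shows "arc_in Q x z"
proof -
  obtain \<gamma>1 where 1: "causal_arc 0 1 \<gamma>1" "\<gamma>1 0 = x" "\<gamma>1 1 = y" "\<gamma>1 ` {0..1} \<subseteq> Q" using assms(1) unfolding arc_in_def by blast
  obtain \<gamma>2 where 2: "causal_arc 0 1 \<gamma>2" "\<gamma>2 0 = y" "\<gamma>2 1 = z" "\<gamma>2 ` {0..1} \<subseteq> Q" using assms(2) unfolding arc_in_def by blast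
  have "causal_arc 1 2 (\<lambda>s. \<gamma>2 (-1 + 1 * s))" by (rule causal_arc_affine[OF 2(1)]) auto
  from causal_arc_join[OF 1(1) this]
  have "causal_arc 0 2 (\<lambda>t. if t \<le> 1 then \<gamma>1 t else \<gamma>2 (-1 + 1 * t))" (is "causal_arc 0 2 ?\<gamma>") using 1 2 by simp
  from causal_arc_imp_arc_in[OF this, of Q] show ?thesis using 1 2 by (force simp: image_subset_iff)
qed

text \<open>
  On the interval between the integers \<open>k\<close> and \<open>k + 2\<close> the curve is two
  arcs joined, and these intervals have overlapping interiors that cover the line.
\<close>
lemma chain_curve:
  assumes "\<And>k::int. arc_in UNIV (x k) (x (k + 1))"
  shows "\<exists>\<gamma>. causal_curve A C UNIV \<gamma> \<and> (\<forall>k. \<gamma> (of_int k) = x k)"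
proof -
  obtain g where g: "\<And>k. causal_arc 0 1 (g k)" "\<And>k. g k 0 = x k" "\<And>k. g k 1 = x (k + 1)"
    using assms unfolding arc_in_def by metis
  define \<gamma> where "\<gamma> t = g \<lfloor>t\<rfloor> (t - of_int \<lfloor>t\<rfloor>)" for t :: real
  have cc: "causal_arc (of_int k) (of_int k + 2) \<gamma>" for k
  proof -
    have 1: "causal_arc (of_int k) (of_int k + 1) (\<lambda>s. g k (- of_int k + 1 * s))" by (rule causal_arc_affine[OF g(1)]) auto
    have 2: "causal_arc (of_int k + 1) (of_int k + 2) (\<lambda>s. g (k + 1) (- of_int k - 1 + 1 * s))" by (rule causal_arc_affine[OF g(1)]) auto
    show ?thesis
    proof (rule causal_arc_cong[OF causal_arc_join[OF 1 2]])
      show "g k (- of_int k + 1 * (of_int k + 1)) = g (k + 1) (- of_int k - 1 + 1 * (of_int k + 1))"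
        using g(2,3) by simp
      fix t :: real assume t: "t \<in> {of_int k..of_int k + 2}"
      consider "t < of_int k + 1" | "t = of_int k + 1" | "of_int k + 1 < t" "t < of_int k + 2" | "t = of_int k + 2"
        using t by fastforce
      then show "(if t \<le> of_int k + 1 then g k (- of_int k + 1 * t) else g (k + 1) (- of_int k - 1 + 1 * t)) = \<gamma> t"
      proof cases
        case 1
        then have "\<lfloor>t\<rfloor> = k" using t by (intro floor_unique) auto
        then show ?thesis using 1 by (simp add: \<gamma>_def)
      next
        case 2
        then have "\<lfloor>t\<rfloor> = k + 1" by simp
        then show ?thesis using 2 g(2,3) by (simp add: \<gamma>_def)
      next
        case 3
        then have "\<lfloor>t\<rfloor> = k + 1" by (intro floor_unique) auto
        then show ?thesis using 3 by (simp add: \<gamma>_def algebra_simps)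
      next
        case 4
        then have "\<lfloor>t\<rfloor> = k + 2" by simp
        then show ?thesis using 4 g(2)[of "k + 2"] g(3)[of "k + 1"] by (simp add: \<gamma>_def add.commute)
      qed
    qed
  qed
  \<comment> \<open>starting the window at the ceiling minus 1 keeps t in its interior, also when t is an integer\<close>
  have inside: "t \<in> {of_int (\<lceil>t\<rceil> - 1)<..<of_int (\<lceil>t\<rceil> - 1) + 2}" for t :: real
    using ceiling_correct[of t] by (simp, linarith)
  have "\<forall>k. \<exists>N. negligible N \<and> (\<forall>t\<in>{of_int k<..<of_int k + 2} - N. has_cone_velocity \<gamma> t)"
    using cc unfolding causal_arc_def by blast
  then obtain N where N: "\<And>k::int. negligible (N k)" "\<And>k t. t \<in> {of_int k<..<of_int k + 2} - N k \<Longrightarrow> has_cone_velocity \<gamma> t"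
    by metis
  have "causal_curve A C UNIV \<gamma>"
  proof (rule causal_curveI)
    show "negligible (\<Union>k. N k)" using N(1) by (intro negligible_countable_Union) auto
    show "has_cone_velocity \<gamma> t" if "t \<in> interior UNIV - (\<Union>k. N k)" for t
      using that inside[of t] N(2)[of t "\<lceil>t\<rceil> - 1"] by auto
    show "locally_lipschitz_curve A UNIV \<gamma>"
      unfolding locally_lipschitz_curve_def
    proof
      fix t :: real
      let ?a = "of_int (\<lceil>t\<rceil> - 1) :: real"
      have "t \<in> {?a..?a + 2}" using inside[of t] by auto
      then obtain c \<delta> L where *: "c \<in> A" "\<delta> > 0" "\<gamma> ` ({?a..?a + 2} \<inter> ball t \<delta>) \<subseteq> fst c"
        "L-lipschitz_on ({?a..?a + 2} \<inter> ball t \<delta>) (snd c \<circ> \<gamma>)"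
        using cc[of "\<lceil>t\<rceil> - 1"] unfolding causal_arc_def locally_lipschitz_curve_def by meson
      obtain \<delta>2 where \<delta>2: "\<delta>2 > 0" "ball t \<delta>2 \<subseteq> {?a<..<?a + 2}"
        using inside[of t] openE[OF open_greaterThanLessThan] by metis
      have sub: "UNIV \<inter> ball t (min \<delta> \<delta>2) \<subseteq> {?a..?a + 2} \<inter> ball t \<delta>" using \<delta>2(2) by fastforce
      have "min \<delta> \<delta>2 > 0" using * \<delta>2 by simp
      then show "\<exists>c\<in>A. \<exists>\<delta>>0. \<exists>L. \<gamma> ` (UNIV \<inter> ball t \<delta>) \<subseteq> fst c \<and> L-lipschitz_on (UNIV \<inter> ball t \<delta>) (snd c \<circ> \<gamma>)"
        using *(1) lipschitz_on_subset[OF *(4) sub] subset_trans[OF image_mono[OF sub] *(3)] by blast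
    qed
  qed auto
  moreover have "\<gamma> (of_int k) = x k" for k using g(2) by (simp add: \<gamma>_def)
  ultimately show ?thesis by blast
qed

text \<open>
  If a reparametrised curve extended beyond an end of its interval, it would have a limit at that
  end; the times mapped to the integers tend to it.
\<close>
lemma inextensible_if_no_limits:
  assumes \<gamma>: "causal_curve A C UNIV \<gamma>"
    and future: "\<nexists>q. (\<lambda>n. \<gamma> (real n)) \<longlonglongrightarrow> q" and past: "\<nexists>q. (\<lambda>n. \<gamma> (- real n)) \<longlonglongrightarrow> q"
  shows "inextensible_causal_curve A C UNIV \<gamma>"
proof -
  have "\<not> extensible_curve A C J (\<gamma> \<circ> s)" if J: "is_interval J" "strict_mono_on J s" "s ` J = UNIV" for J s
  proof
    assume "extensible_curve A C J (\<gamma> \<circ> s)"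
    then obtain J' \<eta> where J': "J \<subset> J'" "causal_curve A C J' \<eta>" "\<And>t. t \<in> J \<Longrightarrow> \<eta> t = \<gamma> (s t)"
      unfolding extensible_curve_def by auto
    then obtain b0 where b0: "b0 \<in> J'" "b0 \<notin> J" by blast
    have iJ': "is_interval J'" and ll: "locally_lipschitz_curve A J' \<eta>" using J'(2) unfolding causal_curve_def by auto
    have cont: "continuous_on J' \<eta>" by (rule locally_lipschitz_curve_continuous[OF ll])
    \<comment> \<open>the parameter at which the reparametrised curve reaches the time u of the original one\<close>
    define \<theta> where "\<theta> = inv_into J s"
    have \<theta>: "\<theta> u \<in> J" "s (\<theta> u) = u" for u
      unfolding \<theta>_def using J(3) by (auto intro: inv_into_into f_inv_into_f)
    have \<theta>s: "\<theta> (s t) = t" if "t \<in> J" for t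
      unfolding \<theta>_def using that strict_mono_on_imp_inj_on[OF J(2)] by (simp add: inv_into_f_f)
    have less: "t < u \<longleftrightarrow> s t < s u" if "t \<in> J" "u \<in> J" for t u
      using J(2) that by (metis linorder_neqE order_less_asym strict_mono_onD)
    have "(\<forall>t\<in>J. t < b0) \<or> (\<forall>t\<in>J. b0 < t)"
      using J(1) b0(2) unfolding is_interval_1 by (meson linorder_not_less order_le_less)
    then show False
    proof
      assume up: "\<forall>t\<in>J. t < b0"
      define b where "b = Sup J"
      have J0: "J \<noteq> {}" using \<theta>(1) by auto
      have bdd: "bdd_above J" using up by (auto simp: bdd_above_def intro!: exI[of _ b0] less_imp_le)
      have le: "t \<le> b" if "t \<in> J" for t unfolding b_def using that bdd by (rule cSup_upper)
      have "b \<le> b0" unfolding b_def using J0 up by (intro cSup_least) (auto simp: less_imp_le)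
      then have bJ': "b \<in> J'" using iJ' le[OF \<theta>(1)[of 0]] \<theta>(1)[of 0] J'(1) b0(1) unfolding is_interval_1 by blast
      have conv: "(\<lambda>n. \<theta> (real n)) \<longlonglongrightarrow> b"
      proof (rule LIMSEQ_I)
        fix e :: real assume "0 < e"
        then obtain t where t: "t \<in> J" "b - e < t" using less_cSup_iff[OF J0 bdd, of "b - e"] by (auto simp: b_def)
        obtain N :: nat where N: "s t < real N" using reals_Archimedean2 by blast
        have "norm (\<theta> (real n) - b) < e" if "n \<ge> N" for n
        proof -
          have "t < \<theta> (real n)" using less[OF t(1) \<theta>(1)] N that \<theta>(2) by auto
          then show ?thesis using t(2) le[OF \<theta>(1), of "real n"] by auto
        qed
        then show "\<exists>N. \<forall>n\<ge>N. norm (\<theta> (real n) - b) < e" by blast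
      qed
      have "(\<lambda>n. \<eta> (\<theta> (real n))) \<longlonglongrightarrow> \<eta> b"
      proof (rule continuous_on_tendsto_compose[OF cont conv bJ'])
        show "\<forall>\<^sub>F n in sequentially. \<theta> (real n) \<in> J'" using \<theta>(1) J'(1) by (intro always_eventually allI) blast
      qed
      then show False using future J'(3) \<theta> by auto
    next
      assume dn: "\<forall>t\<in>J. b0 < t"
      define b where "b = Inf J"
      have J0: "J \<noteq> {}" using \<theta>(1) by auto
      have bdd: "bdd_below J" using dn by (auto simp: bdd_below_def intro!: exI[of _ b0] less_imp_le)
      have le: "b \<le> t" if "t \<in> J" for t unfolding b_def using that bdd by (rule cInf_lower)
      have "b0 \<le> b" unfolding b_def using J0 dn by (intro cInf_greatest) (auto simp: less_imp_le)
      then have bJ': "b \<in> J'" using iJ' le[OF \<theta>(1)[of 0]] \<theta>(1)[of 0] J'(1) b0(1) unfolding is_interval_1 by blast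
      have conv: "(\<lambda>n. \<theta> (- real n)) \<longlonglongrightarrow> b"
      proof (rule LIMSEQ_I)
        fix e :: real assume "0 < e"
        then obtain t where t: "t \<in> J" "t < b + e" using cInf_less_iff[OF J0 bdd, of "b + e"] by (auto simp: b_def)
        obtain N :: nat where N: "- s t < real N" using reals_Archimedean2 by blast
        have "norm (\<theta> (- real n) - b) < e" if "n \<ge> N" for n
        proof -
          have "\<theta> (- real n) < t" using less[OF \<theta>(1) t(1)] N that \<theta>(2) by auto
          then show ?thesis using t(2) le[OF \<theta>(1), of "- real n"] by auto
        qed
        then show "\<exists>N. \<forall>n\<ge>N. norm (\<theta> (- real n) - b) < e" by blast
      qed
      have "(\<lambda>n. \<eta> (\<theta> (- real n))) \<longlonglongrightarrow> \<eta> b"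
      proof (rule continuous_on_tendsto_compose[OF cont conv bJ'])
        show "\<forall>\<^sub>F n in sequentially. \<theta> (- real n) \<in> J'" using \<theta>(1) J'(1) by (intro always_eventually allI) blast
      qed
      then show False using past J'(3) \<theta> by auto
    qed
  qed
  moreover have "\<not> extensible_curve A C UNIV \<gamma>" unfolding extensible_curve_def by blast
  ultimately show ?thesis using \<gamma> unfolding inextensible_causal_curve_def by blast
qed

text \<open>
  The domain is closed and contains the points with a velocity in the cones, which are dense on the
  arc.
\<close>
lemma causal_arc_domain:
  assumes "causal_arc a b \<gamma>" "t \<in> {a..b}" shows "\<gamma> t \<in> cone_domain C"
proof -
  obtain N where N: "negligible N" "\<And>t. t \<in> {a<..<b} - N \<Longrightarrow> has_cone_velocity \<gamma> t"
    using assms unfolding causal_arc_def by blast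
  have ab: "a < b" using assms(1) by (rule causal_arc_less)
  have dom: "\<gamma> s \<in> cone_domain C" if "s \<in> {a<..<b} - N" for s
    using N(2)[OF that] fibre_nonempty_iff unfolding has_cone_velocity_def by blast
  show ?thesis
  proof (rule ccontr)
    assume "\<gamma> t \<notin> cone_domain C"
    then have "\<forall>\<^sub>F s in at t within {a..b}. \<gamma> s \<in> - cone_domain C"
      using causal_arc_continuous[OF assms(1)] assms(2) closed_cone_domain
      unfolding continuous_on_def by (intro topological_tendstoD) auto
    then obtain d where d: "d > 0" "\<And>s. s \<in> {a..b} \<Longrightarrow> s \<noteq> t \<Longrightarrow> dist s t < d \<Longrightarrow> \<gamma> s \<notin> cone_domain C"
      unfolding eventually_at by auto
    define u where "u = max a (t - d)"
    define v where "v = min b (t + d)"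
    have uv: "u < v" using d ab assms(2) by (auto simp: u_def v_def)
    have "{u<..<v} \<subseteq> insert t N"
    proof
      fix s assume s: "s \<in> {u<..<v}"
      then have "s \<in> {a<..<b}" "dist s t < d" by (auto simp: u_def v_def dist_real_def)
      then show "s \<in> insert t N" using d(2)[of s] dom[of s] by auto
    qed
    then have "negligible {u<..<v}" using N(1) negligible_subset by (metis negligible_insert)
    then show False using negligible_interval(2)[of u v] uv by simp
  qed
qed

lemma arc_in_domain: "arc_in Q x y \<Longrightarrow> x \<in> cone_domain C \<and> y \<in> cone_domain C"
  unfolding arc_in_def using causal_arc_domain[of 0 1 _ 0] causal_arc_domain[of 0 1 _ 1] by auto

text \<open>
  A constant arc has velocity 0, which is not a cone vector.
\<close>
lemma causal_arc_nonconstant: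
  assumes "causal_arc a b \<gamma>" shows "\<exists>t\<in>{a<..<b}. \<gamma> t \<noteq> \<gamma> a"
proof (rule ccontr)
  assume "\<not> ?thesis"
  then have const: "\<And>t. t \<in> {a<..<b} \<Longrightarrow> \<gamma> t = \<gamma> a" by blast
  have ab: "a < b" using assms(1) by (rule causal_arc_less)
  obtain N where N: "negligible N" "\<And>t. t \<in> {a<..<b} - N \<Longrightarrow> has_cone_velocity \<gamma> t"
    using assms unfolding causal_arc_def by blast
  have "\<not> {a<..<b} \<subseteq> N" using N(1) negligible_subset negligible_interval(2)[of a b] ab by auto
  then obtain t where t: "t \<in> {a<..<b} - N" by blast
  then obtain c w where c: "c \<in> A" "\<gamma> t \<in> fst c" and w: "w \<in> fibre c (\<gamma> t)" "((snd c \<circ> \<gamma>) has_vector_derivative w) (at t)"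
    using N(2) unfolding has_cone_velocity_def by blast
  have "((snd c \<circ> \<gamma>) has_vector_derivative 0) (at t)"
    by (rule has_vector_derivative_transform_within_open[of "\<lambda>_. snd c (\<gamma> a)" _ _ "{a<..<b}"]) (use t const in auto)
  then have "w = 0" using w(2) vector_derivative_unique_at by blast
  then show False using w(1) zero_notin_fibre[OF c] by simp
qed

lemma strict_causal_future_iff: "y \<in> strict_causal_future A C x \<longleftrightarrow> arc_in UNIV x y"
proof
  assume "y \<in> strict_causal_future A C x"
  then obtain T \<gamma> where "T > 0" "causal_curve A C {0..T} \<gamma>" "\<gamma> 0 = x" "\<gamma> T = y"
    unfolding strict_causal_future_def by blast
  then show "arc_in UNIV x y" using causal_curve_imp_causal_arc[of "{0..T}" \<gamma> 0 T] causal_arc_imp_arc_in[of 0 T \<gamma> UNIV] by simp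
next
  assume "arc_in UNIV x y"
  then obtain \<gamma> where \<gamma>: "causal_arc 0 1 \<gamma>" "\<gamma> 0 = x" "\<gamma> 1 = y" unfolding arc_in_def by blast
  have "causal_curve A C {0..1} \<gamma> \<and> \<gamma> 0 = x \<and> \<gamma> 1 = y" using causal_arc_imp_causal_curve[OF \<gamma>(1)] \<gamma>(2,3) by simp
  then have "\<exists>T>0. \<exists>\<gamma>. causal_curve A C {0..T} \<gamma> \<and> \<gamma> 0 = x \<and> \<gamma> T = y" by (metis zero_less_one)
  then show "y \<in> strict_causal_future A C x" unfolding strict_causal_future_def by simp
qed

lemma causal_future_iff: "y \<in> causal_future A C x \<longleftrightarrow> (x = y \<and> x \<in> cone_domain C) \<or> arc_in UNIV x y"
proof
  assume "y \<in> causal_future A C x"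
  then obtain T \<gamma> where T: "T \<ge> 0" "causal_curve A C {0..T} \<gamma>" "\<gamma> 0 = x" "\<gamma> T = y"
    unfolding causal_future_def by blast
  show "(x = y \<and> x \<in> cone_domain C) \<or> arc_in UNIV x y"
  proof (cases "T = 0")
    case True
    then show ?thesis using T unfolding causal_curve_def by auto
  next
    case False
    then have "T > 0" using T(1) by simp
    then have "y \<in> strict_causal_future A C x" using T(2-4) unfolding strict_causal_future_def by blast
    then show ?thesis by (simp add: strict_causal_future_iff)
  qed
next
  assume "(x = y \<and> x \<in> cone_domain C) \<or> arc_in UNIV x y"
  then show "y \<in> causal_future A C x"
  proof
    assume xy: "x = y \<and> x \<in> cone_domain C"
    have "locally_lipschitz_curve A {0..0} (\<lambda>_. x)"
      unfolding locally_lipschitz_curve_def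
    proof
      fix t :: real
      obtain c where c: "c \<in> A" "x \<in> fst c" using chart_at by blast
      have "0-lipschitz_on ({0..0} \<inter> ball t 1) (snd c \<circ> (\<lambda>_. x))" by (rule lipschitz_onI) auto
      moreover have "(\<lambda>_. x) ` ({0..0} \<inter> ball t 1) \<subseteq> fst c" using c by auto
      ultimately show "\<exists>c\<in>A. \<exists>\<delta>>0. \<exists>L. (\<lambda>_. x) ` ({0..0} \<inter> ball t \<delta>) \<subseteq> fst c \<and>
          L-lipschitz_on ({0..0} \<inter> ball t \<delta>) (snd c \<circ> (\<lambda>_. x))"
        using c(1) zero_less_one by blast
    qed
    moreover have "is_interval {0..0::real}" by (rule is_interval_cc)
    ultimately have "causal_curve A C {0..0} (\<lambda>_. x)" using xy unfolding causal_curve_def by auto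
    then show ?thesis using xy unfolding causal_future_def by (intro CollectI exI[of _ 0] conjI exI[of _ "\<lambda>_. x"]) auto
  next
    assume "arc_in UNIV x y"
    then show ?thesis unfolding strict_causal_future_iff[symmetric] strict_causal_future_def causal_future_def
      using less_imp_le by blast
  qed
qed

end

section \<open>Boxes adapted to the cone field\<close>

context cone_manifold
begin

text \<open>
  The ball of radius \<open>r\<close> is the core of the box, the closed ball of radius \<open>2 *
  r\<close> the box itself.
\<close>
definition good_box :: "('m, 'e) chart \<Rightarrow> 'e \<Rightarrow> real \<Rightarrow> ('e \<Rightarrow> real) \<Rightarrow> bool" where
  "good_box c p r l \<longleftrightarrow> c \<in> A \<and> 0 < r \<and> cball p (2 * r) \<subseteq> snd c ` fst c \<and>
     cone_box (local_cone c) (cball p (2 * r)) l"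

lemma good_box_exists:
  assumes "open V" "x \<in> V"
  shows "\<exists>c p r l. good_box c p r l \<and> x \<in> region c (ball p r) \<and> region c (cball p (2 * r)) \<subseteq> V"
proof -
  obtain c where c: "c \<in> A" "x \<in> fst c" using chart_at by blast
  obtain l0 where l0: "bounded_linear l0" "\<And>w. w \<in> fibre c x \<Longrightarrow> 0 < (l0 w :: real)" using fibre_functional[OF c] by blast
  obtain r k where r: "r > 0" "cball (snd c x) (2 * r) \<subseteq> snd c ` (fst c \<inter> V)"
    "cone_box (local_cone c) (cball (snd c x) (2 * r)) (\<lambda>w. k * l0 w)"
    using cone_box_exists[OF c l0 assms] by blast
  have "region c (cball (snd c x) (2 * r)) \<subseteq> V"
  proof
    fix y assume "y \<in> region c (cball (snd c x) (2 * r))"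
    then have y: "y \<in> fst c" "snd c y \<in> snd c ` (fst c \<inter> V)" using r(2) by (auto simp: region_def)
    then obtain z where "z \<in> fst c" "z \<in> V" "snd c y = snd c z" by blast
    then show "y \<in> V" using y(1) c(1) chart_inv_chart by metis
  qed
  moreover have "good_box c (snd c x) r (\<lambda>w. k * l0 w)" using c r unfolding good_box_def by blast
  moreover have "x \<in> region c (ball (snd c x) r)" using c r(1) by (simp add: region_def)
  ultimately show ?thesis by blast
qed

lemma causal_arc_imp_cone_curve:
  assumes g: "good_box c p r l" and \<gamma>: "causal_arc 0 1 \<gamma>" "\<gamma> ` {0..1} \<subseteq> region c (cball p (2 * r))"
  shows "cone_box.cone_curve (local_cone c) (cball p (2 * r)) 0 1 (snd c \<circ> \<gamma>)"
proof -
  have c: "c \<in> A" and cb: "cone_box (local_cone c) (cball p (2 * r)) l" using g by (auto simp: good_box_def)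
  have ll: "locally_lipschitz_curve A {0..1} \<gamma>" using \<gamma>(1) by (simp add: causal_arc_def)
  obtain N where N: "negligible N" "\<And>t. t \<in> {0<..<1} - N \<Longrightarrow> has_cone_velocity \<gamma> t"
    using \<gamma>(1) unfolding causal_arc_def by blast
  have dom: "\<gamma> t \<in> fst c" if "t \<in> {0..1}" for t using subsetD[OF \<gamma>(2) imageI[OF that]] by (simp add: region_def)
  show ?thesis
    unfolding cone_box.cone_curve_def[OF cb]
  proof (intro conjI exI[of _ "insert 0 (insert 1 N)"] ballI)
    show "pointwise_lipschitz_on {0..1} (snd c \<circ> \<gamma>)"
      unfolding pointwise_lipschitz_on_def
    proof
      fix t :: real assume t: "t \<in> {0..1}"
      obtain \<delta> L where *: "\<delta> > 0" "L-lipschitz_on ({0..1} \<inter> ball t \<delta>) (snd c \<circ> \<gamma>)"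
        using locally_lipschitz_curve_in_chart[OF ll t c dom[OF t]] by blast
      have "norm ((snd c \<circ> \<gamma>) s - (snd c \<circ> \<gamma>) t) \<le> L * norm (s - t)" if "s \<in> {0..1} \<inter> ball t \<delta>" for s
        using lipschitz_onD[OF *(2) that, of t] t * by (simp add: dist_norm)
      then show "\<exists>T B. open T \<and> t \<in> T \<and>
          (\<forall>s\<in>{0..1} \<inter> T. norm ((snd c \<circ> \<gamma>) s - (snd c \<circ> \<gamma>) t) \<le> B * norm (s - t))"
        using *(1) by (intro exI[of _ "ball t \<delta>"] exI[of _ L]) auto
    qed
    show "(snd c \<circ> \<gamma>) ` {0..1} \<subseteq> cball p (2 * r)" using \<gamma>(2) by (auto simp: region_def)
    show "negligible (insert 0 (insert 1 N))" using N(1) by simp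
    fix t assume "t \<in> {0..1} - insert 0 (insert 1 N)"
    then have t: "t \<in> {0<..<1} - N" by auto
    then have "isCont \<gamma> t" using causal_arc_isCont[OF \<gamma>(1)] by blast
    moreover have "\<gamma> t \<in> fst c" using t by (intro dom) simp
    ultimately obtain w where "w \<in> fibre c (\<gamma> t)" "((snd c \<circ> \<gamma>) has_vector_derivative w) (at t)"
      using has_cone_velocity_in_chart[OF N(2)[OF t] _ c] by blast
    moreover have "local_cone c ((snd c \<circ> \<gamma>) t) = fibre c (\<gamma> t)" using dom[of t] t c by (simp add: local_cone_def)
    ultimately show "\<exists>w\<in>local_cone c ((snd c \<circ> \<gamma>) t). ((snd c \<circ> \<gamma>) has_vector_derivative w) (at t within {0..1})"
      using has_vector_derivative_at_within by blast
  qed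
qed

lemma cone_curve_imp_causal_arc:
  assumes g: "good_box c p r l" and \<sigma>: "cone_box.cone_curve (local_cone c) (cball p (2 * r)) 0 1 \<sigma>" "L-lipschitz_on {0..1} \<sigma>"
  shows "causal_arc 0 1 (chart_inv c \<circ> \<sigma>)" "(chart_inv c \<circ> \<sigma>) ` {0..1} \<subseteq> region c (cball p (2 * r))"
proof -
  have c: "c \<in> A" and cb: "cone_box (local_cone c) (cball p (2 * r)) l" 
    and sub: "cball p (2 * r) \<subseteq> snd c ` fst c" using g by (auto simp: good_box_def)
  obtain N where N: "negligible N"
    "\<And>t. t \<in> {0..1} - N \<Longrightarrow> \<exists>w\<in>local_cone c (\<sigma> t). (\<sigma> has_vector_derivative w) (at t within {0..1})"
    and im: "\<sigma> ` {0..1} \<subseteq> cball p (2 * r)"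
    using \<sigma>(1) unfolding cone_box.cone_curve_def[OF cb] by blast
  have img: "\<sigma> t \<in> snd c ` fst c" if "t \<in> {0..1}" for t using im sub that by blast
  show "(chart_inv c \<circ> \<sigma>) ` {0..1} \<subseteq> region c (cball p (2 * r))"
    using im img by (auto simp: region_def image_subset_iff)
  have "locally_lipschitz_curve A {0..1} (chart_inv c \<circ> \<sigma>)"
    unfolding locally_lipschitz_curve_def
  proof
    fix t :: real
    have "L-lipschitz_on ({0..1} \<inter> ball t 1) (snd c \<circ> (chart_inv c \<circ> \<sigma>))"
      by (rule lipschitz_on_transform[OF lipschitz_on_subset[OF \<sigma>(2)]]) (use img in auto)
    moreover have "(chart_inv c \<circ> \<sigma>) ` ({0..1} \<inter> ball t 1) \<subseteq> fst c" using img by auto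
    ultimately show "\<exists>c'\<in>A. \<exists>\<delta>>0. \<exists>L. (chart_inv c \<circ> \<sigma>) ` ({0..1} \<inter> ball t \<delta>) \<subseteq> fst c' \<and>
        L-lipschitz_on ({0..1} \<inter> ball t \<delta>) (snd c' \<circ> (chart_inv c \<circ> \<sigma>))"
      using c zero_less_one by blast
  qed
  moreover have "has_cone_velocity (chart_inv c \<circ> \<sigma>) t" if t: "t \<in> {0<..<1} - N" for t
  proof -
    obtain w where w: "w \<in> local_cone c (\<sigma> t)" "(\<sigma> has_vector_derivative w) (at t within {0..1})" using N(2)[of t] t by auto
    have "at t within {0..1} = at t" using t by (intro at_within_Icc_at) auto
    then have "(\<sigma> has_vector_derivative w) (at t)" using w(2) by simp
    then have "((snd c \<circ> (chart_inv c \<circ> \<sigma>)) has_vector_derivative w) (at t)"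
      by (rule has_vector_derivative_transform_within_open[of _ _ _ "{0<..<1}"]) (use t img in auto)
    then show ?thesis using w(1) c img[of t] t unfolding has_cone_velocity_def local_cone_def 
      by (intro bexI[of _ c]) auto
  qed
  ultimately show "causal_arc 0 1 (chart_inv c \<circ> \<sigma>)" using N(1) unfolding causal_arc_def by auto
qed

lemma arc_in_l_less:
  assumes g: "good_box c p r l" and "arc_in (region c (cball p (2 * r))) x y"
  shows "l (snd c x) < l (snd c y)"
proof -
  obtain \<gamma> where \<gamma>: "causal_arc 0 1 \<gamma>" "\<gamma> 0 = x" "\<gamma> 1 = y" "\<gamma> ` {0..1} \<subseteq> region c (cball p (2 * r))"
    using assms(2) unfolding arc_in_def by blast
  have cb: "cone_box (local_cone c) (cball p (2 * r)) l" using g by (auto simp: good_box_def)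
  show ?thesis using cone_box.l_increasing[OF cb causal_arc_imp_cone_curve[OF g \<gamma>(1,4)]] \<gamma>(2,3) by simp
qed

definition arc_in_eq :: "'m set \<Rightarrow> 'm \<Rightarrow> 'm \<Rightarrow> bool" where
  "arc_in_eq Q x y \<longleftrightarrow> arc_in Q x y \<or> (x = y \<and> x \<in> Q \<inter> cone_domain C)"

lemma arc_in_eq_trans: "arc_in_eq Q x y \<Longrightarrow> arc_in_eq Q y z \<Longrightarrow> arc_in_eq Q x z"
  unfolding arc_in_eq_def using arc_in_trans by blast

lemma arc_in_eq_mono: "arc_in_eq Q x y \<Longrightarrow> Q \<subseteq> R \<Longrightarrow> arc_in_eq R x y"
  unfolding arc_in_eq_def using arc_in_mono by blast

lemma arc_in_eq_endpoints: "arc_in_eq Q x y \<Longrightarrow> x \<in> Q \<inter> cone_domain C \<and> y \<in> Q \<inter> cone_domain C"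
  unfolding arc_in_eq_def using arc_in_endpoints arc_in_domain by blast

lemma compact_box:
  assumes "good_box c p r l" shows "compact (region c (cball p (2 * r)))"
  using assms unfolding good_box_def by (intro compact_region) (auto simp: compact_eq_bounded_closed)

text \<open>
  If the limit points differ, then so do the points of the sequences from some index on, and these
  are joined by arcs to which the limit theorem for curves in the model space applies. If they
  agree, only membership in the closed domain remains.
\<close>
lemma arc_in_eq_closed:
  assumes g: "good_box c p r l" and X: "X \<longlonglongrightarrow> x" and Y: "Y \<longlonglongrightarrow> y"
    and XY: "\<And>n::nat. arc_in_eq (region c (cball p (2 * r))) (X n) (Y n)"
  shows "arc_in_eq (region c (cball p (2 * r))) x y"
proof -
  let ?Q = "region c (cball p (2 * r))"
  have c: "c \<in> A" and cb: "cone_box (local_cone c) (cball p (2 * r)) l" using g by (auto simp: good_box_def)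
  have cl: "closed (?Q \<inter> cone_domain C)"
    using compact_imp_closed[OF compact_box[OF g]] closed_cone_domain by (rule closed_Int)
  have x: "x \<in> ?Q \<inter> cone_domain C" by (rule Lim_in_closed_set[OF cl _ _ X]) (use arc_in_eq_endpoints[OF XY] in auto)
  have y: "y \<in> ?Q \<inter> cone_domain C" by (rule Lim_in_closed_set[OF cl _ _ Y]) (use arc_in_eq_endpoints[OF XY] in auto)
  show ?thesis
  proof (cases "x = y")
    case True
    then show ?thesis using x by (simp add: arc_in_eq_def)
  next
    case False
    then obtain U V where UV: "open U" "open V" "x \<in> U" "y \<in> V" "U \<inter> V = {}" using hausdorff by metis
    have "\<forall>\<^sub>F n in sequentially. X n \<in> U" "\<forall>\<^sub>F n in sequentially. Y n \<in> V"
      using X Y UV by (auto intro: topological_tendstoD)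
    then have "\<forall>\<^sub>F n in sequentially. X n \<noteq> Y n" by eventually_elim (use UV in auto)
    then obtain N where N: "\<And>n. n \<ge> N \<Longrightarrow> X n \<noteq> Y n" unfolding eventually_sequentially by blast
    have "\<exists>\<gamma>. causal_arc 0 1 \<gamma> \<and> \<gamma> 0 = X (n + N) \<and> \<gamma> 1 = Y (n + N) \<and> \<gamma> ` {0..1} \<subseteq> ?Q" for n
      using XY[of "n + N"] N[of "n + N"] unfolding arc_in_eq_def arc_in_def by auto
    then obtain \<gamma> where \<gamma>: "\<And>n. causal_arc 0 1 (\<gamma> n)" "\<And>n. \<gamma> n 0 = X (n + N)" "\<And>n. \<gamma> n 1 = Y (n + N)" "\<And>n. \<gamma> n ` {0..1} \<subseteq> ?Q"
      by metis
    have lx: "(\<lambda>n. (snd c \<circ> \<gamma> n) 0) \<longlonglongrightarrow> snd c x"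
      using tendsto_chart[OF c _ LIMSEQ_ignore_initial_segment[OF X, of N]] x \<gamma>(2) by (simp add: region_def)
    have ly: "(\<lambda>n. (snd c \<circ> \<gamma> n) 1) \<longlonglongrightarrow> snd c y"
      using tendsto_chart[OF c _ LIMSEQ_ignore_initial_segment[OF Y, of N]] y \<gamma>(3) by (simp add: region_def)
    have ne: "snd c x \<noteq> snd c y" using False x y c chart_inv_chart by (metis (mono_tags, lifting) IntD1 mem_Collect_eq region_def)
    obtain h L where h: "cone_box.cone_curve (local_cone c) (cball p (2 * r)) 0 1 h" "L-lipschitz_on {0..1} h"
      "h 0 = snd c x" "h 1 = snd c y"
      using cone_box.cone_curve_limit[OF cb causal_arc_imp_cone_curve[OF g \<gamma>(1,4)] lx ly ne] by blast
    have "(chart_inv c \<circ> h) 0 = x" "(chart_inv c \<circ> h) 1 = y" using h(3,4) x y c by (auto simp: region_def)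
    then have "arc_in ?Q x y" unfolding arc_in_def using cone_curve_imp_causal_arc[OF g h(1,2)] by blast
    then show ?thesis by (simp add: arc_in_eq_def)
  qed
qed

lemma compact_neighbourhood:
  assumes "compact X" shows "\<exists>Y. compact Y \<and> X \<subseteq> interior (Y :: 'm set)"
proof -
  have "\<exists>U Y. open U \<and> x \<in> U \<and> compact Y \<and> U \<subseteq> Y" for x :: 'm
  proof -
    obtain c p r l where g: "good_box c p r l" "x \<in> region c (ball p r)" using good_box_exists[of UNIV x] by auto
    have "region c (ball p r) \<subseteq> region c (cball p (2 * r))"
      using g(1) by (intro region_mono) (auto simp: good_box_def)
    moreover have "open (region c (ball p r))" using g(1) by (simp add: open_region good_box_def)
    ultimately show ?thesis using g(2) compact_box[OF g(1)] by blast
  qed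
  then obtain U Y where UY: "\<And>x::'m. open (U x)" "\<And>x. x \<in> U x" "\<And>x. compact (Y x)" "\<And>x. U x \<subseteq> (Y x :: 'm set)" by metis
  have cov: "X \<subseteq> (\<Union>x\<in>X. U x)" using UY(2) by blast
  obtain S where S: "S \<subseteq> X" "finite S" "X \<subseteq> (\<Union>x\<in>S. U x)"
    using compactE_image[OF assms _ cov] UY(1) by metis
  have "compact (\<Union>x\<in>S. Y x)" using S(2) UY(3) by (intro compact_UN) auto
  moreover have "(\<Union>x\<in>S. U x) \<subseteq> interior (\<Union>x\<in>S. Y x)" 
    using UY(1) by (intro interior_maximal UN_mono[OF subset_refl UY(4)] open_UN) simp
  ultimately show ?thesis using subset_trans[OF S(3)] by meson
qed

text \<open>
  Starting with the empty set ensures that every point lies in some layer between consecutive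
  members.
\<close>
lemma compact_exhaustion:
  "\<exists>K :: nat \<Rightarrow> 'm set. K 0 = {} \<and> (\<forall>n. compact (K n)) \<and> (\<forall>n. K n \<subseteq> interior (K (Suc n))) \<and> (\<Union>n. K n) = UNIV"
proof -
  have "\<exists>U. open U \<and> x \<in> U \<and> (\<exists>Y. compact Y \<and> U \<subseteq> Y)" for x :: 'm
    using compact_neighbourhood[of "{x}"] open_interior interior_subset by (metis compact_sing insert_subset)
  then have "\<Union>{U :: 'm set. open U \<and> (\<exists>Y. compact Y \<and> U \<subseteq> Y)} = UNIV" by blast
  then obtain \<F> where \<F>: "\<F> \<subseteq> {U :: 'm set. open U \<and> (\<exists>Y. compact Y \<and> U \<subseteq> Y)}" "countable \<F>" "\<Union>\<F> = UNIV"
    using Lindelof[of "{U :: 'm set. open U \<and> (\<exists>Y. compact Y \<and> U \<subseteq> Y)}"] by (metis (no_types, lifting) mem_Collect_eq)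
  have "\<F> \<noteq> {}" using \<F>(3) by auto
  then have rng: "range (from_nat_into \<F>) = \<F>" using \<F>(2) by (rule range_from_nat_into)
  then have "\<exists>Y. compact Y \<and> from_nat_into \<F> n \<subseteq> Y" for n using \<F>(1) by blast
  then obtain Y where Y: "\<And>n. compact (Y n)" "\<And>n. from_nat_into \<F> n \<subseteq> Y n" by metis
  have "\<exists>K. K 0 = {} \<and> (\<forall>n. compact (K n) \<and> K n \<union> Y n \<subseteq> interior (K (Suc n)))"
  proof -
    have "\<exists>K. \<forall>n::nat. (compact (K n) \<and> (n = 0 \<longrightarrow> K n = {})) \<and> K n \<union> Y n \<subseteq> interior (K (Suc n))"
    proof (rule dependent_nat_choice)
      fix X :: "'m set" and n :: nat assume "compact X \<and> (n = 0 \<longrightarrow> X = {})"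
      then obtain Z where "compact Z" "X \<union> Y n \<subseteq> interior Z"
        using compact_neighbourhood[of "X \<union> Y n"] Y(1) by auto
      then show "\<exists>Z. (compact Z \<and> (Suc n = 0 \<longrightarrow> Z = {})) \<and> X \<union> Y n \<subseteq> interior Z" by auto
    qed auto
    then show ?thesis by blast
  qed
  then obtain K where K: "K 0 = {}" "\<And>n. compact (K n)" "\<And>n. K n \<union> Y n \<subseteq> interior (K (Suc n))" by blast
  have "x \<in> (\<Union>n. K n)" for x
  proof -
    obtain n where "x \<in> from_nat_into \<F> n" using \<F>(3) rng by (metis UNIV_I UnionE rangeE)
    then have "x \<in> interior (K (Suc n))" using Y(2)[of n] K(3)[of n] by blast
    then show ?thesis using interior_subset by blast
  qed
  then have "(\<Union>n. K n) = UNIV" by blast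
  moreover have "\<forall>n. K n \<subseteq> interior (K (Suc n))" using K(3) by simp
  ultimately show ?thesis using K(1,2) by (intro exI[of _ K] conjI allI) simp_all
qed

end

section \<open>A locally finite cover by boxes\<close>

text \<open>
  A chart, centre and radius of a ball in its image, and the dominating functional.
\<close>
type_synonym ('m, 'e) chart_box = "('m, 'e) chart \<times> 'e \<times> real \<times> ('e \<Rightarrow> real)"

context cone_manifold
begin

definition good :: "('m, 'e) chart_box \<Rightarrow> bool" where
  "good i \<longleftrightarrow> (case i of (c, p, r, l) \<Rightarrow> good_box c p r l)"

definition core :: "('m, 'e) chart_box \<Rightarrow> 'm set" where
  "core i = (case i of (c, p, r, l) \<Rightarrow> region c (ball p r))"

definition closed_core :: "('m, 'e) chart_box \<Rightarrow> 'm set" where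
  "closed_core i = (case i of (c, p, r, l) \<Rightarrow> region c (cball p r))"

definition open_box :: "('m, 'e) chart_box \<Rightarrow> 'm set" where
  "open_box i = (case i of (c, p, r, l) \<Rightarrow> region c (ball p (2 * r)))"

definition closed_box :: "('m, 'e) chart_box \<Rightarrow> 'm set" where
  "closed_box i = (case i of (c, p, r, l) \<Rightarrow> region c (cball p (2 * r)))"

definition rim :: "('m, 'e) chart_box \<Rightarrow> 'm set" where
  "rim i = (case i of (c, p, r, l) \<Rightarrow> region c (sphere p (2 * r)))"

lemma box_parts:
  assumes "good i"
  shows "open (core i)" "open (open_box i)" "compact (closed_box i)" "closed (closed_core i)" "closed (rim i)"
    "core i \<subseteq> closed_core i" "closed_core i \<inter> rim i = {}" "core i \<subseteq> open_box i" "open_box i \<subseteq> closed_box i"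
    "closed_box i - open_box i = rim i" "closed_core i \<subseteq> closed_box i"
proof -
  obtain c p r l where i: "i = (c, p, r, l)" by (metis prod.exhaust)
  have g: "good_box c p r l" using assms by (simp add: good_def i)
  then have c: "c \<in> A" and r: "r > 0" and sub: "cball p (2 * r) \<subseteq> snd c ` fst c" by (auto simp: good_box_def)
  show "open (core i)" "open (open_box i)" using c by (simp_all add: core_def open_box_def i open_region)
  show "compact (closed_box i)" using compact_box[OF g] by (simp add: closed_box_def i)
  have sub2: "cball p r \<subseteq> cball p (2 * r)" "sphere p (2 * r) \<subseteq> cball p (2 * r)" using r by auto
  have cc: "compact (cball p s)" for s by (simp add: compact_eq_bounded_closed)
  have "sphere p (2 * r) = cball p (2 * r) - ball p (2 * r)" by auto
  then have "compact (sphere p (2 * r))" using compact_diff[OF cc open_ball] by simp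
  then have "compact (region c (cball p r))" "compact (region c (sphere p (2 * r)))"
    using cc sub sub2 subset_trans by (blast intro: compact_region[OF c])+
  then show "closed (closed_core i)" "closed (rim i)" using compact_imp_closed by (auto simp: closed_core_def rim_def i)
  show "core i \<subseteq> closed_core i" "closed_core i \<inter> rim i = {}" "core i \<subseteq> open_box i" "open_box i \<subseteq> closed_box i"
    "closed_box i - open_box i = rim i" "closed_core i \<subseteq> closed_box i"
    using r by (auto simp: core_def closed_core_def rim_def open_box_def closed_box_def i region_def)
qed

lemma arc_in_eq_box_closed:
  assumes "good i" "X \<longlonglongrightarrow> x" "Y \<longlonglongrightarrow> y" "\<And>n::nat. arc_in_eq (closed_box i) (X n) (Y n)"
  shows "arc_in_eq (closed_box i) x y"
proof -
  obtain c p r l where i: "i = (c, p, r, l)" by (metis prod.exhaust)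
  have g: "good_box c p r l" using assms by (simp add: good_def i)
  show ?thesis using arc_in_eq_closed[OF g assms(2,3)] assms(4) by (simp add: closed_box_def i)
qed

lemma good_exists:
  assumes "open V" "x \<in> V" shows "\<exists>i. good i \<and> x \<in> core i \<and> closed_box i \<subseteq> V"
proof -
  obtain c p r l where "good_box c p r l" "x \<in> region c (ball p r)" "region c (cball p (2 * r)) \<subseteq> V"
    using good_box_exists[OF assms] by blast
  then show ?thesis by (intro exI[of _ "(c, p, r, l)"]) (simp add: good_def core_def closed_box_def)
qed

text \<open>
  The compact layers \<open>S n\<close> of an exhaustion are covered by finitely many boxes inside
  the open shells \<open>V n\<close>; a compact set meets only finitely many shells.
\<close>
lemma locally_finite_box_cover:
  "\<exists>\<I>. (\<forall>i\<in>\<I>. good i) \<and> (\<Union>i\<in>\<I>. core i) = UNIV \<and> (\<forall>X. compact X \<longrightarrow> finite {i \<in> \<I>. closed_box i \<inter> X \<noteq> {}})"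
proof -
  obtain K :: "nat \<Rightarrow> 'm set" where K: "K 0 = {}" "\<And>n. compact (K n)" "\<And>n. K n \<subseteq> interior (K (Suc n))" "(\<Union>n. K n) = UNIV"
    using compact_exhaustion by blast
  have Kinc: "K m \<subseteq> K n" if "m \<le> n" for m n
  proof (rule lift_Suc_mono_le[OF _ that])
    show "K n \<subseteq> K (Suc n)" for n using K(3)[of n] interior_subset by (rule subset_trans)
  qed
  define S where "S n = K (Suc n) - interior (K n)" for n
  \<comment> \<open>for n = 0 the truncated n - 1 is 0, and nothing is removed\<close>
  define V where "V n = interior (K (Suc (Suc n))) - K (n - 1)" for n
  have SV: "S n \<subseteq> V n" for n
  proof (cases n)
    case 0
    then show ?thesis using K(1,3) by (auto simp: S_def V_def)
  next
    case (Suc m)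
    then show ?thesis using K(3)[of m] K(3)[of "Suc n"] by (auto simp: S_def V_def)
  qed
  have oV: "open (V n)" for n unfolding V_def using compact_imp_closed[OF K(2)] by (intro open_Diff) auto
  have cS: "compact (S n)" for n unfolding S_def using K(2) by (intro compact_diff) auto
  have "\<exists>I. finite I \<and> (\<forall>i\<in>I. good i \<and> closed_box i \<subseteq> V n) \<and> S n \<subseteq> (\<Union>i\<in>I. core i)" for n
  proof -
    have "\<forall>x\<in>S n. \<exists>i. good i \<and> x \<in> core i \<and> closed_box i \<subseteq> V n" using good_exists[OF oV] SV by blast
    then obtain f where f: "\<And>x. x \<in> S n \<Longrightarrow> good (f x) \<and> x \<in> core (f x) \<and> closed_box (f x) \<subseteq> V n" by metis
    have cov: "S n \<subseteq> (\<Union>x\<in>S n. core (f x))" using f by blast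
    obtain T where T: "T \<subseteq> S n" "finite T" "S n \<subseteq> (\<Union>x\<in>T. core (f x))"
      using compactE_image[OF cS _ cov] box_parts(1) f by metis
    then show ?thesis using f by (intro exI[of _ "f ` T"]) auto
  qed
  then obtain I where I: "\<And>n. finite (I n)" "\<And>n i. i \<in> I n \<Longrightarrow> good i \<and> closed_box i \<subseteq> V n" "\<And>n. S n \<subseteq> (\<Union>i\<in>I n. core i)"
    by metis
  have "x \<in> (\<Union>i\<in>(\<Union>n. I n). core i)" for x
  proof -
    have "\<exists>n. x \<in> K n" using K(4) by blast
    define m where "m = (LEAST n. x \<in> K n)"
    have m: "x \<in> K m" unfolding m_def using \<open>\<exists>n. x \<in> K n\<close> by (rule LeastI_ex)
    then obtain n where n: "m = Suc n" using K(1) by (cases m) auto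
    have "x \<notin> K n" using not_less_Least[of n "\<lambda>n. x \<in> K n"] n by (auto simp: m_def)
    then have "x \<in> S n" using m n interior_subset by (auto simp: S_def)
    then show ?thesis using I(3) by blast
  qed
  moreover have "finite {i \<in> (\<Union>n. I n). closed_box i \<inter> X \<noteq> {}}" if X: "compact X" for X
  proof -
    have cov: "X \<subseteq> (\<Union>n. interior (K (Suc n)))"
    proof
      fix x
      obtain n where "x \<in> K n" using K(4) by blast
      then show "x \<in> (\<Union>n. interior (K (Suc n)))" using K(3)[of n] by blast
    qed
    obtain T where T: "finite T" "X \<subseteq> (\<Union>n\<in>T. interior (K (Suc n)))"
      using compactE_image[OF X open_interior cov] by metis
    obtain M where M: "\<And>n. n \<in> T \<Longrightarrow> n \<le> M" using T(1) finite_nat_set_iff_bounded_le by auto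
    have "X \<subseteq> K (Suc M)"
    proof
      fix x assume "x \<in> X"
      then obtain n where "n \<in> T" "x \<in> K (Suc n)" using T(2) interior_subset by blast
      then show "x \<in> K (Suc M)" using M Kinc[of "Suc n" "Suc M"] by auto
    qed
    have "{i \<in> (\<Union>n. I n). closed_box i \<inter> X \<noteq> {}} \<subseteq> (\<Union>n\<in>{..Suc (Suc M)}. I n)"
    proof
      fix i assume "i \<in> {i \<in> (\<Union>n. I n). closed_box i \<inter> X \<noteq> {}}"
      then obtain n where n: "i \<in> I n" "closed_box i \<inter> X \<noteq> {}" by blast
      have "n \<le> Suc (Suc M)"
      proof (rule ccontr)
        assume "\<not> n \<le> Suc (Suc M)"
        then have "K (Suc M) \<subseteq> K (n - 1)" by (intro Kinc) auto
        then show False using n I(2)[OF n(1)] \<open>X \<subseteq> K (Suc M)\<close> by (auto simp: V_def)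
      qed
      then show "i \<in> (\<Union>n\<in>{..Suc (Suc M)}. I n)" using n(1) by blast
    qed
    then show ?thesis by (rule finite_subset) (simp add: I(1))
  qed
  moreover have "\<forall>i\<in>(\<Union>n. I n). good i" using I(2) by blast
  ultimately show ?thesis by (intro exI[of _ "\<Union>n. I n"] conjI allI impI) auto
qed

lemma inside_interval_step:
  assumes "causal_arc a b \<gamma>" "t \<in> {a<..<b}" "open U" "\<gamma> t \<in> U"
  shows "\<exists>d>0. a \<le> t - d \<and> t + d \<le> b \<and> \<gamma> ` {t - d..t + d} \<subseteq> U"
proof -
  have "isCont \<gamma> t" by (rule causal_arc_isCont[OF assms(1,2)])
  then have "\<forall>\<^sub>F s in at t. \<gamma> s \<in> U" using assms(3,4) unfolding isCont_def by (rule topological_tendstoD)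
  then obtain d where d: "d > 0" "\<And>s. s \<noteq> t \<Longrightarrow> dist s t < d \<Longrightarrow> \<gamma> s \<in> U" unfolding eventually_at by auto
  define e where "e = min (d / 2) (min (t - a) (b - t))"
  have e: "e > 0" "e < d" "a \<le> t - e" "t + e \<le> b" using d assms(2) by (auto simp: e_def min_def)
  have "\<gamma> s \<in> U" if "s \<in> {t - e..t + e}" for s
    using d(2)[of s] that e(2) assms(4) by (cases "s = t") (auto simp: dist_real_def)
  then show ?thesis using e by blast
qed

end

locale solvable_cone = cone_manifold A C
  for A :: "('m::{t2_space, second_countable_topology}, 'e::{real_inner, heine_borel}) chart set" and C +
  assumes solvable: "locally_solvable A C"
begin

lemma solution_through:
  assumes "x \<in> cone_domain C"
  shows "\<exists>\<gamma>. causal_arc (-1/2) (1/2) \<gamma> \<and> \<gamma> 0 = x"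
proof -
  obtain \<gamma> where \<gamma>: "causal_curve A C {-1<..<1} \<gamma>" "\<gamma> 0 = x" using solvable assms unfolding locally_solvable_def by blast
  have "causal_arc (-1/2) (1/2) \<gamma>" by (rule causal_curve_imp_causal_arc[OF \<gamma>(1)]) auto
  then show ?thesis using \<gamma>(2) by blast
qed

lemma short_segments:
  assumes "x \<in> cone_domain C" "open U" "x \<in> U"
  shows "\<exists>y. arc_in U x y" "\<exists>y. arc_in U y x"
proof -
  obtain \<gamma> where \<gamma>: "causal_arc (-1/2) (1/2) \<gamma>" "\<gamma> 0 = x" using solution_through[OF assms(1)] by blast
  obtain d where d: "d > 0" "-1/2 \<le> 0 - d" "0 + d \<le> 1/2" "\<gamma> ` {0 - d..0 + d} \<subseteq> U"
    using inside_interval_step[OF \<gamma>(1), of 0 U] assms \<gamma>(2) by auto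
  have "causal_arc 0 d \<gamma>" "causal_arc (- d) 0 \<gamma>" using d by (auto intro!: causal_arc_subinterval[OF \<gamma>(1)])
  moreover have "\<gamma> ` {0..d} \<subseteq> U" "\<gamma> ` {-d..0} \<subseteq> U" using d by auto
  ultimately show "\<exists>y. arc_in U x y" "\<exists>y. arc_in U y x" using causal_arc_imp_arc_in \<gamma>(2) by metis+
qed

text \<open>
  The points joined to \<open>x\<close> inside the box form a compact set, on which
  \<open>l\<close> is extremal at some \<open>y\<close>. If \<open>y\<close> were not on the rim, a
  short causal arc through \<open>y\<close> would stay in the box and change \<open>l\<close>
  further.
\<close>
lemma exit_box:
  assumes i: "good i" and x: "x \<in> open_box i" "x \<in> cone_domain C"
  shows "\<exists>y\<in>rim i. arc_in (closed_box i) x y" "\<exists>y\<in>rim i. arc_in (closed_box i) y x"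
proof -
  obtain c p r l where ieq: "i = (c, p, r, l)" by (metis prod.exhaust)
  have g: "good_box c p r l" using i by (simp add: good_def ieq)
  have Q: "closed_box i = region c (cball p (2 * r))" by (simp add: closed_box_def ieq)
  have c: "c \<in> A" and cb: "cone_box (local_cone c) (cball p (2 * r)) l" using g by (auto simp: good_box_def)
  have contl: "continuous_on (closed_box i) (\<lambda>y. l (snd c y))"
  proof -
    have "continuous_on (closed_box i) (snd c)" using continuous_on_chart[OF c] by (rule continuous_on_subset) (auto simp: Q region_def)
    then show ?thesis by (rule bounded_linear.continuous_on[OF cone_box.linear_l[OF cb]])
  qed
  have less: "l (snd c y) < l (snd c z)" if "arc_in (closed_box i) y z" for y z using arc_in_l_less[OF g] that by (simp add: Q)
  have xx: "arc_in_eq (closed_box i) x x" using x box_parts(9)[OF i] by (auto simp: arc_in_eq_def)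
  have cpt: "compact {y. arc_in_eq (closed_box i) x y}" "compact {y. arc_in_eq (closed_box i) y x}"
  proof -
    have "seq_compact {y. arc_in_eq (closed_box i) x y}"
    proof (rule seq_compactI)
      fix f :: "nat \<Rightarrow> 'm" assume f: "\<forall>n. f n \<in> {y. arc_in_eq (closed_box i) x y}"
      then have "\<forall>n. f n \<in> closed_box i" using arc_in_eq_endpoints by blast
      then obtain y s where "strict_mono s" "(f \<circ> s) \<longlonglongrightarrow> y"
        using compact_imp_seq_compact[OF box_parts(3)[OF i]] seq_compactE by metis
      moreover have "arc_in_eq (closed_box i) x y" using arc_in_eq_box_closed[OF i tendsto_const calculation(2), of x] f by auto
      ultimately show "\<exists>l\<in>{y. arc_in_eq (closed_box i) x y}. \<exists>r. strict_mono r \<and> (f \<circ> r) \<longlonglongrightarrow> l" by blast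
    qed
    then show "compact {y. arc_in_eq (closed_box i) x y}" by (simp add: seq_compact_eq_compact)
    have "seq_compact {y. arc_in_eq (closed_box i) y x}"
    proof (rule seq_compactI)
      fix f :: "nat \<Rightarrow> 'm" assume f: "\<forall>n. f n \<in> {y. arc_in_eq (closed_box i) y x}"
      then have "\<forall>n. f n \<in> closed_box i" using arc_in_eq_endpoints by blast
      then obtain y s where "strict_mono s" "(f \<circ> s) \<longlonglongrightarrow> y"
        using compact_imp_seq_compact[OF box_parts(3)[OF i]] seq_compactE by metis
      moreover have "arc_in_eq (closed_box i) y x" using arc_in_eq_box_closed[OF i calculation(2) tendsto_const, of x] f by auto
      ultimately show "\<exists>l\<in>{y. arc_in_eq (closed_box i) y x}. \<exists>r. strict_mono r \<and> (f \<circ> r) \<longlonglongrightarrow> l" by blast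
    qed
    then show "compact {y. arc_in_eq (closed_box i) y x}" by (simp add: seq_compact_eq_compact)
  qed
  have subs: "{y. arc_in_eq (closed_box i) x y} \<subseteq> closed_box i" "{y. arc_in_eq (closed_box i) y x} \<subseteq> closed_box i" using arc_in_eq_endpoints by blast+
  have xrim: "x \<notin> rim i" using x box_parts(10)[OF i] by blast
  obtain y where y: "arc_in_eq (closed_box i) x y" "\<And>z. arc_in_eq (closed_box i) x z \<Longrightarrow> l (snd c z) \<le> l (snd c y)"
    using continuous_attains_sup[OF cpt(1) _ continuous_on_subset[OF contl subs(1)]] xx by blast
  have "y \<in> rim i"
  proof (rule ccontr)
    assume "y \<notin> rim i"
    then have yi: "y \<in> open_box i" "y \<in> cone_domain C" using arc_in_eq_endpoints[OF y(1)] box_parts(10)[OF i] by blast+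
    obtain z where z: "arc_in (open_box i) y z" using short_segments(1)[OF yi(2) box_parts(2)[OF i] yi(1)] by blast
    then have z': "arc_in (closed_box i) y z" using arc_in_mono box_parts(9)[OF i] by blast
    then have "arc_in_eq (closed_box i) x z" using arc_in_eq_trans[OF y(1)] by (simp add: arc_in_eq_def)
    then show False using y(2) less[OF z'] by fastforce
  qed
  then show "\<exists>y\<in>rim i. arc_in (closed_box i) x y" using y(1) xrim unfolding arc_in_eq_def by blast
  obtain y where y: "arc_in_eq (closed_box i) y x" "\<And>z. arc_in_eq (closed_box i) z x \<Longrightarrow> l (snd c y) \<le> l (snd c z)"
    using continuous_attains_inf[OF cpt(2) _ continuous_on_subset[OF contl subs(2)]] xx by blast
  have "y \<in> rim i"
  proof (rule ccontr)
    assume "y \<notin> rim i"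
    then have yi: "y \<in> open_box i" "y \<in> cone_domain C" using arc_in_eq_endpoints[OF y(1)] box_parts(10)[OF i] by blast+
    obtain z where z: "arc_in (open_box i) z y" using short_segments(2)[OF yi(2) box_parts(2)[OF i] yi(1)] by blast
    then have z': "arc_in (closed_box i) z y" using arc_in_mono box_parts(9)[OF i] by blast
    then have "arc_in_eq (closed_box i) z x" using arc_in_eq_trans[OF _ y(1)] by (simp add: arc_in_eq_def)
    then show False using y(2) less[OF z'] by fastforce
  qed
  then show "\<exists>y\<in>rim i. arc_in (closed_box i) y x" using y(1) xrim unfolding arc_in_eq_def by blast
qed

end

section \<open>Limits of chains\<close>

lemma infinitely_often_in_finite:
  fixes f :: "nat \<Rightarrow> 'i"
  assumes "finite F" "\<forall>\<^sub>F n in sequentially. f n \<in> F"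
  shows "\<exists>i\<in>F. \<exists>r. strict_mono (r :: nat \<Rightarrow> nat) \<and> (\<forall>n. f (r n) = i)"
proof -
  obtain N where N: "\<And>n. n \<ge> N \<Longrightarrow> f n \<in> F" using assms(2) unfolding eventually_sequentially by blast
  have "f ` {N..} \<subseteq> F" using N by auto
  then have "finite (f ` {N..})" using assms(1) finite_subset by blast
  then obtain n where n: "n \<in> {N..}" "infinite {m \<in> {N..}. f m = f n}"
    using pigeonhole_infinite[of "{N..}" f] infinite_Ici[of N] by blast
  obtain r where "strict_mono (r :: nat \<Rightarrow> nat)" "\<And>k. r k \<in> {m \<in> {N..}. f m = f n}"
    using infinite_enumerate[OF n(2)] by blast
  then show ?thesis using N n(1) by (intro bexI[of _ "f n"] exI[of _ r]) auto
qed

text \<open>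
  Chains of increasing length, for a closed relation \<open>T\<close> that maps compact sets into
  compact sets, have a diagonal subsequence that converges at every position. Beyond its length a
  chain is continued by its last element, so that all \<open>k\<close>-th elements lie in one
  compact set.
\<close>
lemma chain_limit:
  fixes F :: "nat \<Rightarrow> nat \<Rightarrow> 'm::{t2_space, second_countable_topology}" and T :: "'m \<Rightarrow> 'm \<Rightarrow> bool"
  assumes bound: "\<And>X. compact X \<Longrightarrow> \<exists>Y. compact Y \<and> X \<subseteq> Y \<and> (\<forall>x\<in>X. \<forall>y. T x y \<longrightarrow> y \<in> Y)"
    and closed: "\<And>X Y x y. X \<longlonglongrightarrow> x \<Longrightarrow> Y \<longlonglongrightarrow> y \<Longrightarrow> (\<And>n. T (X n) (Y n)) \<Longrightarrow> T x y"
    and start: "compact X0" "\<And>n. F n 0 \<in> X0"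
    and steps: "\<And>n k. k < len n \<Longrightarrow> T (F n k) (F n (Suc k))" and len: "\<And>n. n \<le> len n"
  shows "\<exists>s h. strict_mono s \<and> (\<forall>k. (\<lambda>n. F (s n) k) \<longlonglongrightarrow> h k) \<and> (\<forall>k. T (h k) (h (Suc k)))"
proof -
  define G where "G n k = F n (min k (len n))" for n k
  have cpt: "\<exists>Y. compact Y \<and> (\<forall>n. G n k \<in> Y)" for k
  proof (induction k)
    case 0
    then show ?case using start by (auto simp: G_def)
  next
    case (Suc k)
    then obtain X where X: "compact X" "\<And>n. G n k \<in> X" by blast
    obtain Y where Y: "compact Y" "X \<subseteq> Y" "\<And>x y. x \<in> X \<Longrightarrow> T x y \<Longrightarrow> y \<in> Y" using bound[OF X(1)] by blast
    have "G n (Suc k) \<in> Y" for n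
    proof (cases "k < len n")
      case True
      then have "T (G n k) (G n (Suc k))" using steps[of k n] by (simp add: G_def)
      then show ?thesis using X(2) Y(3) by blast
    next
      case False
      then have "G n (Suc k) = G n k" by (simp add: G_def)
      then show ?thesis using X(2)[of n] Y(2) by auto
    qed
    then show ?case using Y(1) by blast
  qed
  interpret subseqs "\<lambda>k s. \<exists>y. (\<lambda>n. G (s n) k) \<longlonglongrightarrow> y"
  proof
    fix k :: nat and s :: "nat \<Rightarrow> nat"
    obtain Y where Y: "compact Y" "\<And>n. G n k \<in> Y" using cpt by blast
    then obtain y r where "strict_mono r" "((\<lambda>n. G (s n) k) \<circ> r) \<longlonglongrightarrow> y"
      using seq_compactE[OF compact_imp_seq_compact[OF Y(1)], of "\<lambda>n. G (s n) k"] by metis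
    then show "\<exists>r'. strict_mono r' \<and> (\<exists>y. (\<lambda>n. G ((s \<circ> r') n) k) \<longlonglongrightarrow> y)" by (auto simp: o_def)
  qed
  define s where "s = diagseq"
  have s: "strict_mono s" unfolding s_def by (rule subseq_diagseq)
  have "\<exists>y. (\<lambda>n. G (s n) k) \<longlonglongrightarrow> y" for k
  proof -
    have "\<exists>y. (\<lambda>n. G ((diagseq \<circ> (+) (Suc k)) n) k) \<longlonglongrightarrow> y"
    proof (rule diagseq_holds)
      fix r t :: "nat \<Rightarrow> nat" and n assume rt: "strict_mono r" "\<exists>y. (\<lambda>m. G (t m) n) \<longlonglongrightarrow> y"
      then obtain y where "(\<lambda>m. G (t m) n) \<longlonglongrightarrow> y" by blast
      from LIMSEQ_subseq_LIMSEQ[OF this rt(1)] show "\<exists>y. (\<lambda>m. G ((t \<circ> r) m) n) \<longlonglongrightarrow> y" by (auto simp: o_def)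
    qed
    then obtain y where "(\<lambda>n. G (diagseq (n + Suc k)) k) \<longlonglongrightarrow> y" by (auto simp: add.commute)
    then have "(\<lambda>n. G (diagseq n) k) \<longlonglongrightarrow> y" by (rule LIMSEQ_offset)
    then show ?thesis by (auto simp: s_def)
  qed
  then obtain h where h: "\<And>k. (\<lambda>n. G (s n) k) \<longlonglongrightarrow> h k" by metis
  have big: "k \<le> len (s n)" if "k \<le> n" for k n
    using that len[of "s n"] seq_suble[OF s, of n] by linarith
  have "(\<lambda>n. F (s n) k) \<longlonglongrightarrow> h k" for k
  proof -
    have "\<forall>\<^sub>F n in sequentially. G (s n) k = F (s n) k"
      unfolding eventually_sequentially using big by (intro exI[of _ k]) (auto simp: G_def)
    then show ?thesis using h tendsto_cong by fastforce
  qed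
  moreover have "T (h k) (h (Suc k))" for k
  proof (rule closed)
    show "(\<lambda>n. G (s (n + Suc k)) k) \<longlonglongrightarrow> h k" by (rule LIMSEQ_ignore_initial_segment[OF h])
    show "(\<lambda>n. G (s (n + Suc k)) (Suc k)) \<longlonglongrightarrow> h (Suc k)" by (rule LIMSEQ_ignore_initial_segment[OF h])
    show "T (G (s (n + Suc k)) k) (G (s (n + Suc k)) (Suc k))" for n
      using big[of "Suc k" "n + Suc k"] steps[of k "s (n + Suc k)"] by (simp add: G_def min_def)
  qed
  ultimately show ?thesis using s by blast
qed

section \<open>Chains of steps\<close>

locale covered_cone = solvable_cone A C
  for A :: "('m::{t2_space, second_countable_topology}, 'e::{real_inner, heine_borel}) chart set" and C +
  fixes \<I> :: "('m, 'e) chart_box set"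
  assumes good_index: "\<And>i. i \<in> \<I> \<Longrightarrow> good i"
    and cover: "(\<Union>i\<in>\<I>. core i) = UNIV"
    and locally_finite: "\<And>X. compact X \<Longrightarrow> finite {i \<in> \<I>. closed_box i \<inter> X \<noteq> {}}"
begin

text \<open>
  Symmetric in \<open>x\<close> and \<open>y\<close>, so that divergence and compactness arguments
  for chains hold in both time directions.
\<close>
definition across :: "('m, 'e) chart_box \<Rightarrow> 'm \<Rightarrow> 'm \<Rightarrow> bool" where
  "across i x y \<longleftrightarrow> x \<in> closed_core i \<and> y \<in> rim i \<or> x \<in> rim i \<and> y \<in> closed_core i"

definition step :: "'m \<Rightarrow> 'm \<Rightarrow> bool" where
  "step x y \<longleftrightarrow> (\<exists>i\<in>\<I>. across i x y \<and> arc_in_eq (closed_box i) x y)"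

lemma across_commute: "across i x y \<longleftrightarrow> across i y x"
  by (auto simp: across_def)

lemma rim_subset: "good i \<Longrightarrow> rim i \<subseteq> closed_box i"
  using box_parts(10) by blast

lemma across_box: "i \<in> \<I> \<Longrightarrow> across i x y \<Longrightarrow> x \<in> closed_box i \<and> y \<in> closed_box i"
  using box_parts(11)[OF good_index] rim_subset[OF good_index] unfolding across_def by blast

lemma step_imp_arc_in: "step x y \<Longrightarrow> arc_in UNIV x y"
  unfolding step_def across_def arc_in_eq_def using box_parts(7)[OF good_index] arc_in_mono[OF _ subset_UNIV] by blast

text \<open>
  A compact neighbourhood of a limit point \<open>q\<close> meets finitely many boxes, so one box
  is crossed infinitely often. Then \<open>q\<close> lies both in its closed core and on its rim.
\<close>
lemma zigzag_diverges:
  assumes "\<And>n. \<exists>i\<in>\<I>. across i (h n) (h (Suc n))"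
  shows "\<nexists>q. h \<longlonglongrightarrow> q"
proof
  assume "\<exists>q. h \<longlonglongrightarrow> q"
  then obtain q where q: "h \<longlonglongrightarrow> q" by blast
  obtain i where i: "\<And>n. i n \<in> \<I>" "\<And>n. across (i n) (h n) (h (Suc n))" using assms by metis
  obtain Y where Y: "compact Y" "{q} \<subseteq> interior Y" using compact_neighbourhood[of "{q}"] by auto
  have "\<forall>\<^sub>F n in sequentially. h n \<in> interior Y" using q Y(2) by (intro topological_tendstoD) auto
  then have "\<forall>\<^sub>F n in sequentially. i n \<in> {i \<in> \<I>. closed_box i \<inter> Y \<noteq> {}}"
    by eventually_elim (use i across_box interior_subset in blast)
  from infinitely_often_in_finite[OF locally_finite[OF Y(1)] this]
  obtain j r where j: "j \<in> \<I>" and r: "strict_mono (r :: nat \<Rightarrow> nat)" "\<And>n. i (r n) = j" by blast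
  have acr: "across j (h (r n)) (h (Suc (r n)))" for n using i(2)[of "r n"] r(2) by simp
  have l1: "(\<lambda>n. h (r n)) \<longlonglongrightarrow> q" using LIMSEQ_subseq_LIMSEQ[OF q r(1)] by (simp add: o_def)
  have l2: "(\<lambda>n. h (Suc (r n))) \<longlonglongrightarrow> q" using LIMSEQ_subseq_LIMSEQ[OF LIMSEQ_Suc[OF q] r(1)] by (simp add: o_def)
  have mem: "q \<in> S" if S: "closed S" "\<And>n. h (r n) \<in> S \<or> h (Suc (r n)) \<in> S" for S
  proof (rule ccontr)
    assume "q \<notin> S"
    then have "open (- S)" "q \<in> - S" using S(1) by auto
    then have "\<forall>\<^sub>F n in sequentially. h (r n) \<in> - S" "\<forall>\<^sub>F n in sequentially. h (Suc (r n)) \<in> - S"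
      using topological_tendstoD[OF l1] topological_tendstoD[OF l2] by blast+
    then have "\<forall>\<^sub>F n in sequentially. False" by eventually_elim (use S(2) in blast)
    then show False by simp
  qed
  have "q \<in> closed_core j" "q \<in> rim j"
    using acr box_parts(4,5)[OF good_index[OF j]] by (auto intro!: mem simp: across_def)
  then show False using box_parts(7)[OF good_index[OF j]] by blast
qed

text \<open>
  Near \<open>x\<close> only finitely many boxes can serve, so one of them serves for a
  subsequence.
\<close>
lemma step_closed:
  assumes X: "X \<longlonglongrightarrow> x" and Y: "Y \<longlonglongrightarrow> y" and st: "\<And>n::nat. step (X n) (Y n)"
  shows "step x y"
proof -
  obtain i where i: "\<And>n. i n \<in> \<I>" "\<And>n. across (i n) (X n) (Y n)" "\<And>n. arc_in_eq (closed_box (i n)) (X n) (Y n)"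
    using st unfolding step_def by metis
  obtain Z where Z: "compact Z" "{x} \<subseteq> interior Z" using compact_neighbourhood[of "{x}"] by auto
  have "\<forall>\<^sub>F n in sequentially. X n \<in> interior Z" using X Z(2) by (intro topological_tendstoD) auto
  then have "\<forall>\<^sub>F n in sequentially. i n \<in> {i \<in> \<I>. closed_box i \<inter> Z \<noteq> {}}"
    by eventually_elim (use i across_box interior_subset in blast)
  from infinitely_often_in_finite[OF locally_finite[OF Z(1)] this]
  obtain j r where j: "j \<in> \<I>" and r: "strict_mono (r :: nat \<Rightarrow> nat)" "\<And>n. i (r n) = j" by blast
  have lX: "(\<lambda>n. X (r n)) \<longlonglongrightarrow> x" using LIMSEQ_subseq_LIMSEQ[OF X r(1)] by (simp add: o_def)
  have lY: "(\<lambda>n. Y (r n)) \<longlonglongrightarrow> y" using LIMSEQ_subseq_LIMSEQ[OF Y r(1)] by (simp add: o_def)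
  have "arc_in_eq (closed_box j) x y"
    by (rule arc_in_eq_box_closed[OF good_index[OF j] lX lY]) (use i(3)[of "r _"] r(2) in simp)
  moreover have "across j x y"
  proof -
    let ?S = "closed_core j \<times> rim j \<union> rim j \<times> closed_core j"
    have "closed ?S" using box_parts(4,5)[OF good_index[OF j]] by (intro closed_Un closed_Times)
    moreover have "(X (r n), Y (r n)) \<in> ?S" for n using i(2)[of "r n"] r(2) by (auto simp: across_def)
    ultimately have "(x, y) \<in> ?S" using tendsto_Pair[OF lX lY] by (intro Lim_in_closed_set) auto
    then show ?thesis by (auto simp: across_def)
  qed
  ultimately show ?thesis using j unfolding step_def by blast
qed

lemma boxes_compact:
  assumes "compact X" shows "\<exists>Y. compact Y \<and> X \<subseteq> Y \<and> (\<forall>i\<in>\<I>. closed_box i \<inter> X \<noteq> {} \<longrightarrow> closed_box i \<subseteq> Y)"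
proof (intro exI conjI)
  show "compact (X \<union> (\<Union>i\<in>{i \<in> \<I>. closed_box i \<inter> X \<noteq> {}}. closed_box i))"
    using locally_finite[OF assms] box_parts(3) good_index by (intro compact_Un assms compact_UN) auto
qed auto

lemma step_bounds:
  assumes "compact X"
  shows "\<exists>Y. compact Y \<and> X \<subseteq> Y \<and> (\<forall>x\<in>X. \<forall>y. step x y \<longrightarrow> y \<in> Y)"
    "\<exists>Y. compact Y \<and> X \<subseteq> Y \<and> (\<forall>x\<in>X. \<forall>y. step y x \<longrightarrow> y \<in> Y)"
proof -
  obtain Y where Y: "compact Y" "X \<subseteq> Y" "\<And>i. i \<in> \<I> \<Longrightarrow> closed_box i \<inter> X \<noteq> {} \<Longrightarrow> closed_box i \<subseteq> Y"
    using boxes_compact[OF assms] by blast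
  have "y \<in> Y" if "x \<in> X" "step x y \<or> step y x" for x y
  proof -
    obtain i where i: "i \<in> \<I>" "across i x y" using \<open>step x y \<or> step y x\<close> across_commute unfolding step_def by blast
    then have "x \<in> closed_box i" "y \<in> closed_box i" using across_box by blast+
    then show ?thesis using Y(3)[OF i(1)] \<open>x \<in> X\<close> by blast
  qed
  then show "\<exists>Y. compact Y \<and> X \<subseteq> Y \<and> (\<forall>x\<in>X. \<forall>y. step x y \<longrightarrow> y \<in> Y)"
    "\<exists>Y. compact Y \<and> X \<subseteq> Y \<and> (\<forall>x\<in>X. \<forall>y. step y x \<longrightarrow> y \<in> Y)"
    using Y(1,2) by blast+
qed

lemma core_index: "\<exists>i\<in>\<I>. x \<in> core i"
  using cover by blast

lemma step_exists:
  assumes "x \<in> cone_domain C" shows "\<exists>y. step x y" "\<exists>y. step y x"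
proof -
  obtain i where i: "i \<in> \<I>" "x \<in> core i" using core_index by blast
  note g = good_index[OF i(1)]
  have x: "x \<in> open_box i" "x \<in> closed_core i" using box_parts(6,8)[OF g] i(2) by blast+
  obtain y where "y \<in> rim i" "arc_in (closed_box i) x y" using exit_box(1)[OF g x(1) assms] by blast
  then show "\<exists>y. step x y" using i(1) x(2) unfolding step_def across_def arc_in_eq_def by blast
  obtain y where "y \<in> rim i" "arc_in (closed_box i) y x" using exit_box(2)[OF g x(1) assms] by blast
  then show "\<exists>y. step y x" using i(1) x(2) unfolding step_def across_def arc_in_eq_def by blast
qed

lemma step_domain: "step x y \<Longrightarrow> x \<in> cone_domain C \<and> y \<in> cone_domain C"
  using step_imp_arc_in arc_in_domain by blast

lemma future_chain:
  assumes "x \<in> cone_domain C" shows "\<exists>h. h 0 = x \<and> (\<forall>n. step (h n) (h (Suc n)))"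
proof -
  have "\<exists>h. \<forall>n::nat. (h n \<in> cone_domain C \<and> (n = 0 \<longrightarrow> h n = x)) \<and> step (h n) (h (Suc n))"
    using assms step_exists(1) step_domain by (intro dependent_nat_choice) blast+
  then show ?thesis by blast
qed

lemma past_chain:
  assumes "x \<in> cone_domain C" shows "\<exists>h. h 0 = x \<and> (\<forall>n. step (h (Suc n)) (h n))"
proof -
  have "\<exists>h. \<forall>n::nat. (h n \<in> cone_domain C \<and> (n = 0 \<longrightarrow> h n = x)) \<and> step (h (Suc n)) (h n)"
    using assms step_exists(2) step_domain by (intro dependent_nat_choice) blast+
  then show ?thesis by blast
qed

lemma step_chain_diverges:
  "(\<And>n. step (h n) (h (Suc n))) \<Longrightarrow> \<nexists>q. h \<longlonglongrightarrow> q"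
  "(\<And>n. step (h (Suc n)) (h n)) \<Longrightarrow> \<nexists>q. h \<longlonglongrightarrow> q"
  using zigzag_diverges across_commute unfolding step_def by blast+

definition precedes :: "'m \<Rightarrow> 'm \<Rightarrow> bool" where "precedes x y \<longleftrightarrow> arc_in_eq UNIV x y"

lemma precedes_iff: "precedes x y \<longleftrightarrow> y \<in> causal_future A C x"
  unfolding precedes_def arc_in_eq_def causal_future_iff by auto

lemma precedes_trans: "precedes x y \<Longrightarrow> precedes y z \<Longrightarrow> precedes x z"
  unfolding precedes_def by (rule arc_in_eq_trans)

lemma step_imp_precedes: "step x y \<Longrightarrow> precedes x y"
  using step_imp_arc_in by (simp add: precedes_def arc_in_eq_def)

lemma arc_in_eq_imp_precedes: "arc_in_eq Q x y \<Longrightarrow> precedes x y"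
  unfolding precedes_def by (rule arc_in_eq_mono) auto

text \<open>
  Take a box with \<open>\<gamma> t\<close> in its core and follow the arc until it first leaves
  the interior of the box. At that time it is on the rim, and if there is no such time the rest of
  the arc stays in the box.
\<close>
lemma first_exit:
  assumes \<gamma>: "causal_arc 0 1 \<gamma>" and t: "t \<in> {0..1}"
  shows "(\<exists>s\<in>{t<..1}. step (\<gamma> t) (\<gamma> s)) \<or> (\<exists>i\<in>\<I>. arc_in_eq (closed_box i) (\<gamma> t) (\<gamma> 1))"
proof -
  obtain i where i: "i \<in> \<I>" "\<gamma> t \<in> core i" using core_index by blast
  note g = good_index[OF i(1)]
  have cont: "continuous_on {0..1} \<gamma>" by (rule causal_arc_continuous[OF \<gamma>])
  have ti: "\<gamma> t \<in> open_box i" using box_parts(8)[OF g] i(2) by blast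
  have sub: "arc_in (closed_box i) (\<gamma> t) (\<gamma> s)" if "t < s" "s \<le> 1" "\<gamma> ` {t..s} \<subseteq> closed_box i" for s
    using that t by (intro causal_arc_imp_arc_in causal_arc_subinterval[OF \<gamma>]) auto
  define S where "S = {s \<in> {t..1}. \<gamma> s \<in> - open_box i}"
  show ?thesis
  proof (cases "S = {}")
    case True
    then have im: "\<gamma> ` {t..1} \<subseteq> closed_box i" using box_parts(9)[OF g] by (auto simp: S_def)
    have "arc_in_eq (closed_box i) (\<gamma> t) (\<gamma> 1)"
    proof (cases "t = 1")
      case True
      then show ?thesis using im causal_arc_domain[OF \<gamma> t] by (auto simp: arc_in_eq_def)
    next
      case False
      then show ?thesis using sub[of 1] t im by (simp add: arc_in_eq_def)
    qed
    then show ?thesis using i(1) by blast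
  next
    case False
    have "closed S"
      unfolding S_def using continuous_on_subset[OF cont, of "{t..1}"] t box_parts(2)[OF g]
      by (intro continuous_closed_preimage[of "{t..1}" \<gamma> "- open_box i", unfolded vimage_def Int_def mem_Collect_eq] ) auto
    define s where "s = Inf S"
    have bdd: "bdd_below S" by (auto simp: S_def bdd_below_def)
    have s: "s \<in> S" unfolding s_def using closed_contains_Inf[OF False bdd \<open>closed S\<close>] .
    have before: "\<gamma> u \<in> open_box i" if "t \<le> u" "u < s" for u
      using cInf_lower[OF _ bdd, of u] that s by (force simp: s_def S_def)
    have ts: "t < s" using s ti by (cases "t = s") (auto simp: S_def)
    have "\<gamma> s \<in> closed_box i"
    proof (rule ccontr)
      assume "\<gamma> s \<notin> closed_box i"
      then have "\<forall>\<^sub>F u in at s within {0..1}. \<gamma> u \<in> - closed_box i"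
        using cont s t compact_imp_closed[OF box_parts(3)[OF g]] unfolding continuous_on_def
        by (intro topological_tendstoD) (auto simp: S_def)
      then obtain d where d: "d > 0" "\<And>u. u \<in> {0..1} \<Longrightarrow> u \<noteq> s \<Longrightarrow> dist u s < d \<Longrightarrow> \<gamma> u \<notin> closed_box i"
        unfolding eventually_at by auto
      define u where "u = max t (s - d / 2)"
      have "t \<le> u" "u < s" "dist u s < d" using d(1) ts by (auto simp: u_def dist_real_def)
      moreover have "u \<in> {0..1}" using \<open>t \<le> u\<close> \<open>u < s\<close> s t by (auto simp: S_def)
      ultimately show False using d(2)[of u] before[of u] box_parts(9)[OF g] by auto
    qed
    then have rim: "\<gamma> s \<in> rim i" using s box_parts(10)[OF g] by (auto simp: S_def)
    have "\<gamma> u \<in> closed_box i" if "u \<in> {t..s}" for u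
      using before[of u] that \<open>\<gamma> s \<in> closed_box i\<close> box_parts(9)[OF g] by (cases "u = s") auto
    then have "arc_in (closed_box i) (\<gamma> t) (\<gamma> s)" using ts s by (intro sub) (auto simp: S_def)
    then have "step (\<gamma> t) (\<gamma> s)"
      unfolding step_def across_def arc_in_eq_def using i rim box_parts(6)[OF g] by blast
    moreover have "s \<in> {t<..1}" using ts s by (auto simp: S_def)
    ultimately show ?thesis by blast
  qed
qed

text \<open>
  Steps are split off at the first exit times. If this never ended, the increasing exit times would
  converge, and so would the infinite chain of exit points.
\<close>
lemma chain_decomposition:
  assumes "precedes x z"
  shows "\<exists>N y. (step ^^ N) x y \<and> (\<exists>i\<in>\<I>. arc_in_eq (closed_box i) y z)"
proof (cases "arc_in UNIV x z")
  case False
  then have x: "x = z" "x \<in> cone_domain C" using assms by (auto simp: precedes_def arc_in_eq_def)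
  obtain i where i: "i \<in> \<I>" "x \<in> core i" using core_index by blast
  then have "arc_in_eq (closed_box i) x z" using x box_parts(6,11)[OF good_index[OF i(1)]] by (auto simp: arc_in_eq_def)
  then show ?thesis using i(1) by (intro exI[of _ 0] exI[of _ x]) auto
next
  case True
  then obtain \<gamma> where \<gamma>: "causal_arc 0 1 \<gamma>" "\<gamma> 0 = x" "\<gamma> 1 = z" unfolding arc_in_def by blast
  show ?thesis
  proof (rule ccontr)
    assume no: "\<not> ?thesis"
    let ?P = "\<lambda>t. t \<in> {0..1} \<and> (\<exists>N. (step ^^ N) x (\<gamma> t))"
    have "\<exists>t. \<forall>n::nat. ?P (t n) \<and> (t n < t (Suc n) \<and> step (\<gamma> (t n)) (\<gamma> (t (Suc n))))"
    proof (rule dependent_nat_choice)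
      have "(step ^^ 0) x (\<gamma> 0)" using \<gamma>(2) by simp
      then have "\<exists>N. (step ^^ N) x (\<gamma> 0)" by blast
      then show "\<exists>t. ?P t" by (intro exI[of _ "0::real"] conjI) simp
      fix t :: real and n :: nat assume t: "?P t"
      then obtain N where N: "(step ^^ N) x (\<gamma> t)" by blast
      then have "\<not> (\<exists>i\<in>\<I>. arc_in_eq (closed_box i) (\<gamma> t) (\<gamma> 1))" using no \<gamma>(3) by blast
      then obtain s where s: "s \<in> {t<..1}" "step (\<gamma> t) (\<gamma> s)" using first_exit[OF \<gamma>(1), of t] t by blast
      have "(step ^^ Suc N) x (\<gamma> s)" using N s(2) by auto
      then have "\<exists>N. (step ^^ N) x (\<gamma> s)" by blast
      moreover have "s \<in> {0..1}" "t < s" using s(1) t by auto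
      ultimately show "\<exists>s. ?P s \<and> (t < s \<and> step (\<gamma> t) (\<gamma> s))" using s(2) by blast
    qed
    then obtain t where t: "\<And>n. t n \<in> {0..1}" "\<And>n. t n < t (Suc n)" "\<And>n. step (\<gamma> (t n)) (\<gamma> (t (Suc n)))" by blast
    have "incseq t" using t(2) by (intro incseq_SucI less_imp_le)
    then obtain q where q: "t \<longlonglongrightarrow> q" using incseq_convergent[of t 1] t(1) by (metis atLeastAtMost_iff)
    have "q \<in> {0..1}" by (rule Lim_in_closed_set[OF closed_atLeastAtMost _ _ q]) (use t(1) in auto)
    then have "(\<lambda>n. \<gamma> (t n)) \<longlonglongrightarrow> \<gamma> q"
      using continuous_on_tendsto_compose[OF causal_arc_continuous[OF \<gamma>(1)] q] t(1) by simp
    then show False using step_chain_diverges(1)[of "\<lambda>n. \<gamma> (t n)"] t(3) by blast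
  qed
qed

end

section \<open>Cauchy subsets\<close>

locale cauchy_cone = covered_cone A C \<I>
  for A :: "('m::{t2_space, second_countable_topology}, 'e::{real_inner, heine_borel}) chart set" and C \<I> +
  fixes H Nb Up Um :: "'m set"
  assumes domain_nbhd: "cone_domain C \<subseteq> interior Nb"
    and open_Up: "openin (top_of_set Nb) Up" and open_Um: "openin (top_of_set Nb) Um"
    and disjoint: "Up \<inter> Um = {}" "Up \<inter> (Nb \<inter> H) = {}" "Um \<inter> (Nb \<inter> H) = {}"
    and crossing: "\<And>\<gamma>. inextensible_causal_curve A C UNIV \<gamma> \<Longrightarrow>
           \<exists>a b. a \<le> b \<and> \<gamma> ` {..<a} \<subseteq> Um \<and> \<gamma> ` {b<..} \<subseteq> Up \<and> \<gamma> ` {a..b} \<subseteq> H"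
begin

text \<open>
  The two chains are glued to one inextensible curve with \<open>f n\<close> at time
  \<open>n\<close> and \<open>b n\<close> at time \<open>- n\<close>. Its points lie in
  \<open>Nb\<close>, as they are in the domain, so that membership in \<open>Um\<close>,
  \<open>H\<close> or \<open>Up\<close> reveals on which side of the crossing interval they are.
\<close>
lemma chain_crossing:
  assumes f: "\<And>n. arc_in UNIV (f n) (f (Suc n))" "\<nexists>q. f \<longlonglongrightarrow> q"
    and b: "\<And>n. arc_in UNIV (b (Suc n)) (b n)" "\<nexists>q. b \<longlonglongrightarrow> q" and eq: "f 0 = b 0"
  shows "\<exists>n. \<forall>m\<ge>n. f m \<in> Up" "\<exists>n. \<forall>m\<ge>n. b m \<in> Um" "\<not> (f 0 \<in> Up \<and> f (Suc 0) \<in> Um)"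
proof -
  \<comment> \<open>one chain indexed by the integers: f forwards and b backwards from their common first point\<close>
  define z where "z k = (if k \<ge> 0 then f (nat k) else b (nat (- k)))" for k :: int
  have "arc_in UNIV (z k) (z (k + 1))" for k
  proof (cases "k \<ge> 0")
    case True
    then show ?thesis using f(1)[of "nat k"] by (simp add: z_def nat_add_distrib)
  next
    case False
    define m where "m = nat (- k - 1)"
    have m: "nat (- k) = Suc m" "nat (- (k + 1)) = m" using False by (auto simp: m_def)
    have "z (k + 1) = b m"
    proof (cases "k = -1")
      case True
      then show ?thesis using m eq by (simp add: z_def)
    next
      case False
      then show ?thesis using \<open>\<not> k \<ge> 0\<close> m by (simp add: z_def)
    qed
    then show ?thesis using b(1)[of m] False m by (simp add: z_def)
  qed
  from chain_curve[of z, OF this] obtain \<gamma> where \<gamma>: "causal_curve A C UNIV \<gamma>" "\<And>k. \<gamma> (of_int k) = z k" by blast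
  have \<gamma>f: "\<gamma> (real n) = f n" for n using \<gamma>(2)[of "int n"] by (simp add: z_def)
  have \<gamma>b: "\<gamma> (- real n) = b n" for n using \<gamma>(2)[of "- int n"] eq by (cases "n = 0") (auto simp: z_def)
  have "inextensible_causal_curve A C UNIV \<gamma>"
    by (rule inextensible_if_no_limits[OF \<gamma>(1)]) (use f(2) b(2) in \<open>simp_all add: \<gamma>f \<gamma>b\<close>)
  then obtain s t where st: "s \<le> t" "\<gamma> ` {..<s} \<subseteq> Um" "\<gamma> ` {t<..} \<subseteq> Up" "\<gamma> ` {s..t} \<subseteq> H"
    using crossing by blast
  have um: "\<gamma> u \<in> Um" if "u < s" for u using subsetD[OF st(2) imageI] that by simp
  have up: "\<gamma> u \<in> Up" if "t < u" for u using subsetD[OF st(3) imageI] that by simp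
  have mid: "\<gamma> u \<in> H" if "s \<le> u" "u \<le> t" for u using subsetD[OF st(4) imageI] that by simp
  obtain n :: nat where n: "t < n" using reals_Archimedean2 by blast
  have "f m \<in> Up" if "m \<ge> n" for m
    using up[of "real m"] \<gamma>f[of m] n that by simp
  then show "\<exists>n. \<forall>m\<ge>n. f m \<in> Up" by blast
  obtain n :: nat where n: "- s < n" using reals_Archimedean2 by blast
  have "b m \<in> Um" if "m \<ge> n" for m
    using um[of "- real m"] \<gamma>b[of m] n that by simp
  then show "\<exists>n. \<forall>m\<ge>n. b m \<in> Um" by blast
  show "\<not> (f 0 \<in> Up \<and> f (Suc 0) \<in> Um)"
  proof
    assume A: "f 0 \<in> Up \<and> f (Suc 0) \<in> Um"
    have "f 0 \<in> Nb" "f (Suc 0) \<in> Nb" using arc_in_domain[OF f(1)[of 0]] domain_nbhd interior_subset by blast+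
    then have "f 0 \<notin> H" "f 0 \<notin> Um" "f (Suc 0) \<notin> H" "f (Suc 0) \<notin> Up" using A disjoint by blast+
    then have "\<not> 0 < s" "\<not> (s \<le> 0 \<and> 0 \<le> t)" "\<not> t < 1" "\<not> (s \<le> 1 \<and> 1 \<le> t)"
      using um[of 0] mid[of 0] up[of 1] mid[of 1] \<gamma>f[of 0] \<gamma>f[of "Suc 0"] by auto
    then show False using st(1) by linarith
  qed
qed

text \<open>
  \<open>U\<close> is only open relative to \<open>Nb\<close>, but \<open>Nb\<close> is a
  neighbourhood of every point of the domain.
\<close>
lemma open_interior_part:
  assumes "x \<in> cone_domain C" "openin (top_of_set Nb) U" "x \<in> U" "X \<longlonglongrightarrow> x"
  shows "\<forall>\<^sub>F n in sequentially. X n \<in> U"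
proof -
  obtain W where W: "open W" "U = Nb \<inter> W" using assms(2) by (auto simp: openin_open)
  have "\<forall>\<^sub>F n in sequentially. X n \<in> interior Nb \<inter> W"
    using assms domain_nbhd W by (intro topological_tendstoD[OF assms(4)]) auto
  then show ?thesis by eventually_elim (use W interior_subset in blast)
qed

text \<open>
  An arc from \<open>x\<close> to \<open>y\<close> is prolonged by infinite chains into the past of
  \<open>x\<close> and the future of \<open>y\<close>.
\<close>
lemma no_return:
  assumes "precedes x y" "x \<in> Up" "y \<in> Um" shows False
proof -
  have "x \<noteq> y" using assms disjoint by blast
  then have xy: "arc_in UNIV x y" using assms(1) by (auto simp: precedes_def arc_in_eq_def)
  obtain b where b: "b 0 = x" "\<And>n. step (b (Suc n)) (b n)" using past_chain arc_in_domain[OF xy] by blast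
  obtain f where f: "f 0 = y" "\<And>n. step (f n) (f (Suc n))" using future_chain arc_in_domain[OF xy] by blast
  define h where "h n = (case n of 0 \<Rightarrow> x | Suc m \<Rightarrow> f m)" for n
  have 1: "arc_in UNIV (h n) (h (Suc n))" for n
    using xy f step_imp_arc_in by (cases n) (auto simp: h_def)
  have 2: "\<nexists>q. h \<longlonglongrightarrow> q"
  proof
    assume "\<exists>q. h \<longlonglongrightarrow> q"
    then obtain q where "h \<longlonglongrightarrow> q" by blast
    then have "(\<lambda>n. h (Suc n)) \<longlonglongrightarrow> q" by (rule LIMSEQ_Suc)
    then have "f \<longlonglongrightarrow> q" by (simp add: h_def)
    then show False using step_chain_diverges(1)[of f] f(2) by blast
  qed
  have 3: "arc_in UNIV (b (Suc n)) (b n)" for n using b(2) step_imp_arc_in by blast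
  have 4: "\<nexists>q. b \<longlonglongrightarrow> q" using step_chain_diverges(2)[of b] b(2) by blast
  have "h 0 = b 0" using b(1) by (simp add: h_def)
  from chain_crossing(3)[OF 1 2 3 4 this] show False using assms f(1) by (simp add: h_def)
qed

lemma future_chain_enters:
  assumes "\<And>n. step (f n) (f (Suc n))" shows "\<exists>n. f n \<in> Up"
proof -
  obtain b where b: "b 0 = f 0" "\<And>n. step (b (Suc n)) (b n)"
    using past_chain step_domain[OF assms[of 0]] by blast
  have "\<exists>n. \<forall>m\<ge>n. f m \<in> Up"
    using chain_crossing(1)[of f b] assms b step_imp_arc_in step_chain_diverges by metis
  then show ?thesis by blast
qed

lemma past_chain_enters:
  assumes "\<And>n. step (b (Suc n)) (b n)" shows "\<exists>n. b n \<in> Um"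
proof -
  obtain f where f: "f 0 = b 0" "\<And>n. step (f n) (f (Suc n))"
    using future_chain step_domain[OF assms[of 0]] by blast
  have "\<exists>n. \<forall>m\<ge>n. b m \<in> Um"
    using chain_crossing(2)[of f b] assms f step_imp_arc_in step_chain_diverges by metis
  then show ?thesis by blast
qed

text \<open>
  From arbitrarily long chains one obtains two limits, one along their starts and one along their
  ends. They enter \<open>Up\<close> and \<open>Um\<close> at finite positions \<open>k\<close> and
  \<open>m\<close>, and so do the approximating chains; as soon as the length exceeds \<open>k +
  m\<close>, this contradicts the absence of causal curves from \<open>Up\<close> to
  \<open>Um\<close>.
\<close>
lemma chain_length_bounded:
  assumes K: "compact K" "compact K'"
  shows "\<exists>M. \<forall>N x y z i. x \<in> K \<longrightarrow> z \<in> K' \<longrightarrow> (step ^^ N) x y \<longrightarrow> i \<in> \<I> \<longrightarrow> arc_in_eq (closed_box i) y z \<longrightarrow> N < M"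
proof (rule ccontr)
  assume "\<not> ?thesis"
  then have "\<forall>M. \<exists>N x y z i. x \<in> K \<and> z \<in> K' \<and> (step ^^ N) x y \<and> i \<in> \<I> \<and> arc_in_eq (closed_box i) y z \<and> M \<le> N"
    by (meson not_less)
  then obtain L x y z i where *: "\<And>M. x M \<in> K" "\<And>M. z M \<in> K'" "\<And>M. (step ^^ L M) (x M) (y M)"
    "\<And>M. i M \<in> \<I>" "\<And>M. arc_in_eq (closed_box (i M)) (y M) (z M)" "\<And>M. M \<le> L M" by metis
  have "\<exists>f. f 0 = x M \<and> f (L M) = y M \<and> (\<forall>k<L M. step (f k) (f (Suc k)))" for M
    using *(3)[of M] by (simp add: relpowp_fun_conv)
  then obtain F where F: "\<And>M. F M 0 = x M" "\<And>M. F M (L M) = y M" "\<And>M k. k < L M \<Longrightarrow> step (F M k) (F M (Suc k))" by metis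
  obtain Z where Z: "compact Z" "\<And>i. i \<in> \<I> \<Longrightarrow> closed_box i \<inter> K' \<noteq> {} \<Longrightarrow> closed_box i \<subseteq> Z" using boxes_compact[OF K(2)] by blast
  have yZ: "y M \<in> Z" for M using Z(2)[OF *(4)[of M]] arc_in_eq_endpoints[OF *(5)[of M]] *(2)[of M] by blast
  obtain s f where s: "strict_mono s" "\<And>k. (\<lambda>n. F (s n) k) \<longlonglongrightarrow> f k" "\<And>k. step (f k) (f (Suc k))"
  proof -
    have "\<exists>s f. strict_mono s \<and> (\<forall>k. (\<lambda>n. F (s n) k) \<longlonglongrightarrow> f k) \<and> (\<forall>k. step (f k) (f (Suc k)))"
      by (rule chain_limit[of step K F L, OF step_bounds(1) step_closed K(1) _ F(3) *(6)]) (simp_all add: F(1) *(1))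
    then show ?thesis using that by blast
  qed
  \<comment> \<open>the selected chains, read backwards from their last element\<close>
  define G where "G n m = F (s n) (L (s n) - m)" for n m
  have Gstep: "step (G n (Suc m)) (G n m)" if "m < L (s n)" for n m
    using F(3)[of "L (s n) - Suc m" "s n"] that by (simp add: G_def Suc_diff_Suc)
  have Ls: "n \<le> L (s n)" for n using seq_suble[OF s(1), of n] *(6)[of "s n"] by linarith
  have GZ: "G n 0 \<in> Z" for n using yZ F(2) by (simp add: G_def)
  obtain s' g where s': "strict_mono s'" "\<And>k. (\<lambda>n. G (s' n) k) \<longlonglongrightarrow> g k" "\<And>k. step (g (Suc k)) (g k)"
  proof -
    have "\<exists>s' g. strict_mono s' \<and> (\<forall>k. (\<lambda>n. G (s' n) k) \<longlonglongrightarrow> g k) \<and> (\<forall>k. step (g (Suc k)) (g k))"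
      by (rule chain_limit[of "\<lambda>a b. step b a" Z G "\<lambda>n. L (s n)", OF step_bounds(2) step_closed Z(1) GZ Gstep Ls])
    then show ?thesis using that by blast
  qed
  obtain k where k: "f k \<in> Up" using future_chain_enters[of f] s(3) by blast
  obtain m where m: "g m \<in> Um" using past_chain_enters[of g] s'(3) by blast
  have Flim: "(\<lambda>n. F (s (s' n)) k) \<longlonglongrightarrow> f k" using LIMSEQ_subseq_LIMSEQ[OF s(2) s'(1)] by (simp add: o_def)
  have "\<forall>\<^sub>F n in sequentially. F (s (s' n)) k \<in> Up"
    using step_domain[OF s(3)] by (intro open_interior_part[OF _ open_Up k Flim]) simp
  moreover have "\<forall>\<^sub>F n in sequentially. G (s' n) m \<in> Um"
    using step_domain[OF s'(3)] by (intro open_interior_part[OF _ open_Um m s'(2)]) simp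
  moreover have "\<forall>\<^sub>F n in sequentially. k + m < n" by (rule eventually_gt_at_top)
  ultimately have "\<forall>\<^sub>F n in sequentially. False"
  proof eventually_elim
    case (elim n)
    define M where "M = s (s' n)"
    have "n \<le> L M" using seq_suble[OF s(1), of "s' n"] seq_suble[OF s'(1), of n] *(6)[of M] unfolding M_def by linarith
    then have km: "k < L M - m" using elim(3) by linarith
    have reach: "precedes (F M k) (F M (k + d))" if "k + d \<le> L M" for d
      using that
    proof (induction d)
      case 0
      then have "k < L M" using km by simp
      then show ?case using step_domain[OF F(3)] by (simp add: precedes_def arc_in_eq_def)
    next
      case (Suc d)
      then show ?case using F(3)[of "k + d" M] step_imp_precedes precedes_trans by (metis add_Suc_right Suc_le_eq less_imp_le)
    qed
    have "precedes (F M k) (F M (L M - m))" using reach[of "L M - m - k"] km by simp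
    then show ?case using no_return elim(1,2) unfolding G_def M_def by blast
  qed
  then show False by simp
qed

text \<open>
  The limit is taken one step at a time: the second element of the chains stays in a compact set,
  so it converges along a subsequence.
\<close>
lemma precedes_closed_bounded:
  assumes "\<And>n::nat. (step ^^ N) (X n) (Y n)" "\<And>n. i n \<in> \<I>" "\<And>n. arc_in_eq (closed_box (i n)) (Y n) (Z n)"
    and "X \<longlonglongrightarrow> x" "Z \<longlonglongrightarrow> z"
  shows "precedes x z"
  using assms
proof (induction N arbitrary: X Y Z i x)
  case 0
  then have YX: "Y n = X n" for n by (metis relpowp_0_E)
  obtain W where W: "compact W" "{x} \<subseteq> interior W" using compact_neighbourhood[of "{x}"] by auto
  have "\<forall>\<^sub>F n in sequentially. X n \<in> interior W" using 0(4) W(2) by (intro topological_tendstoD) auto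
  then have "\<forall>\<^sub>F n in sequentially. i n \<in> {i \<in> \<I>. closed_box i \<inter> W \<noteq> {}}"
  proof eventually_elim
    case (elim n)
    then have "X n \<in> W" using interior_subset by blast
    moreover have "X n \<in> closed_box (i n)" using arc_in_eq_endpoints[OF 0(3)[of n]] YX[of n] by auto
    ultimately show ?case using 0(2)[of n] by blast
  qed
  from infinitely_often_in_finite[OF locally_finite[OF W(1)] this]
  obtain j r where j: "j \<in> \<I>" and r: "strict_mono (r :: nat \<Rightarrow> nat)" "\<And>n. i (r n) = j" by blast
  have "arc_in_eq (closed_box j) x z"
  proof (rule arc_in_eq_box_closed[OF good_index[OF j] LIMSEQ_subseq_LIMSEQ[OF 0(4) r(1)] LIMSEQ_subseq_LIMSEQ[OF 0(5) r(1)]])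
    show "arc_in_eq (closed_box j) ((X \<circ> r) n) ((Z \<circ> r) n)" for n using 0(3)[of "r n"] YX r(2)[of n] by simp
  qed
  then show ?case by (rule arc_in_eq_imp_precedes)
next
  case (Suc N)
  have "\<exists>u. step (X n) u \<and> (step ^^ N) u (Y n)" for n using Suc.prems(1)[of n] by (metis relpowp_Suc_D2)
  then obtain U where U: "\<And>n. step (X n) (U n)" "\<And>n. (step ^^ N) (U n) (Y n)" by metis
  obtain W where W: "compact W" "{x} \<subseteq> interior W" using compact_neighbourhood[of "{x}"] by auto
  have "\<forall>\<^sub>F n in sequentially. X n \<in> interior W" using Suc.prems(4) W(2) by (intro topological_tendstoD) auto
  then obtain n0 where n0: "\<And>n. n \<ge> n0 \<Longrightarrow> X n \<in> interior W" unfolding eventually_sequentially by blast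
  obtain V where V: "compact V" "\<And>x y. x \<in> W \<Longrightarrow> step x y \<Longrightarrow> y \<in> V" using step_bounds(1)[OF W(1)] by blast
  have "U (n + n0) \<in> V" for n
  proof (rule V(2)[OF _ U(1)])
    show "X (n + n0) \<in> W" using n0[of "n + n0"] interior_subset by auto
  qed
  then obtain u r where r: "strict_mono r" "((\<lambda>n. U (n + n0)) \<circ> r) \<longlonglongrightarrow> u"
    using seq_compactE[OF compact_imp_seq_compact[OF V(1)], of "\<lambda>n. U (n + n0)"] by blast
  define q where "q n = r n + n0" for n
  have q: "strict_mono q" using r(1) by (simp add: strict_mono_def q_def)
  have Uq: "(\<lambda>n. U (q n)) \<longlonglongrightarrow> u" using r(2) by (simp add: q_def o_def)
  have Xq: "(\<lambda>n. X (q n)) \<longlonglongrightarrow> x" using LIMSEQ_subseq_LIMSEQ[OF Suc.prems(4) q] by (simp add: o_def)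
  have Zq: "(\<lambda>n. Z (q n)) \<longlonglongrightarrow> z" using LIMSEQ_subseq_LIMSEQ[OF Suc.prems(5) q] by (simp add: o_def)
  have "step x u" by (rule step_closed[OF Xq Uq U(1)])
  moreover have "precedes u z"
    by (rule Suc.IH[of "\<lambda>n. U (q n)" "\<lambda>n. Y (q n)" "\<lambda>n. i (q n)" "\<lambda>n. Z (q n)" u, OF _ _ _ Uq Zq])
      (use U(2) Suc.prems(2,3) in auto)
  ultimately show ?case using step_imp_precedes precedes_trans by blast
qed

lemma precedes_closed:
  assumes K: "compact K" "compact K'" and XZ: "\<And>n::nat. X n \<in> K" "\<And>n. Z n \<in> K'" "\<And>n. precedes (X n) (Z n)"
    and lim: "X \<longlonglongrightarrow> x" "Z \<longlonglongrightarrow> z"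
  shows "precedes x z"
proof -
  obtain M where M: "\<And>N x y z i. x \<in> K \<Longrightarrow> z \<in> K' \<Longrightarrow> (step ^^ N) x y \<Longrightarrow> i \<in> \<I> \<Longrightarrow> arc_in_eq (closed_box i) y z \<Longrightarrow> N < M"
    using chain_length_bounded[OF K] by blast
  have "\<exists>N y i. (step ^^ N) (X n) y \<and> i \<in> \<I> \<and> arc_in_eq (closed_box i) y (Z n)" for n
    using chain_decomposition[OF XZ(3)[of n]] by blast
  then obtain L Y i where Y: "\<And>n. (step ^^ L n) (X n) (Y n)" "\<And>n. i n \<in> \<I>" "\<And>n. arc_in_eq (closed_box (i n)) (Y n) (Z n)" by metis
  have "\<forall>\<^sub>F n in sequentially. L n \<in> {..<M}" using M XZ(1,2) Y by (intro always_eventually) blast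
  from infinitely_often_in_finite[OF _ this]
  obtain k r where r: "strict_mono (r :: nat \<Rightarrow> nat)" "\<And>n. L (r n) = k" by blast
  show ?thesis
  proof (rule precedes_closed_bounded[of k "X \<circ> r" "Y \<circ> r" "i \<circ> r" "Z \<circ> r"])
    show "(step ^^ k) ((X \<circ> r) n) ((Y \<circ> r) n)" for n using Y(1)[of "r n"] r(2)[of n] by simp
    show "(X \<circ> r) \<longlonglongrightarrow> x" "(Z \<circ> r) \<longlonglongrightarrow> z" using lim r(1) LIMSEQ_subseq_LIMSEQ by blast+
  qed (use Y in auto)
qed

lemma chain_in_compact:
  assumes "compact K" shows "\<exists>Y. compact Y \<and> (\<forall>N\<le>M. \<forall>x\<in>K. \<forall>y. (step ^^ N) x y \<longrightarrow> y \<in> Y)"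
proof (induction M)
  case 0
  then show ?case using assms by (intro exI[of _ K]) auto
next
  case (Suc M)
  then obtain Y where Y: "compact Y" "\<And>N x y. N \<le> M \<Longrightarrow> x \<in> K \<Longrightarrow> (step ^^ N) x y \<Longrightarrow> y \<in> Y" by blast
  obtain Z where Z: "compact Z" "Y \<subseteq> Z" "\<And>x y. x \<in> Y \<Longrightarrow> step x y \<Longrightarrow> y \<in> Z" using step_bounds(1)[OF Y(1)] by blast
  have "y \<in> Z" if *: "N \<le> Suc M" "x \<in> K" "(step ^^ N) x y" for N x y
  proof (cases "N \<le> M")
    case True
    then show ?thesis using Y(2) * Z(2) by blast
  next
    case False
    then have "N = Suc M" using * by simp
    then obtain u where "(step ^^ M) x u" "step u y" using *(3) by auto
    then show ?thesis using Y(2)[of M x u] *(2) Z(3) by blast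
  qed
  then show ?case using Z(1) by blast
qed

text \<open>
  A chain from \<open>x\<close> to near \<open>y\<close>, followed by one towards \<open>z\<close>,
  is again a chain from \<open>K\<close> to \<open>K'\<close>, so its length is bounded, and
  \<open>y\<close> lies in a box met by chains of bounded length.
\<close>
lemma causal_diamond_bounded:
  assumes K: "compact K" "compact K'"
  shows "\<exists>W. compact W \<and> (\<forall>x y z. x \<in> K \<longrightarrow> z \<in> K' \<longrightarrow> precedes x y \<longrightarrow> precedes y z \<longrightarrow> y \<in> W)"
proof -
  obtain M where M: "\<And>N x y z i. x \<in> K \<Longrightarrow> z \<in> K' \<Longrightarrow> (step ^^ N) x y \<Longrightarrow> i \<in> \<I> \<Longrightarrow> arc_in_eq (closed_box i) y z \<Longrightarrow> N < M"
    using chain_length_bounded[OF K] by blast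
  obtain Y where Y: "compact Y" "\<And>N x y. N \<le> M \<Longrightarrow> x \<in> K \<Longrightarrow> (step ^^ N) x y \<Longrightarrow> y \<in> Y"
    using chain_in_compact[OF K(1), of M] by blast
  obtain W where W: "compact W" "\<And>i. i \<in> \<I> \<Longrightarrow> closed_box i \<inter> Y \<noteq> {} \<Longrightarrow> closed_box i \<subseteq> W" using boxes_compact[OF Y(1)] by blast
  have "y \<in> W" if xz: "x \<in> K" "z \<in> K'" and precedes: "precedes x y" "precedes y z" for x y z
  proof -
    obtain N u i where u: "(step ^^ N) x u" "i \<in> \<I>" "arc_in_eq (closed_box i) u y" using chain_decomposition[OF precedes(1)] by blast
    have "precedes u z" using arc_in_eq_imp_precedes[OF u(3)] precedes(2) by (rule precedes_trans)
    then obtain N' v j where v: "(step ^^ N') u v" "j \<in> \<I>" "arc_in_eq (closed_box j) v z" using chain_decomposition by blast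
    have "(step ^^ (N + N')) x v" using u(1) v(1) by (auto simp: relpowp_add)
    then have "N + N' < M" using M xz v by blast
    then have "u \<in> Y" using Y(2)[of N x u] xz u(1) by auto
    then show ?thesis using W(2)[OF u(2)] arc_in_eq_endpoints[OF u(3)] by blast
  qed
  then show ?thesis using W(1) by blast
qed

lemma compact_causal_diamond:
  assumes K: "compact K" "compact K'"
  shows "compact ((\<Union>x\<in>K. causal_future A C x) \<inter> (\<Union>x\<in>K'. causal_past A C x))"
proof -
  let ?D = "{y. \<exists>x\<in>K. \<exists>z\<in>K'. precedes x y \<and> precedes y z}"
  have D: "(\<Union>x\<in>K. causal_future A C x) \<inter> (\<Union>x\<in>K'. causal_past A C x) = ?D"
    by (auto simp: causal_past_def precedes_iff)
  obtain W where W: "compact W" "\<And>x y z. x \<in> K \<Longrightarrow> z \<in> K' \<Longrightarrow> precedes x y \<Longrightarrow> precedes y z \<Longrightarrow> y \<in> W"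
    using causal_diamond_bounded[OF K] by blast
  have "seq_compact ?D"
  proof (rule seq_compactI)
    fix Y :: "nat \<Rightarrow> 'm" assume "\<forall>n. Y n \<in> ?D"
    then obtain X Z where XZ: "\<And>n. X n \<in> K" "\<And>n. Z n \<in> K'" "\<And>n. precedes (X n) (Y n)" "\<And>n. precedes (Y n) (Z n)"
      unfolding mem_Collect_eq by metis
    have YW: "Y n \<in> W" for n using W(2) XZ by blast
    have "seq_compact (K \<times> W \<times> K')" using K W(1) by (intro compact_imp_seq_compact compact_Times)
    moreover have "\<forall>n. (X n, Y n, Z n) \<in> K \<times> W \<times> K'" using XZ YW by blast
    ultimately obtain p r where p: "p \<in> K \<times> W \<times> K'" "strict_mono r" "((\<lambda>n. (X n, Y n, Z n)) \<circ> r) \<longlonglongrightarrow> p"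
      by (rule seq_compactE)
    obtain x y z where xyz: "p = (x, y, z)" by (metis prod.exhaust)
    have l: "(\<lambda>n. X (r n)) \<longlonglongrightarrow> x" "(\<lambda>n. Y (r n)) \<longlonglongrightarrow> y" "(\<lambda>n. Z (r n)) \<longlonglongrightarrow> z"
      using tendsto_fst[OF p(3)] tendsto_fst[OF tendsto_snd[OF p(3)]] tendsto_snd[OF tendsto_snd[OF p(3)]] by (auto simp: xyz o_def)
    have "precedes x y" using precedes_closed[OF K(1) W(1) _ _ _ l(1,2)] XZ YW by blast
    moreover have "precedes y z" using precedes_closed[OF W(1) K(2) _ _ _ l(2,3)] XZ YW by blast
    ultimately have "y \<in> ?D" using p(1) xyz by blast
    then show "\<exists>l\<in>?D. \<exists>r. strict_mono r \<and> (Y \<circ> r) \<longlonglongrightarrow> l" using l(2) p(2) by (auto simp: o_def)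
  qed
  then show ?thesis by (simp add: D seq_compact_eq_compact)
qed

text \<open>
  A closed arc through \<open>x\<close> also passes through a second point. Alternating between the
  two points gives a chain that diverges in both directions and is the same in the past and in the
  future.
\<close>
lemma no_closed_curve: "\<not> arc_in UNIV x x"
proof
  assume "arc_in UNIV x x"
  then obtain \<gamma> where \<gamma>: "causal_arc 0 1 \<gamma>" "\<gamma> 0 = x" "\<gamma> 1 = x" unfolding arc_in_def by blast
  obtain t where t: "t \<in> {0<..<1}" "\<gamma> t \<noteq> x" using causal_arc_nonconstant[OF \<gamma>(1)] \<gamma>(2) by auto
  have xy: "arc_in UNIV x (\<gamma> t)" "arc_in UNIV (\<gamma> t) x"
    using causal_arc_imp_arc_in[OF causal_arc_subinterval[OF \<gamma>(1), of 0 t], of UNIV]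
      causal_arc_imp_arc_in[OF causal_arc_subinterval[OF \<gamma>(1), of t 1], of UNIV] t \<gamma> by auto
  define f where "f n = (if even n then x else \<gamma> t)" for n :: nat
  have 1: "arc_in UNIV (f n) (f (Suc n))" "arc_in UNIV (f (Suc n)) (f n)" for n using xy by (auto simp: f_def)
  have 2: "\<nexists>q. f \<longlonglongrightarrow> q"
  proof
    assume "\<exists>q. f \<longlonglongrightarrow> q"
    then obtain q where q: "f \<longlonglongrightarrow> q" by blast
    have "strict_mono (\<lambda>n::nat. 2 * n)" "strict_mono (\<lambda>n::nat. 2 * n + 1)" by (auto simp: strict_mono_def)
    from LIMSEQ_subseq_LIMSEQ[OF q this(1)] LIMSEQ_subseq_LIMSEQ[OF q this(2)]
    have "x = q" "\<gamma> t = q" by (simp_all add: f_def o_def LIMSEQ_const_iff)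
    then show False using t(2) by simp
  qed
  obtain n m where "\<forall>k\<ge>n. f k \<in> Up" "\<forall>k\<ge>m. f k \<in> Um"
    using chain_crossing(1,2)[OF 1(1) 2 1(2) 2 refl] by blast
  then have "f (n + m) \<in> Up \<inter> Um" by simp
  then show False using disjoint(1) by blast
qed

theorem globally_hyperbolic_cone: "globally_hyperbolic A C"
  unfolding globally_hyperbolic_def hyperbolic_def causal_def
  using solvable compact_causal_diamond no_closed_curve by (auto simp: strict_causal_future_iff)

end

theorem proposition2p2:
  fixes A :: "('m::{t2_space, second_countable_topology}, 'e::{real_inner, heine_borel}) chart set"
    and C :: "('m \<times> ('m, 'e) tangent_vector) set"
  assumes "smooth_atlas A"
    and "closed_cone_field A C"
    and "locally_solvable A C"
    and "\<exists>H. cauchy_subset A C H"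
  shows "globally_hyperbolic A C"
proof -
  interpret solvable_cone A C
    using assms(1-3) by unfold_locales
  obtain \<I> where "(\<forall>i\<in>\<I>. good i) \<and> (\<Union>i\<in>\<I>. core i) = UNIV \<and>
      (\<forall>X. compact X \<longrightarrow> finite {i \<in> \<I>. closed_box i \<inter> X \<noteq> {}})"
    using locally_finite_box_cover by (rule exE)
  then have \<I>: "\<And>i. i \<in> \<I> \<Longrightarrow> good i" "(\<Union>i\<in>\<I>. core i) = UNIV"
    "\<And>X. compact X \<Longrightarrow> finite {i \<in> \<I>. closed_box i \<inter> X \<noteq> {}}"
    by simp_all
  obtain H N Up Um where H: "cone_domain C \<subseteq> interior N"
      "openin (top_of_set N) Up" "openin (top_of_set N) Um"
      "Up \<inter> Um = {}" "Up \<inter> (N \<inter> H) = {}" "Um \<inter> (N \<inter> H) = {}"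
      "\<And>\<gamma>. inextensible_causal_curve A C UNIV \<gamma> \<Longrightarrow>
           (\<exists>a b. a \<le> b \<and> \<gamma> ` {..<a} \<subseteq> Um \<and> \<gamma> ` {b<..} \<subseteq> Up \<and> \<gamma> ` {a..b} \<subseteq> H)"
    using assms(4) unfolding cauchy_subset_def by metis
  interpret cauchy_cone A C \<I> H N Up Um
    by unfold_locales (use \<I> H in simp_all)
  show ?thesis by (rule globally_hyperbolic_cone)
qed

end
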